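(* In the setting described in the context, let $\epsilon\in(0,1)$, let $\boldsymbol\nu\in\mathfrak F$ be a multi-index, and suppose that Assumption A1 holds. Then for all $\boldsymbol y\in U$ the corresponding derivative of the smallest eigenvalue is bounded by $$|\partial^{\boldsymbol\nu}_{\boldsymbol y}\lambda_1(\boldsymbol y)|\;\le\;\overline{\lambda_1}\,(|\boldsymbol\nu|!)^{1+\epsilon}\,\boldsymbol\beta^{\boldsymbol\nu},$$ and the norm of the derivative of the corresponding eigenfunction is similarly bounded by $$\|\partial^{\boldsymbol\nu}_{\boldsymbol y}u_1(\boldsymbol y)\|_V\;\le\;\overline{u_1}\,(|\boldsymbol\nu|!)^{1+\epsilon}\,\boldsymbol\beta^{\boldsymbol\nu},$$ where the sequence $\boldsymbol\beta=(\beta_j)_{j\in\mathbb N}$ is defined by $$\beta_j=C_{\boldsymbol\beta}\max\big(\|a_j\|_{L^\infty(D)},\|b_j\|_{L^\infty(D)}\big),$$ with $C_{\boldsymbol\beta}>0$ independent of $\boldsymbol y$, given by $$C_{\boldsymbol\beta}=\frac1{C_{\rm gap}}\,\frac{a_{\min}^2\,\overline{\lambda_1}}{a_{\max}^2\,\underline{\lambda_1}}\left(\frac{3\overline{\lambda_1}}{2\underline{\lambda_1}}\,C_\epsilon+1\right),\qquad C_\epsilon=\frac{2^{1-\epsilon}}{1-2^{-\epsilon}}\Big(\frac{e^2}{\sqrt{2\pi}}\Big)^{\epsilon},\qquad C_{\rm gap}=\frac{a_{\min}\,\delta}{\overline{\lambda_2}},$$ and $\delta>0$ is a constant, independent of $\boldsymbol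 y$, such that $\lambda_2(\boldsymbol y)-\lambda_1(\boldsymbol y)\ge\delta$ for all $\boldsymbol y\in U$.
   Context: Setting. Let $d\in\{1,2,3\}$, let $D\subset\mathbb R^d$ be a bounded convex domain with Lipschitz boundary, $V=H^1_0(D)$ (real-valued) with norm $\|v\|_V=\|\nabla v\|_{L^2(D)}$, and $U=[-\tfrac12,\tfrac12]^{\mathbb N}$. For $\boldsymbol x\in D$, $\boldsymbol y=(y_j)_{j\ge1}\in U$ let $a(\boldsymbol x,\boldsymbol y)=a_0(\boldsymbol x)+\sum_{j\ge1}y_ja_j(\boldsymbol x)$, $b(\boldsymbol x,\boldsymbol y)=b_0(\boldsymbol x)+\sum_{j\ge1}y_jb_j(\boldsymbol x)$, and let $c=c(\boldsymbol x)$. Assumption A1: (1) $a_j,b_j\in L^\infty(D)$ for all $j\ge0$ and $c\in L^\infty(D)$. (2) There is $a_{\min}>0$ with $a(\boldsymbol x,\boldsymbol y)\ge a_{\min}$, $b(\boldsymbol x,\boldsymbol y)\ge0$, $c(\boldsymbol x)\ge a_{\min}$ for all $\boldsymbol x\in D,\boldsymbol y\in U$. (3) For some $p\in(0,1)$, $\sum_{j\ge1}\|a_j\|_{L^\infty(D)}^p<\infty$ and $\sum_{j\ge1}\|b_j\|_{L^\infty(D)}^p<\infty$. (4) $a_j\in W^{1,\infty}(D)$ for $j\ge0$ and $\sum_{j\ge1}\|a_j\|_{W^{1,\infty}(D)}<\infty$, where $\|v\|_{W^{1,\infty}(D)}=\max\{\|v\|_{L^\infty(D)},\|\nabla v\|_{L^\infty(D)}\}$.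 Put $a_{\max}=\max\{\sup_{\boldsymbol y\in U}\|a(\cdot,\boldsymbol y)\|_{L^\infty(D)},\sup_{\boldsymbol y\in U}\|b(\cdot,\boldsymbol y)\|_{L^\infty(D)},\|c\|_{L^\infty(D)}\}$. Let $\mathcal A(\boldsymbol y;w,v)=\int_D a(\boldsymbol x,\boldsymbol y)\nabla w\cdot\nabla v\,d\boldsymbol x+\int_D b(\boldsymbol x,\boldsymbol y)wv\,d\boldsymbol x$, $\mathcal M(w,v)=\int_D c\,wv\,d\boldsymbol x$, $\|v\|_{\mathcal M}=\sqrt{\mathcal M(v,v)}$. For each $\boldsymbol y\in U$ the eigenvalue problem is: find $\lambda(\boldsymbol y)\in\mathbb R$, $0\ne u(\boldsymbol y)\in V$ with $\mathcal A(\boldsymbol y;u(\boldsymbol y),v)=\lambda(\boldsymbol y)\mathcal M(u(\boldsymbol y),v)$ for all $v\in V$ and $\|u(\boldsymbol y)\|_{\mathcal M}=1$. Its eigenvalues, counted with multiplicity, are $0<\lambda_1(\boldsymbol y)\le\lambda_2(\boldsymbol y)\le\cdots$; $\lambda_1(\boldsymbol y)$ is simple, with normalised eigenfunction $u_1(\boldsymbol y)$. It is known that simple eigenpairs are analytic in $\boldsymbol y$, so the partial derivatives of $\lambda_1$ and $u_1$ exist, with $\partial^{\boldsymbol\nu}_{\boldsymbol y}u_1(\boldsymbol y)\in V$. Under Assumption A1 a uniform gap constant $\delta>0$ as in the claim exists. Constants: $0<\chi_1<\chi_2\le\cdots$ are the Dirichlet eigenvalues of $-\Delta$ on $D$; $\underline{\lambda_k}=\frac{a_{\min}}{a_{\max}}\chi_k$;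 $\overline{\lambda_k}=\frac{a_{\max}}{a_{\min}}(\chi_k+1)$; $\overline{u_1}=\frac{\sqrt{a_{\max}(\chi_1+1)}}{a_{\min}}$. Multi-indices: $\mathfrak F$ is the set of sequences $\boldsymbol\nu=(\nu_j)_{j\in\mathbb N}$ of nonnegative integers with finitely many nonzero entries; $|\boldsymbol\nu|=\sum_j\nu_j$; $\boldsymbol\beta^{\boldsymbol\nu}=\prod_j\beta_j^{\nu_j}$; $\partial^{\boldsymbol\nu}_{\boldsymbol y}$ is the mixed partial derivative of order $\nu_j$ in $y_j$ for each $j$. *)

theory Defs
  imports "HOL-Analysis.Analysis" "HOL-Probability.Essential_Supremum"
begin

section \<open>Domains\<close>

text \<open>
  Locally, up to a choice of an axis \<open>e\<close>, the set is the part of a small ball above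
  the graph of a Lipschitz function of the coordinates orthogonal to \<open>e\<close>.
\<close>

definition lipschitz_boundary :: "(real^'n) set \<Rightarrow> bool" where
  "lipschitz_boundary D \<longleftrightarrow>
     (\<forall>z\<in>frontier D. \<exists>r>0. \<exists>e L. \<exists>\<gamma> :: real^'n \<Rightarrow> real.
        norm e = 1 \<and> L-lipschitz_on UNIV \<gamma> \<and>
        D \<inter> ball z r = {x \<in> ball z r. x \<bullet> e > \<gamma> (x - (x \<bullet> e) *\<^sub>R e)})"

definition convex_lipschitz_domain :: "(real^'n) set \<Rightarrow> bool" where
  "convex_lipschitz_domain D \<longleftrightarrow>
     open D \<and> connected D \<and> D \<noteq> {} \<and> bounded D \<and> convex D \<and> lipschitz_boundary D"


section \<open>Lebesgue and Sobolev spaces\<close>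

text \<open>
  Elements of the function spaces are represented by functions on the whole space, of which only the
  restriction to \<open>D\<close>, up to equality almost everywhere, is relevant.
\<close>

definition L2 :: "(real^'n) set \<Rightarrow> (real^'n \<Rightarrow> 'b::euclidean_space) set" where
  "L2 D = {f. f \<in> borel_measurable (lebesgue_on D) \<and>
              integrable (lebesgue_on D) (\<lambda>x. (norm (f x))\<^sup>2)}"

definition L2_norm :: "(real^'n) set \<Rightarrow> (real^'n \<Rightarrow> 'b::euclidean_space) \<Rightarrow> real" where
  "L2_norm D f = sqrt (LINT x|lebesgue_on D. (norm (f x))\<^sup>2)"

definition Linf :: "(real^'n) set \<Rightarrow> (real^'n \<Rightarrow> 'b::euclidean_space) set" where
  "Linf D = {f. f \<in> borel_measurable (lebesgue_on D) \<and>
                esssup (lebesgue_on D) (\<lambda>x. ereal (norm (f x))) < \<infinity>}"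

definition Linf_norm :: "(real^'n) set \<Rightarrow> (real^'n \<Rightarrow> 'b::euclidean_space) \<Rightarrow> real" where
  "Linf_norm D f = real_of_ereal (esssup (lebesgue_on D) (\<lambda>x. ereal (norm (f x))))"

definition locally_integrable :: "(real^'n) set \<Rightarrow> (real^'n \<Rightarrow> 'b::euclidean_space) \<Rightarrow> bool" where
  "locally_integrable D f \<longleftrightarrow>
     (\<forall>K. compact K \<and> K \<subseteq> D \<longrightarrow> integrable (lebesgue_on K) f)"

text \<open>Differentiability of order \<open>k\<close> with continuous derivatives, on the whole space.\<close>

fun times_cont_diff :: "nat \<Rightarrow> (real^'n \<Rightarrow> real) \<Rightarrow> bool" where
  "times_cont_diff 0 f \<longleftrightarrow> continuous_on UNIV f"
| "times_cont_diff (Suc k) f \<longleftrightarrow>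
     (\<forall>x. f differentiable (at x)) \<and>
     (\<forall>h. times_cont_diff k (\<lambda>x. frechet_derivative f (at x) h))"

definition test_functions :: "(real^'n) set \<Rightarrow> (real^'n \<Rightarrow> real) set" where
  "test_functions D =
     {\<phi>. (\<forall>k. times_cont_diff k \<phi>) \<and>
          compact (closure {x. \<phi> x \<noteq> 0}) \<and> closure {x. \<phi> x \<noteq> 0} \<subseteq> D}"

definition classical_grad :: "(real^'n \<Rightarrow> real) \<Rightarrow> real^'n \<Rightarrow> real^'n" where
  "classical_grad \<phi> x = (\<chi> i. frechet_derivative \<phi> (at x) (axis i 1))"

definition is_weak_grad :: "(real^'n) set \<Rightarrow> (real^'n \<Rightarrow> real) \<Rightarrow> (real^'n \<Rightarrow> real^'n) \<Rightarrow> bool" where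
  "is_weak_grad D u g \<longleftrightarrow>
     locally_integrable D u \<and> locally_integrable D g \<and>
     (\<forall>\<phi>\<in>test_functions D.
        (LINT x|lebesgue_on D. u x *\<^sub>R classical_grad \<phi> x)
        = - (LINT x|lebesgue_on D. \<phi> x *\<^sub>R g x))"

text \<open>A representative of the weak gradient, which is unique almost everywhere on \<open>D\<close>.\<close>

definition weak_grad :: "(real^'n) set \<Rightarrow> (real^'n \<Rightarrow> real) \<Rightarrow> real^'n \<Rightarrow> real^'n" where
  "weak_grad D u = (SOME g. is_weak_grad D u g)"

definition H1 :: "(real^'n) set \<Rightarrow> (real^'n \<Rightarrow> real) set" where
  "H1 D = {u \<in> L2 D. (\<exists>g. is_weak_grad D u g) \<and> weak_grad D u \<in> L2 D}"

definition H1_norm :: "(real^'n) set \<Rightarrow> (real^'n \<Rightarrow> real) \<Rightarrow> real" where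
  "H1_norm D u = sqrt ((L2_norm D u)\<^sup>2 + (L2_norm D (weak_grad D u))\<^sup>2)"

definition H10 :: "(real^'n) set \<Rightarrow> (real^'n \<Rightarrow> real) set" where
  "H10 D = {u \<in> H1 D. \<exists>\<phi> :: nat \<Rightarrow> real^'n \<Rightarrow> real.
              (\<forall>k. \<phi> k \<in> test_functions D) \<and>
              (\<lambda>k. H1_norm D (\<lambda>x. \<phi> k x - u x)) \<longlonglongrightarrow> 0}"

definition V_norm :: "(real^'n) set \<Rightarrow> (real^'n \<Rightarrow> real) \<Rightarrow> real" where
  "V_norm D v = L2_norm D (weak_grad D v)"

definition W1inf :: "(real^'n) set \<Rightarrow> (real^'n \<Rightarrow> real) set" where
  "W1inf D = {u \<in> Linf D. (\<exists>g. is_weak_grad D u g) \<and> weak_grad D u \<in> Linf D}"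

definition W1inf_norm :: "(real^'n) set \<Rightarrow> (real^'n \<Rightarrow> real) \<Rightarrow> real" where
  "W1inf_norm D u = max (Linf_norm D u) (Linf_norm D (weak_grad D u))"


section \<open>Parametric coefficients\<close>

text \<open>
  The index set of the parameters is \<open>{0, 1, 2, \<dots>}\<close>; the nominal coefficients
  \<open>a\<^sub>0\<close>, \<open>b\<^sub>0\<close> are kept apart, so that \<open>a j\<close> multiplies \<open>y j\<close> for every \<open>j :: nat\<close>.
\<close>

definition param_box :: "(nat \<Rightarrow> real) set" where
  "param_box = {y. \<forall>j. y j \<in> {-1/2..1/2}}"

definition affine_coeff ::
  "(real^'n \<Rightarrow> real) \<Rightarrow> (nat \<Rightarrow> real^'n \<Rightarrow> real) \<Rightarrow> (nat \<Rightarrow> real) \<Rightarrow> real^'n \<Rightarrow> real" where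
  "affine_coeff f0 f y x = f0 x + (\<Sum>j. y j * f j x)"

text \<open>
  The coefficients are classes modulo null sets, so the pointwise bounds are required for each
  \<open>y\<close> and almost every \<open>x\<close>.
\<close>

definition assumption_A1 ::
  "(real^'n) set \<Rightarrow> (real^'n \<Rightarrow> real) \<Rightarrow> (nat \<Rightarrow> real^'n \<Rightarrow> real) \<Rightarrow>
   (real^'n \<Rightarrow> real) \<Rightarrow> (nat \<Rightarrow> real^'n \<Rightarrow> real) \<Rightarrow> (real^'n \<Rightarrow> real) \<Rightarrow> real \<Rightarrow> bool" where
  "assumption_A1 D a0 a b0 b c amin \<longleftrightarrow>
     (a0 \<in> Linf D \<and> (\<forall>j. a j \<in> Linf D) \<and> b0 \<in> Linf D \<and> (\<forall>j. b j \<in> Linf D) \<and> c \<in> Linf D) \<and>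
     (amin > 0 \<and>
      (\<forall>y\<in>param_box. AE x in lebesgue_on D.
         affine_coeff a0 a y x \<ge> amin \<and> affine_coeff b0 b y x \<ge> 0 \<and> c x \<ge> amin)) \<and>
     (\<exists>p\<in>{0<..<1}. summable (\<lambda>j. Linf_norm D (a j) powr p) \<and>
                   summable (\<lambda>j. Linf_norm D (b j) powr p)) \<and>
     (a0 \<in> W1inf D \<and> (\<forall>j. a j \<in> W1inf D) \<and> summable (\<lambda>j. W1inf_norm D (a j)))"

definition coeff_max ::
  "(real^'n) set \<Rightarrow> (real^'n \<Rightarrow> real) \<Rightarrow> (nat \<Rightarrow> real^'n \<Rightarrow> real) \<Rightarrow>
   (real^'n \<Rightarrow> real) \<Rightarrow> (nat \<Rightarrow> real^'n \<Rightarrow> real) \<Rightarrow> (real^'n \<Rightarrow> real) \<Rightarrow> real" where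
  "coeff_max D a0 a b0 b c =
     Max {SUP y\<in>param_box. Linf_norm D (affine_coeff a0 a y),
          SUP y\<in>param_box. Linf_norm D (affine_coeff b0 b y),
          Linf_norm D c}"


section \<open>Variational eigenvalue problems\<close>

definition A_form ::
  "(real^'n) set \<Rightarrow> (real^'n \<Rightarrow> real) \<Rightarrow> (real^'n \<Rightarrow> real) \<Rightarrow>
   (real^'n \<Rightarrow> real) \<Rightarrow> (real^'n \<Rightarrow> real) \<Rightarrow> real" where
  "A_form D \<alpha> \<beta> w v =
     (LINT x|lebesgue_on D. \<alpha> x * (weak_grad D w x \<bullet> weak_grad D v x)) +
     (LINT x|lebesgue_on D. \<beta> x * w x * v x)"

definition M_form ::
  "(real^'n) set \<Rightarrow> (real^'n \<Rightarrow> real) \<Rightarrow> (real^'n \<Rightarrow> real) \<Rightarrow> (real^'n \<Rightarrow> real) \<Rightarrow> real" where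
  "M_form D \<gamma> w v = (LINT x|lebesgue_on D. \<gamma> x * w x * v x)"

definition eigenspace ::
  "(real^'n) set \<Rightarrow> ((real^'n \<Rightarrow> real) \<Rightarrow> (real^'n \<Rightarrow> real) \<Rightarrow> real) \<Rightarrow>
   ((real^'n \<Rightarrow> real) \<Rightarrow> (real^'n \<Rightarrow> real) \<Rightarrow> real) \<Rightarrow> real \<Rightarrow> (real^'n \<Rightarrow> real) set" where
  "eigenspace D A M \<mu> = {w \<in> H10 D. \<forall>v\<in>H10 D. A w v = \<mu> * M w v}"

text \<open>Dimension of a space of functions after identifying functions that agree a.e. on \<open>D\<close>.\<close>

definition has_dim_ae :: "(real^'n) set \<Rightarrow> (real^'n \<Rightarrow> real) set \<Rightarrow> nat \<Rightarrow> bool" where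
  "has_dim_ae D E m \<longleftrightarrow>
     (\<exists>e :: nat \<Rightarrow> real^'n \<Rightarrow> real.
        (\<forall>i<m. e i \<in> E) \<and>
        (\<forall>w\<in>E. \<exists>t. AE x in lebesgue_on D. w x = (\<Sum>i<m. t i * e i x)) \<and>
        (\<forall>t. (AE x in lebesgue_on D. (\<Sum>i<m. t i * e i x) = 0) \<longrightarrow> (\<forall>i<m. t i = 0)))"

text \<open>
  \<open>l 1 \<le> l 2 \<le> \<dots>\<close> are all eigenvalues, each repeated according to the dimension of its
  eigenspace (which is zero for a number that is not an eigenvalue). The value \<open>l 0\<close> is not used.
\<close>

definition eigenvalues_with_multiplicity ::
  "(real^'n) set \<Rightarrow> ((real^'n \<Rightarrow> real) \<Rightarrow> (real^'n \<Rightarrow> real) \<Rightarrow> real) \<Rightarrow>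
   ((real^'n \<Rightarrow> real) \<Rightarrow> (real^'n \<Rightarrow> real) \<Rightarrow> real) \<Rightarrow> (nat \<Rightarrow> real) \<Rightarrow> bool" where
  "eigenvalues_with_multiplicity D A M l \<longleftrightarrow>
     mono_on {1..} l \<and>
     (\<forall>\<mu>. finite {k\<in>{1..}. l k = \<mu>} \<and>
          has_dim_ae D (eigenspace D A M \<mu>) (card {k\<in>{1..}. l k = \<mu>}))"

definition dirichlet_eigenvalues :: "(real^'n) set \<Rightarrow> (nat \<Rightarrow> real) \<Rightarrow> bool" where
  "dirichlet_eigenvalues D \<chi>s \<longleftrightarrow>
     eigenvalues_with_multiplicity D (A_form D (\<lambda>_. 1) (\<lambda>_. 0)) (M_form D (\<lambda>_. 1)) \<chi>s"

definition normalised_eigenfunction ::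
  "(real^'n) set \<Rightarrow> ((real^'n \<Rightarrow> real) \<Rightarrow> (real^'n \<Rightarrow> real) \<Rightarrow> real) \<Rightarrow>
   ((real^'n \<Rightarrow> real) \<Rightarrow> (real^'n \<Rightarrow> real) \<Rightarrow> real) \<Rightarrow> real \<Rightarrow> (real^'n \<Rightarrow> real) \<Rightarrow> bool" where
  "normalised_eigenfunction D A M \<mu> w \<longleftrightarrow> w \<in> eigenspace D A M \<mu> \<and> sqrt (M w w) = 1"


section \<open>Multi-indices and mixed partial derivatives\<close>

definition multi_indices :: "(nat \<Rightarrow> nat) set" where
  "multi_indices = {\<nu>. finite {j. \<nu> j \<noteq> 0}}"

definition mi_order :: "(nat \<Rightarrow> nat) \<Rightarrow> nat" where
  "mi_order \<nu> = (\<Sum>j | \<nu> j \<noteq> 0. \<nu> j)"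

definition mi_power :: "(nat \<Rightarrow> real) \<Rightarrow> (nat \<Rightarrow> nat) \<Rightarrow> real" where
  "mi_power \<beta> \<nu> = (\<Prod>j | \<nu> j \<noteq> 0. \<beta> j ^ \<nu> j)"

text \<open>
  \<open>df \<nu> y\<close> is the mixed partial derivative of order \<open>\<nu>\<close> of \<open>f\<close> at \<open>y\<close>, for all
  multi-indices and all points of the parameter box. The derivatives with respect to
  the \<open>j\<close>th parameter are one-sided where \<open>y j\<close> is an end point of its interval.
\<close>

definition mixed_partials ::
  "((nat \<Rightarrow> real) \<Rightarrow> real) \<Rightarrow> ((nat \<Rightarrow> nat) \<Rightarrow> (nat \<Rightarrow> real) \<Rightarrow> real) \<Rightarrow> bool" where
  "mixed_partials f df \<longleftrightarrow>
     (\<forall>y\<in>param_box. df (\<lambda>_. 0) y = f y) \<and>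
     (\<forall>\<nu>\<in>multi_indices. \<forall>j. \<forall>y\<in>param_box.
        ((\<lambda>t. df \<nu> (y(j := t))) has_real_derivative df (\<nu>(j := Suc (\<nu> j))) y)
          (at (y j) within {-1/2..1/2}))"

text \<open>
  The same for a map into \<open>H\<^sup>1\<^sub>0(D)\<close>: all derivatives lie in this space, and the
  difference quotients converge in its norm, which determines the derivatives up to null sets.
\<close>

definition mixed_partials_V ::
  "(real^'n) set \<Rightarrow> ((nat \<Rightarrow> real) \<Rightarrow> real^'n \<Rightarrow> real) \<Rightarrow>
   ((nat \<Rightarrow> nat) \<Rightarrow> (nat \<Rightarrow> real) \<Rightarrow> real^'n \<Rightarrow> real) \<Rightarrow> bool" where
  "mixed_partials_V D f df \<longleftrightarrow>
     (\<forall>y\<in>param_box. df (\<lambda>_. 0) y = f y) \<and>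
     (\<forall>\<nu>\<in>multi_indices. \<forall>y\<in>param_box. df \<nu> y \<in> H10 D) \<and>
     (\<forall>\<nu>\<in>multi_indices. \<forall>j. \<forall>y\<in>param_box.
        ((\<lambda>t. V_norm D (\<lambda>x. (df \<nu> (y(j := t)) x - df \<nu> y x) / (t - y j)
                               - df (\<nu>(j := Suc (\<nu> j))) y x)) \<longlongrightarrow> 0)
          (at (y j) within {-1/2..1/2}))"


section \<open>Constants\<close>

text \<open>\<open>\<chi>k\<close> stands for the \<open>k\<close>th Dirichlet eigenvalue of the negative Laplacian.\<close>

definition eig_lower :: "real \<Rightarrow> real \<Rightarrow> real \<Rightarrow> real" where
  "eig_lower amin amax \<chi>k = amin / amax * \<chi>k"

definition eig_upper :: "real \<Rightarrow> real \<Rightarrow> real \<Rightarrow> real" where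
  "eig_upper amin amax \<chi>k = amax / amin * (\<chi>k + 1)"

definition eigfun_upper :: "real \<Rightarrow> real \<Rightarrow> real \<Rightarrow> real" where
  "eigfun_upper amin amax \<chi>k = sqrt (amax * (\<chi>k + 1)) / amin"

definition C_eps :: "real \<Rightarrow> real" where
  "C_eps \<epsilon> = 2 powr (1 - \<epsilon>) / (1 - 2 powr (- \<epsilon>)) * ((exp 1)\<^sup>2 / sqrt (2 * pi)) powr \<epsilon>"

definition C_gap :: "real \<Rightarrow> real \<Rightarrow> real \<Rightarrow> real \<Rightarrow> real" where
  "C_gap amin amax \<chi>2 \<delta> = amin * \<delta> / eig_upper amin amax \<chi>2"

definition C_beta :: "real \<Rightarrow> real \<Rightarrow> real \<Rightarrow> real \<Rightarrow> real \<Rightarrow> real \<Rightarrow> real" where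
  "C_beta amin amax \<chi>1 \<chi>2 \<delta> \<epsilon> =
     1 / C_gap amin amax \<chi>2 \<delta>
     * (amin\<^sup>2 * eig_upper amin amax \<chi>1 / (amax\<^sup>2 * eig_lower amin amax \<chi>1))
     * (3 * eig_upper amin amax \<chi>1 / (2 * eig_lower amin amax \<chi>1) * C_eps \<epsilon> + 1)"

end

(*
  Differentiating the eigenvalue equation and the normalisation gives a recursion for the
  derivatives. The part of a derivative of the eigenfunction that is orthogonal to the eigenfunction
  is controlled by the spectral gap, because A - lambda_1 M is coercive there; the parallel part is
  read off the normalised equation. The recursion is bounded by an induction in which all
  derivatives of positive order carry an additional small factor 1 / K, so that the convolution
  sums, which are quadratic in such derivatives, close up.

  Coercivity and the two-sided bounds for the eigenvalues come from the variational characterisation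
  of the first two eigenvalues. These are obtained from minimisers of the Rayleigh quotient, which
  exist by completeness of H^1_0 and the Rellich theorem.
*)

theory Submission
  imports Defs "HOL-Library.Function_Algebras" "HOL-Library.Diagonal_Subsequence"
begin

text \<open>The obstacle is the convolution over the splittings of a multi-index of order n. If the
  derivatives were bounded by multiples of plain factorials, each of the n - 1 sizes of a proper
  splitting would contribute n!, and no constant could close the induction. With the exponent 1 +
  \<epsilon> the contribution of size k becomes (n!)^(1+\<epsilon>) times (n choose
  k)^(-\<epsilon>), and these weights sum to at most \<open>C_eps\<close> whatever n is. The
  constant \<open>C_beta\<close> equals (1 + 1/\<chi>_1) K / \<open>C_gap\<close> with K = 1 + (3/2)
  R \<open>C_eps\<close>, where R is the quotient of the upper and the lower bound of the first
  eigenvalue. In K, the 1 pays for differentiating the coefficients, R \<open>C_eps\<close> for the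
  convolution in the eigenvalue equation and half of it for the one in the normalisation. The factor
  1 + 1/\<chi>_1 bounds the forms of the \<open>a j\<close>, \<open>b j\<close> by gradient norms
  alone, and 1 / \<open>C_gap\<close> inverts the coercivity constant. The eigenvalues are given
  only as a list with multiplicities, so a minimiser becomes useful once its multiplier is located
  in that list.\<close>

instantiation "fun" :: (type, scaleR) scaleR
begin
definition scaleR_fun_def: "scaleR c f = (\<lambda>x. c *\<^sub>R f x)"
instance ..
end

lemma scaleR_fun_apply [simp]: "(c *\<^sub>R f) x = c *\<^sub>R f x"
  by (simp add: scaleR_fun_def)

text \<open>With pointwise operations the spaces \<open>L2 D\<close>, \<open>H1 D\<close> and
  \<open>H10 D\<close>, which consist of representatives, are subspaces of a real vector space. The
  abstract arguments about forms then apply without passing to classes modulo null sets.\<close>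

instance "fun" :: (type, real_vector) real_vector
  by standard (auto simp: fun_eq_iff scaleR_add_right scaleR_add_left)

section \<open>Symmetric bilinear forms on a subspace\<close>

text \<open>Bilinearity is demanded on a subspace because integrals of products are additive only
  for square-integrable functions and \<open>weak_grad\<close> is meaningful only on
  \<open>H1\<close>. The forms in use are at best semidefinite: they vanish on representatives that
  are zero almost everywhere.\<close>

definition symbil :: "'v::real_vector set \<Rightarrow> ('v \<Rightarrow> 'v \<Rightarrow> real) \<Rightarrow> bool" where
  "symbil V B \<longleftrightarrow> subspace V \<and> (\<forall>u\<in>V. \<forall>v\<in>V. B u v = B v u) \<and>
     (\<forall>u\<in>V. \<forall>v\<in>V. \<forall>w\<in>V. B (u + v) w = B u w + B v w) \<and>
     (\<forall>c. \<forall>u\<in>V. \<forall>w\<in>V. B (c *\<^sub>R u) w = c * B u w)"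

context
  fixes V :: "'v::real_vector set" and B
  assumes B: "symbil V B"
begin

lemma symbil_subspace: "subspace V"
  using B by (simp add: symbil_def)

lemma symbil_mem: "u \<in> V \<Longrightarrow> v \<in> V \<Longrightarrow> u + v \<in> V" "u \<in> V \<Longrightarrow> v \<in> V \<Longrightarrow> u - v \<in> V"
    "u \<in> V \<Longrightarrow> c *\<^sub>R u \<in> V" "0 \<in> V"
  using symbil_subspace by (auto intro: subspace_add subspace_diff subspace_scale subspace_0)

lemma symbil_sym: "u \<in> V \<Longrightarrow> v \<in> V \<Longrightarrow> B u v = B v u"
  using B by (auto simp: symbil_def)

lemma symbil_add_left: "u \<in> V \<Longrightarrow> v \<in> V \<Longrightarrow> w \<in> V \<Longrightarrow> B (u + v) w = B u w + B v w"
  using B by (auto simp: symbil_def)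

lemma symbil_scale_left: "u \<in> V \<Longrightarrow> w \<in> V \<Longrightarrow> B (c *\<^sub>R u) w = c * B u w"
  using B by (auto simp: symbil_def)

lemma symbil_add_right: "u \<in> V \<Longrightarrow> v \<in> V \<Longrightarrow> w \<in> V \<Longrightarrow> B w (u + v) = B w u + B w v"
  using symbil_add_left[of u v w] symbil_sym symbil_mem by metis

lemma symbil_scale_right: "u \<in> V \<Longrightarrow> w \<in> V \<Longrightarrow> B w (c *\<^sub>R u) = c * B w u"
  using symbil_scale_left symbil_sym symbil_mem by metis

lemma symbil_diff_left: "u \<in> V \<Longrightarrow> v \<in> V \<Longrightarrow> w \<in> V \<Longrightarrow> B (u - v) w = B u w - B v w"
  using symbil_add_left[of u "-1 *\<^sub>R v" w] symbil_scale_left[of v w "-1"] symbil_mem(3)[of v "-1"] by simp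

lemma symbil_diff_right: "u \<in> V \<Longrightarrow> v \<in> V \<Longrightarrow> w \<in> V \<Longrightarrow> B w (u - v) = B w u - B w v"
  using symbil_diff_left[of u v w] symbil_sym symbil_mem by metis

lemma symbil_zero: "w \<in> V \<Longrightarrow> B 0 w = 0" "w \<in> V \<Longrightarrow> B w 0 = 0"
  using symbil_scale_left[of 0 w 0] symbil_scale_right[of 0 w 0] symbil_mem(4) by auto

lemmas symbil_simps = symbil_add_left symbil_add_right symbil_scale_left symbil_scale_right
  symbil_diff_left symbil_diff_right symbil_mem

lemma symbil_lincomb_square:
  assumes "u \<in> V" "v \<in> V"
  shows "B (s *\<^sub>R u + t *\<^sub>R v) (s *\<^sub>R u + t *\<^sub>R v) = s\<^sup>2 * B u u + 2 * s * t * B u v + t\<^sup>2 * B v v"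
  using assms symbil_sym[of v u] by (simp add: symbil_simps power2_eq_square algebra_simps)

context
  assumes nonneg: "\<And>v. v \<in> V \<Longrightarrow> B v v \<ge> 0"
begin

text \<open>The form may be degenerate, so a vector \<open>v\<close> with \<open>B v v = 0\<close>
  is treated apart: there the nonnegative quadratic is affine in t, hence has slope zero.\<close>

lemma symbil_Cauchy_Schwarz:
  assumes "u \<in> V" "v \<in> V"
  shows "(B u v)\<^sup>2 \<le> B u u * B v v"
proof -
  have *: "s\<^sup>2 * B u u + 2 * s * t * B u v + t\<^sup>2 * B v v \<ge> 0" for s t
    using nonneg[of "s *\<^sub>R u + t *\<^sub>R v"] symbil_lincomb_square[OF assms] assms symbil_mem by auto
  show ?thesis
  proof (cases "B v v = 0")
    case True
    have "B u v = 0"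
    proof (rule ccontr)
      assume ne: "B u v \<noteq> 0"
      \<comment> \<open>This t makes the expression equal to -1.\<close>
      show False
        using *[of 1 "- (B u u + 1) / (2 * B u v)"] ne True by (simp add: field_simps)
    qed
    then show ?thesis using nonneg assms by simp
  next
    case False
    then have pos: "B v v > 0" using nonneg[OF assms(2)] by simp
    \<comment> \<open>The minimiser of the quadratic, scaled by \<open>B v v\<close> to avoid a
      division.\<close>
    have "0 \<le> (B v v)\<^sup>2 * B u u - 2 * B v v * B u v * B u v + (B u v)\<^sup>2 * B v v"
      using *[of "B v v" "- B u v"] by (simp add: algebra_simps)
    also have "\<dots> = B v v * (B u u * B v v - (B u v)\<^sup>2)"
      by (simp add: algebra_simps power2_eq_square)
    finally show ?thesis using pos by (simp add: zero_le_mult_iff)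
  qed
qed

lemma symbil_Cauchy_Schwarz_sqrt:
  assumes "u \<in> V" "v \<in> V"
  shows "\<bar>B u v\<bar> \<le> sqrt (B u u) * sqrt (B v v)"
  using real_sqrt_le_mono[OF symbil_Cauchy_Schwarz[OF assms]] by (simp add: real_sqrt_mult)

lemma symbil_triangle:
  assumes "u \<in> V" "v \<in> V"
  shows "sqrt (B (u + v) (u + v)) \<le> sqrt (B u u) + sqrt (B v v)"
proof (rule real_le_lsqrt)
  have "B (u + v) (u + v) = B u u + 2 * B u v + B v v"
    using symbil_lincomb_square[OF assms, of 1 1] by simp
  also have "\<dots> \<le> (sqrt (B u u) + sqrt (B v v))\<^sup>2"
    using symbil_Cauchy_Schwarz_sqrt[OF assms] nonneg assms by (simp add: power2_sum)
  finally show "B (u + v) (u + v) \<le> (sqrt (B u u) + sqrt (B v v))\<^sup>2" .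
qed (use nonneg assms in auto)

lemma symbil_triangle_diff:
  assumes "u \<in> V" "v \<in> V"
  shows "\<bar>sqrt (B u u) - sqrt (B v v)\<bar> \<le> sqrt (B (u - v) (u - v))"
proof -
  have "sqrt (B u u) \<le> sqrt (B (u - v) (u - v)) + sqrt (B v v)"
    using symbil_triangle[of "u - v" v] assms symbil_mem by simp
  moreover have "sqrt (B v v) \<le> sqrt (B (v - u) (v - u)) + sqrt (B u u)"
    using symbil_triangle[of "v - u" u] assms symbil_mem by simp
  moreover have "B (v - u) (v - u) = B (u - v) (u - v)"
    using assms symbil_sym by (simp add: symbil_simps)
  ultimately show ?thesis by (simp add: abs_le_iff)
qed

lemma symbil_tendsto:
  assumes X: "\<And>n::nat. X n \<in> V" and x: "x \<in> V" and lim: "(\<lambda>n. B (X n - x) (X n - x)) \<longlonglongrightarrow> 0"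
  shows "(\<lambda>n. B (X n) (X n)) \<longlonglongrightarrow> B x x" "v \<in> V \<Longrightarrow> (\<lambda>n. B (X n) v) \<longlonglongrightarrow> B x v"
proof -
  have lim': "(\<lambda>n. sqrt (B (X n - x) (X n - x))) \<longlonglongrightarrow> 0"
    using tendsto_real_sqrt[OF lim] by simp
  have "(\<lambda>n. sqrt (B (X n) (X n)) - sqrt (B x x)) \<longlonglongrightarrow> 0"
    by (rule Lim_null_comparison[OF _ lim']) (use symbil_triangle_diff X x in auto)
  then have "(\<lambda>n. (sqrt (B (X n) (X n)))\<^sup>2) \<longlonglongrightarrow> (sqrt (B x x))\<^sup>2"
    by (intro tendsto_power) (simp add: LIM_zero_iff)
  then show "(\<lambda>n. B (X n) (X n)) \<longlonglongrightarrow> B x x"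
    using nonneg X x by simp
  assume v: "v \<in> V"
  have "(\<lambda>n. B (X n) v - B x v) \<longlonglongrightarrow> 0"
  proof (rule Lim_null_comparison)
    show "\<forall>\<^sub>F n in sequentially. norm (B (X n) v - B x v) \<le> sqrt (B (X n - x) (X n - x)) * sqrt (B v v)"
      using symbil_Cauchy_Schwarz_sqrt[of "X _ - x" v] v X x by (auto simp: symbil_simps)
    show "(\<lambda>n. sqrt (B (X n - x) (X n - x)) * sqrt (B v v)) \<longlonglongrightarrow> 0"
      using tendsto_mult_right[OF lim', of "sqrt (B v v)"] by simp
  qed
  then show "(\<lambda>n. B (X n) v) \<longlonglongrightarrow> B x v"
    by (simp add: LIM_zero_iff)
qed

end

end

lemma symbil_lincomb:
  assumes "symbil V A" "symbil V B"
  shows "symbil V (\<lambda>u v. s * A u v + t * B u v)"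
  using assms by (simp add: symbil_def algebra_simps)

section \<open>Minimising a quadratic form\<close>

text \<open>The compactness assumption plays the role of the Rellich theorem: \<open>G\<close> is the
  gradient form and \<open>L\<close> the \<open>L\<^sup>2\<close> form. Strong convergence of a minimising sequence follows from
  the parallelogram law, so that no weak topology is needed.\<close>

locale compact_pair =
  fixes V :: "'v::real_vector set" and G L :: "'v \<Rightarrow> 'v \<Rightarrow> real"
  assumes G: "symbil V G" and L: "symbil V L"
    and G_nonneg: "v \<in> V \<Longrightarrow> G v v \<ge> 0" and L_nonneg: "v \<in> V \<Longrightarrow> L v v \<ge> 0"
    and complete: "\<lbrakk>\<And>n::nat. X n \<in> V; \<And>e. e > 0 \<Longrightarrow> \<exists>N. \<forall>m\<ge>N. \<forall>n\<ge>N.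
        G (X m - X n) (X m - X n) + L (X m - X n) (X m - X n) < e\<rbrakk> \<Longrightarrow>
        \<exists>x\<in>V. (\<lambda>n. G (X n - x) (X n - x) + L (X n - x) (X n - x)) \<longlonglongrightarrow> 0"
    and precompact: "\<lbrakk>\<And>n::nat. X n \<in> V; \<And>n. G (X n) (X n) + L (X n) (X n) \<le> K\<rbrakk> \<Longrightarrow>
        \<exists>r::nat \<Rightarrow> nat. strict_mono r \<and> (\<forall>e>0. \<exists>N. \<forall>m\<ge>N. \<forall>n\<ge>N.
          L (X (r m) - X (r n)) (X (r m) - X (r n)) < e)"
begin

text \<open>With \<open>u0 = 0\<close> this yields the first eigenvalue, with \<open>u0\<close> a
  first eigenfunction the second. The vector \<open>v0\<close> ensures that the constraint space
  contains something that can be normalised. The Euler-Lagrange equation is obtained against the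
  constraint space only.\<close>

lemma exists_minimiser:
  assumes A: "symbil V A" and M: "symbil V M" and kappa: "\<kappa> > 0"
    and A_ge: "\<And>v. v \<in> V \<Longrightarrow> A v v \<ge> \<kappa> * G v v"
    and A_le: "\<And>v. v \<in> V \<Longrightarrow> A v v \<le> K * (G v v + L v v)"
    and M_ge: "\<And>v. v \<in> V \<Longrightarrow> M v v \<ge> \<kappa> * L v v"
    and M_le: "\<And>v. v \<in> V \<Longrightarrow> M v v \<le> K * L v v"
    and u0: "u0 \<in> V" and v0: "v0 \<in> V" "M v0 u0 = 0" "M v0 v0 > 0"
  obtains e \<mu> where "e \<in> V" "M e u0 = 0" "M e e = 1"
    "\<And>v. v \<in> V \<Longrightarrow> M v u0 = 0 \<Longrightarrow> \<mu> * M v v \<le> A v v"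
    "\<And>v. v \<in> V \<Longrightarrow> M v u0 = 0 \<Longrightarrow> A e v = \<mu> * M e v"
proof -
  note sA = symbil_simps[OF A] and sM = symbil_simps[OF M]
  note mem = symbil_mem[OF A]
  have A_nonneg: "A v v \<ge> 0" if "v \<in> V" for v
    using A_ge[OF that] G_nonneg[OF that] kappa by (smt (verit) mult_nonneg_nonneg)
  have M_nonneg: "M v v \<ge> 0" if "v \<in> V" for v
    using M_ge[OF that] L_nonneg[OF that] kappa by (smt (verit) mult_nonneg_nonneg)
  define S where "S = {v\<in>V. M v u0 = 0}"
  define Q where "Q = {A v v |v. v \<in> S \<and> M v v = 1}"
  define \<mu> where "\<mu> = Inf Q"
  have S_mem: "v \<in> V" if "v \<in> S" for v using that by (simp add: S_def)
  have S_closed: "u + v \<in> S" "u - v \<in> S" "c *\<^sub>R u \<in> S" if "u \<in> S" "v \<in> S" for u v c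
    using that u0 by (auto simp: S_def sM)
  have normalise: "A v v / M v v \<in> Q" if "v \<in> S" "M v v > 0" for v
  proof -
    define w where "w = (1 / sqrt (M v v)) *\<^sub>R v"
    have "w \<in> S" using that S_closed by (simp add: w_def)
    moreover have "M w w = 1" "A w w = A v v / M v v"
      using that S_mem by (simp_all add: w_def sM sA)
    ultimately show ?thesis unfolding Q_def by force
  qed
  have Qne: "Q \<noteq> {}" using normalise[of v0] v0 by (auto simp: S_def)
  have Qbdd: "bdd_below Q"
    by (rule bdd_belowI[of _ 0]) (auto simp: Q_def S_def A_nonneg)
  have low: "\<mu> * M v v \<le> A v v" if "v \<in> S" for v
  proof (cases "M v v = 0")
    case True then show ?thesis using A_nonneg S_mem that by simp
  next
    case False
    then have p: "M v v > 0" using M_nonneg S_mem that by (simp add: order_less_le)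
    then have "\<mu> \<le> A v v / M v v"
      unfolding \<mu>_def using normalise that Qbdd by (intro cInf_lower) auto
    then show ?thesis using p by (simp add: field_simps)
  qed
  have "\<exists>v\<in>S. M v v = 1 \<and> A v v < \<mu> + 1 / real (Suc n)" for n
  proof -
    have "\<exists>q\<in>Q. q < \<mu> + 1 / real (Suc n)"
      using cInf_lessD[OF Qne, of "\<mu> + 1 / real (Suc n)"] by (simp add: \<mu>_def)
    then show ?thesis by (auto simp: Q_def)
  qed
  then obtain X where X: "\<And>n. X n \<in> S" "\<And>n. M (X n) (X n) = 1"
      "\<And>n. A (X n) (X n) < \<mu> + 1 / real (Suc n)"
    by metis
  have "G (X n) (X n) + L (X n) (X n) \<le> (\<mu> + 1) / \<kappa> + 1 / \<kappa>" for n
  proof -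
    have "1 / real (Suc n) \<le> 1" by simp
    then have "\<kappa> * G (X n) (X n) \<le> \<mu> + 1"
      using A_ge[OF S_mem[OF X(1)[of n]]] X(3)[of n] by linarith
    moreover have "\<kappa> * L (X n) (X n) \<le> 1"
      using M_ge[OF S_mem[OF X(1)[of n]]] X(2)[of n] by linarith
    ultimately show ?thesis
      using kappa by (simp add: field_simps)
  qed
  from precompact[of X, OF S_mem[OF X(1)] this] obtain r :: "nat \<Rightarrow> nat" where r: "strict_mono r"
    and rL: "\<forall>e>0. \<exists>N. \<forall>m\<ge>N. \<forall>n\<ge>N. L (X (r m) - X (r n)) (X (r m) - X (r n)) < e"
    by blast
  define Y where "Y n = X (r n)" for n
  have YS: "Y n \<in> S" and YM: "M (Y n) (Y n) = 1" for n using X by (auto simp: Y_def)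
  have YV: "Y n \<in> V" for n using YS S_mem by auto
  have YA: "A (Y n) (Y n) < \<mu> + 1 / real (Suc n)" for n
  proof -
    have "n \<le> r n" using r by (simp add: seq_suble)
    then have "1 / real (Suc (r n)) \<le> 1 / real (Suc n)" by (simp add: field_simps)
    then show ?thesis using X(3)[of "r n"] by (simp add: Y_def)
  qed
  have L_le: "L v v \<le> (1 / \<kappa>) * M v v" "L v v \<ge> 0" if "v \<in> V" for v
    using M_ge[OF that] kappa L_nonneg[OF that] by (auto simp: field_simps)
  have K0: "\<bar>K\<bar> \<ge> K" "\<bar>K\<bar> \<ge> 0" by auto
  have \<mu>0: "\<mu> \<ge> 0" unfolding \<mu>_def
    by (rule cInf_greatest[OF Qne]) (auto simp: Q_def S_def A_nonneg)
  \<comment> \<open>For the difference d and the sum s, the parallelogram law gives A d d = 2 A (Y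
    m) (Y m) + 2 A (Y n) (Y n) - A s s. Since s obeys the constraint, A s s is at least \<mu> M s s
    = 4 \<mu> - \<mu> M d d. The nearly minimal energies cancel 4 \<mu>, and \<open>M\<close> is
    dominated by the form \<open>L\<close>, in which the sequence is Cauchy.\<close>
  have est: "G (Y m - Y n) (Y m - Y n) \<le>
      (2 / real (Suc m) + 2 / real (Suc n) + \<mu> * \<bar>K\<bar> * L (Y m - Y n) (Y m - Y n)) / \<kappa>" for m n
  proof -
    let ?d = "Y m - Y n" and ?s = "Y m + Y n"
    have "A ?d ?d = 2 * A (Y m) (Y m) + 2 * A (Y n) (Y n) - A ?s ?s"
      using YV symbil_sym[OF A, of "Y m" "Y n"] by (simp add: sA)
    moreover have "\<mu> * M ?s ?s = 4 * \<mu> - \<mu> * M ?d ?d"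
      using YV YM symbil_sym[OF M, of "Y m" "Y n"] by (simp add: sM algebra_simps)
    moreover have "\<mu> * M ?s ?s \<le> A ?s ?s"
      using low S_closed YS by auto
    moreover have "\<mu> * M ?d ?d \<le> \<mu> * (\<bar>K\<bar> * L ?d ?d)"
      using M_le[of ?d] mult_right_mono[OF K0(1), of "L ?d ?d"] YV mem L_nonneg[of ?d] \<mu>0
      by (intro mult_left_mono) (auto intro: order_trans)
    ultimately have "A ?d ?d \<le> 2 / real (Suc m) + 2 / real (Suc n) + \<mu> * \<bar>K\<bar> * L ?d ?d"
      using YA[of m] YA[of n] by linarith
    then have "\<kappa> * G ?d ?d \<le> 2 / real (Suc m) + 2 / real (Suc n) + \<mu> * \<bar>K\<bar> * L ?d ?d"
      using A_ge[of ?d] YV mem by auto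
    then show ?thesis using kappa by (simp add: field_simps)
  qed
  have cauchy: "\<exists>N. \<forall>m\<ge>N. \<forall>n\<ge>N. G (Y m - Y n) (Y m - Y n) + L (Y m - Y n) (Y m - Y n) < e" if "e > 0" for e
  proof -
    \<comment> \<open>The total coefficient of \<open>L\<close> in the estimate, including
      \<open>L\<close> itself. The terms 2 / m and 2 / n use up one half of \<open>e\<close>, the
      form \<open>L\<close> the other half.\<close>
    define c where "c = \<mu> * \<bar>K\<bar> / \<kappa> + 1"
    have c: "c \<ge> 1" using \<mu>0 K0 kappa by (simp add: c_def)
    have pos: "e / (2 * c) > 0" using c that by simp
    obtain N1 where N1: "\<And>m n. m \<ge> N1 \<Longrightarrow> n \<ge> N1 \<Longrightarrow> L (Y m - Y n) (Y m - Y n) < e / (2 * c)"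
      using rL[rule_format, OF pos] unfolding Y_def by meson
    obtain N2 :: nat where N2: "8 / (e * \<kappa>) < real N2" using reals_Archimedean2 by blast
    have N2': "2 / real (Suc m) \<le> e * \<kappa> / 4" if "m \<ge> N2" for m
    proof -
      have "8 / (e * \<kappa>) < real (Suc m)" using N2 that by linarith
      then show ?thesis using \<open>e > 0\<close> kappa by (simp add: field_simps)
    qed
    show ?thesis
    proof (intro exI[of _ "max N1 N2"] allI impI)
      fix m n assume mn: "max N1 N2 \<le> m" "max N1 N2 \<le> n"
      let ?l = "L (Y m - Y n) (Y m - Y n)"
      have "G (Y m - Y n) (Y m - Y n) + ?l \<le>
         (e * \<kappa> / 4 + e * \<kappa> / 4 + \<mu> * \<bar>K\<bar> * ?l) / \<kappa> + ?l"
        using N2'[of m] N2'[of n] mn kappa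
        by (intro add_mono order_trans[OF est] divide_right_mono) auto
      also have "\<dots> = e / 2 + c * ?l" using kappa by (simp add: c_def field_simps)
      also have "\<dots> < e / 2 + c * (e / (2 * c))"
        using mult_strict_left_mono[OF N1[of m n], of c] mn c by linarith
      also have "\<dots> = e" using c by (simp add: field_simps)
      finally show "G (Y m - Y n) (Y m - Y n) + ?l < e" .
    qed
  qed
  obtain e where e: "e \<in> V" and lim: "(\<lambda>n. G (Y n - e) (Y n - e) + L (Y n - e) (Y n - e)) \<longlonglongrightarrow> 0"
    using complete[OF YV cauchy] by blast
  have limA: "(\<lambda>n. A (Y n - e) (Y n - e)) \<longlonglongrightarrow> 0"
  proof (rule Lim_null_comparison)
    show "\<forall>\<^sub>F n in sequentially. norm (A (Y n - e) (Y n - e)) \<le>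
        K * (G (Y n - e) (Y n - e) + L (Y n - e) (Y n - e))"
      using A_le A_nonneg YV e mem by auto
  qed (use tendsto_mult_left[OF lim, of K] in simp)
  have limL: "(\<lambda>n. L (Y n - e) (Y n - e)) \<longlonglongrightarrow> 0"
  proof (rule Lim_null_comparison[OF _ lim])
    show "\<forall>\<^sub>F n in sequentially. norm (L (Y n - e) (Y n - e)) \<le>
        G (Y n - e) (Y n - e) + L (Y n - e) (Y n - e)"
      using L_nonneg G_nonneg YV e mem by auto
  qed
  have limM: "(\<lambda>n. M (Y n - e) (Y n - e)) \<longlonglongrightarrow> 0"
  proof (rule Lim_null_comparison)
    show "\<forall>\<^sub>F n in sequentially. norm (M (Y n - e) (Y n - e)) \<le> K * L (Y n - e) (Y n - e)"
      using M_le M_nonneg YV e mem by auto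
  qed (use tendsto_mult_left[OF limL, of K] in simp)
  have "M e e = 1"
    using LIMSEQ_unique[OF symbil_tendsto(1)[OF M M_nonneg YV e limM]] YM by simp
  have "M e u0 = 0"
    using LIMSEQ_unique[OF symbil_tendsto(2)[OF M M_nonneg YV e limM u0]] YS by (simp add: S_def)
  have eS: "e \<in> S" using e \<open>M e u0 = 0\<close> by (simp add: S_def)
  have "A e e \<le> \<mu>"
  proof (rule LIMSEQ_le[OF symbil_tendsto(1)[OF A A_nonneg YV e limA]])
    show "(\<lambda>n. \<mu> + 1 / real (Suc n)) \<longlonglongrightarrow> \<mu>"
      using tendsto_add[OF tendsto_const LIMSEQ_inverse_real_of_nat, of \<mu>] by (simp add: inverse_eq_divide)
  qed (blast intro: less_imp_le YA)+
  then have Ae: "A e e = \<mu>" using low[OF eS] \<open>M e e = 1\<close> by simp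
  \<comment> \<open>First variation: 2 t b + t^2 d is nonnegative for all t, which forces b = 0.
    Dividing by d + 1 in the choice of t covers the case d = 0.\<close>
  have "A e v = \<mu> * M e v" if v: "v \<in> S" for v
  proof (rule ccontr)
    define b where "b = A e v - \<mu> * M e v"
    assume "A e v \<noteq> \<mu> * M e v"
    then have b: "b \<noteq> 0" by (simp add: b_def)
    define d where "d = A v v - \<mu> * M v v"
    have d: "d \<ge> 0" using low[OF v] by (simp add: d_def)
    have q: "2 * t * b + t\<^sup>2 * d \<ge> 0" for t
    proof -
      have "e + t *\<^sub>R v \<in> S" using eS v S_closed by auto
      from low[OF this] show ?thesis
        using symbil_lincomb_square[OF A e S_mem[OF v], of 1 t]
          symbil_lincomb_square[OF M e S_mem[OF v], of 1 t] Ae \<open>M e e = 1\<close>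
        by (simp add: b_def d_def algebra_simps)
    qed
    define t where "t = b / (d + 1)"
    have bt: "b = t * (d + 1)" and "t \<noteq> 0" using b d by (auto simp: t_def)
    have "2 * (- t) * b + (- t)\<^sup>2 * d = - (t\<^sup>2 * (d + 2))"
      by (simp add: bt algebra_simps power2_eq_square)
    also have "\<dots> < 0" using \<open>t \<noteq> 0\<close> d by simp
    finally show False using q[of "- t"] by simp
  qed
  then show thesis
    using that[of e \<mu>] e \<open>M e u0 = 0\<close> \<open>M e e = 1\<close> low by (auto simp: S_def)
qed

end

section \<open>Sums over subsets\<close>

lemma sum_Pow_card:
  fixes f :: "nat \<Rightarrow> real"
  assumes "finite S"
  shows "(\<Sum>T\<in>Pow S. f (card T)) = (\<Sum>k\<le>card S. real (card S choose k) * f k)"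
proof -
  have "(\<Sum>T\<in>Pow S. f (card T)) = (\<Sum>k\<le>card S. \<Sum>T\<in>{T\<in>Pow S. card T = k}. f (card T))"
    by (rule sum.group[symmetric]) (use assms in \<open>auto intro: card_mono\<close>)
  also have "\<dots> = (\<Sum>k\<le>card S. real (card {T. T \<subseteq> S \<and> card T = k}) * f k)"
    by (intro sum.cong) (auto simp: Pow_def)
  finally show ?thesis using n_subsets[OF assms] by simp
qed

lemma sum_proper_subsets_card:
  fixes f :: "nat \<Rightarrow> real"
  assumes "finite S" "S \<noteq> {}"
  shows "(\<Sum>T\<in>Pow S - {{}, S}. f (card T)) = (\<Sum>k=1..<card S. real (card S choose k) * f k)"
proof -
  have "card S > 0" using assms by (simp add: card_gt_0_iff)
  have "(\<Sum>T\<in>Pow S. f (card T)) = f (card S) + f 0 + (\<Sum>T\<in>Pow S - {{}, S}. f (card T))"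
    using assms by (subst sum.subset_diff[of "{{}, S}"]) auto
  moreover have "(\<Sum>k\<le>card S. real (card S choose k) * f k) =
      f (card S) + f 0 + (\<Sum>k=1..<card S. real (card S choose k) * f k)"
  proof -
    have "{..card S} - {0, card S} = {1..<card S}" by auto
    then show ?thesis using \<open>card S > 0\<close>
      by (subst sum.subset_diff[of "{0, card S}"]) auto
  qed
  ultimately show ?thesis using sum_Pow_card[OF assms(1), of f] by simp
qed

lemma sum_Pow_insert:
  fixes f :: "'a set \<Rightarrow> real"
  assumes "finite S" "x \<notin> S"
  shows "(\<Sum>T\<in>Pow (insert x S). f T) = (\<Sum>T\<in>Pow S. f T) + (\<Sum>T\<in>Pow S. f (insert x T))"
proof -
  have "inj_on (insert x) (Pow S)" using assms(2) by (auto simp: inj_on_def)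
  then show ?thesis unfolding Pow_insert using assms
    by (subst sum.union_disjoint) (auto simp: sum.reindex)
qed

text \<open>From (n choose k) \<ge> (n/k)^k with n/k \<ge> 2.\<close>

lemma two_power_le_binomial:
  assumes "2 * k \<le> n"
  shows "2 ^ k \<le> real (n choose k)"
proof (cases "k = 0")
  case False
  have "(2::real) ^ k \<le> (real n / real k) ^ k"
    using assms False by (intro power_mono) (simp_all add: field_simps)
  also have "\<dots> \<le> real (n choose k)"
    using assms by (intro binomial_ge_n_over_k_pow_k) auto
  finally show ?thesis .
qed simp

text \<open>Since (n choose k) is at least 2 to the power min k (n - k), the summand is at most q to
  that power for q = 2^(-\<epsilon>). Two geometric series bound the sum by 2 q / (1 - q), which is
  the first factor of \<open>C_eps\<close>.\<close>

lemma sum_binomial_powr_le: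
  assumes eps: "\<epsilon> \<in> {0<..<1}"
  shows "(\<Sum>k=1..<n. real (n choose k) powr (-\<epsilon>)) \<le> C_eps \<epsilon>"
proof -
  define q where "q = (2::real) powr (-\<epsilon>)"
  have q: "q > 0" "q < 1" using eps by (auto simp: q_def powr_less_one)
  have two_q: "2 powr (1 - \<epsilon>) = 2 * q"
    by (simp add: q_def powr_diff powr_minus divide_inverse)
  have geo: "(\<Sum>k\<in>K. q ^ k) \<le> q / (1 - q)" if "finite K" "0 \<notin> K" for K
  proof -
    have sm: "summable (\<lambda>k. q ^ Suc k)" using q by (simp add: summable_geometric)
    have "Suc ` ((\<lambda>k. k - 1) ` K) = id ` K"
      unfolding image_image
    proof (rule image_cong[OF refl])
      fix k assume "k \<in> K"
      then have "k \<noteq> 0" using that(2) by metis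
      then show "Suc (k - 1) = id k" by simp
    qed
    then have "K = Suc ` ((\<lambda>k. k - 1) ` K)" by simp
    then have "(\<Sum>k\<in>K. q ^ k) = (\<Sum>k\<in>(\<lambda>k. k - 1) ` K. q ^ Suc k)"
      by (metis (mono_tags, lifting) inj_Suc inj_on_subset subset_UNIV sum.reindex_cong)
    also have "\<dots> \<le> (\<Sum>k. q ^ Suc k)"
      using that q by (intro sum_le_suminf sm) auto
    also have "\<dots> = q / (1 - q)"
      using q suminf_geometric[of q] by (simp add: suminf_mult summable_geometric divide_inverse)
    finally show ?thesis .
  qed
  have term_le: "real (n choose k) powr (-\<epsilon>) \<le> q ^ min k (n - k)" if "k \<in> {1..<n}" for k
  proof -
    have *: "real (n choose k) \<ge> 2 ^ min k (n - k)"
    proof (cases "2 * k \<le> n")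
      case True
      then show ?thesis using two_power_le_binomial[OF True] min_absorb1[of k "n - k"] True by simp
    next
      case False
      then have "2 ^ (n - k) \<le> real (n choose (n - k))" by (intro two_power_le_binomial) auto
      then show ?thesis using that binomial_symmetric[of k n] min_absorb2[of "n - k" k] False by simp
    qed
    have "real (n choose k) powr (-\<epsilon>) \<le> (2 ^ min k (n - k)) powr (-\<epsilon>)"
      using * eps by (intro powr_mono2') auto
    also have "\<dots> = q ^ min k (n - k)"
      by (simp add: q_def powr_realpow[symmetric] powr_powr mult.commute)
    finally show ?thesis .
  qed
  have "(\<Sum>k=1..<n. real (n choose k) powr (-\<epsilon>)) \<le> (\<Sum>k=1..<n. q ^ min k (n - k))"
    using term_le by (rule sum_mono)
  also have "\<dots> \<le> (\<Sum>k=1..<n. q ^ k + q ^ (n - k))"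
    using q by (intro sum_mono) (simp add: min_def)
  also have "\<dots> = (\<Sum>k=1..<n. q ^ k) + (\<Sum>k=1..<n. q ^ (n - k))"
    by (rule sum.distrib)
  also have "(\<Sum>k=1..<n. q ^ (n - k)) = (\<Sum>k=1..<n. q ^ k)"
    by (rule sum.reindex_bij_witness[of _ "\<lambda>k. n - k" "\<lambda>k. n - k"]) auto
  also have "(\<Sum>k=1..<n. q ^ k) + (\<Sum>k=1..<n. q ^ k) \<le> q / (1 - q) + q / (1 - q)"
    by (intro add_mono geo) auto
  also have "\<dots> = 2 powr (1 - \<epsilon>) / (1 - 2 powr (- \<epsilon>)) * 1"
    unfolding two_q by (simp flip: q_def)
  \<comment> \<open>The second factor of \<open>C_eps\<close> is at least 1, because sqrt(2 pi)
    \<le> 4 \<le> e^2.\<close>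
  also have "\<dots> \<le> C_eps \<epsilon>"
    unfolding C_eps_def
  proof (rule mult_left_mono)
    have "sqrt (2 * pi) \<le> 4" using pi_less_4 by (intro real_le_lsqrt) auto
    also have "\<dots> \<le> (exp 1)\<^sup>2"
      using power_mono[of 2 "exp 1 :: real" 2] exp_ge_add_one_self[of 1] by simp
    finally have "1 \<le> (exp 1)\<^sup>2 / sqrt (2 * pi)" by (subst le_divide_eq_1_pos) auto
    then show "1 \<le> ((exp 1)\<^sup>2 / sqrt (2 * pi)) powr \<epsilon>"
      using eps by (intro ge_one_powr_ge_zero) auto
    show "0 \<le> 2 powr (1 - \<epsilon>) / (1 - 2 powr (- \<epsilon>))" using q by (simp add: q_def)
  qed
  finally show ?thesis .
qed

text \<open>The extra exponent \<epsilon> turns the growing Leibniz factor (n choose k) into the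
  decaying weight (n choose k)^(-\<epsilon>).\<close>

lemma binomial_fact_powr:
  assumes "k \<le> n"
  shows "real (n choose k) * (fact k powr (1+\<epsilon>) * fact (n - k) powr (1+\<epsilon>)) =
    fact n powr (1+\<epsilon>) * real (n choose k) powr (-\<epsilon>)"
proof -
  define c where "c = real (n choose k)"
  have c: "c > 0" using assms by (simp add: c_def)
  have n: "fact n = fact k * fact (n - k) * c"
    using binomial_fact_lemma[OF assms] unfolding c_def by (metis of_nat_fact of_nat_mult)
  have "fact n powr (1+\<epsilon>) * c powr (-\<epsilon>) = (fact k powr (1+\<epsilon>) * fact (n - k) powr (1+\<epsilon>)) * (c powr (1+\<epsilon>) * c powr (-\<epsilon>))"
    using c by (simp add: n powr_mult)
  also have "c powr (1+\<epsilon>) * c powr (-\<epsilon>) = c" using c by (simp flip: powr_add)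
  finally show ?thesis by (simp add: c_def)
qed

text \<open>The binomial coefficients of the Leibniz rule reappear as the numbers of subsets of each
  size.\<close>

lemma sum_proper_subsets_fact_le:
  assumes "finite S" "S \<noteq> {}" "\<epsilon> \<in> {0<..<1}"
  shows "(\<Sum>T\<in>Pow S - {{}, S}. fact (card T) powr (1+\<epsilon>) * fact (card (S - T)) powr (1+\<epsilon>))
    \<le> fact (card S) powr (1+\<epsilon>) * C_eps \<epsilon>"
proof -
  have "(\<Sum>T\<in>Pow S - {{}, S}. fact (card T) powr (1+\<epsilon>) * fact (card (S - T)) powr (1+\<epsilon>))
     = (\<Sum>T\<in>Pow S - {{}, S}. fact (card T) powr (1+\<epsilon>) * fact (card S - card T) powr (1+\<epsilon>))"
    using assms by (intro sum.cong) (auto simp: card_Diff_subset finite_subset)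
  also have "\<dots> = (\<Sum>k=1..<card S. real (card S choose k) * (fact k powr (1+\<epsilon>) * fact (card S - k) powr (1+\<epsilon>)))"
    by (rule sum_proper_subsets_card[OF assms(1,2)])
  also have "\<dots> = fact (card S) powr (1+\<epsilon>) * (\<Sum>k=1..<card S. real (card S choose k) powr (-\<epsilon>))"
    unfolding sum_distrib_left by (intro sum.cong binomial_fact_powr) auto
  also have "\<dots> \<le> fact (card S) powr (1+\<epsilon>) * C_eps \<epsilon>"
    by (intro mult_left_mono sum_binomial_powr_le assms) auto
  finally show ?thesis .
qed

section \<open>Bounds for the recursion satisfied by the derivatives\<close>

text \<open>The induction hypothesis for nonempty sets carries the extra factor \<open>1 / K\<close>, and for the
  eigenvalue also \<open>\<gamma>\<close>; the products of two such derivatives then gain \<open>1 / K\<^sup>2\<close>,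
  which absorbs the constants of the convolution sums.\<close>

lemma recursion_bound:
  fixes u :: "'i set \<Rightarrow> 'v::real_vector" and l :: "'i set \<Rightarrow> real"
  assumes G: "symbil V G" and A: "symbil V A" and M: "symbil V M"
    and G_nonneg: "\<And>v. v \<in> V \<Longrightarrow> G v v \<ge> 0"
    and uV: "\<And>S. finite S \<Longrightarrow> u S \<in> V"
    and E1: "\<And>S v. finite S \<Longrightarrow> v \<in> V \<Longrightarrow>
       A (u S) v + (\<Sum>s\<in>S. B s (u (S - {s})) v) = (\<Sum>T\<in>Pow S. l (S - T) * M (u T) v)"
    and E2: "\<And>S. finite S \<Longrightarrow> (\<Sum>T\<in>Pow S. M (u T) (u (S - T))) = (if S = {} then 1 else 0)"
    and B_le: "\<And>s v w. v \<in> V \<Longrightarrow> w \<in> V \<Longrightarrow> \<bar>B s v w\<bar> \<le> \<beta> s * \<gamma> / K * (sqrt (G v v) * sqrt (G w w))"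
    and M_le: "\<And>v w. v \<in> V \<Longrightarrow> w \<in> V \<Longrightarrow> \<bar>M v w\<bar> \<le> m * (sqrt (G v v) * sqrt (G w w))"
    and coercive: "\<And>v. v \<in> V \<Longrightarrow> M v (u {}) = 0 \<Longrightarrow> \<gamma> * G v v \<le> A v v - l {} * M v v"
    and U: "sqrt (G (u {}) (u {})) \<le> U" "U > 0" and gam: "\<gamma> > 0" and m: "m \<ge> 0"
    and beta: "\<And>s. \<beta> s \<ge> 0"
    and eps: "\<epsilon> \<in> {0<..<1}"
    and K: "K = 3/2 * (m * U\<^sup>2) * C_eps \<epsilon> + 1"
    and S: "finite S" "S \<noteq> {}"
  shows "\<bar>l S\<bar> \<le> \<gamma> * U\<^sup>2 / K * (fact (card S) powr (1+\<epsilon>) * prod \<beta> S) \<and>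
         sqrt (G (u S) (u S)) \<le> U / K * (fact (card S) powr (1+\<epsilon>) * prod \<beta> S)"
  using S
proof (induction "card S" arbitrary: S rule: less_induct)
  case less
  note fin = \<open>finite S\<close> and ne = \<open>S \<noteq> {}\<close>
  define nrm where "nrm v = sqrt (G v v)" for v
  define R where "R = m * U\<^sup>2"
  define W where "W T = fact (card T) powr (1+\<epsilon>) * prod \<beta> T" for T
  have W0: "W T \<ge> 0" for T by (simp add: W_def beta prod_nonneg)
  have nrm0: "nrm v \<ge> 0" if "v \<in> V" for v using G_nonneg that by (simp add: nrm_def)
  have Ce: "C_eps \<epsilon> \<ge> 0" using sum_binomial_powr_le[OF eps, of 0] by simp
  have R0: "R \<ge> 0" using m by (simp add: R_def)
  have K1: "K \<ge> 1" using R0 Ce by (simp add: K R_def[symmetric])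
  let ?u = "u {}"
  have uV0: "?u \<in> V" using uV by simp
  have Pfin: "finite T" if "T \<in> Pow S - {{}, S}" for T using that fin finite_subset by auto
  have IH: "\<bar>l T\<bar> \<le> \<gamma> * U\<^sup>2 / K * W T" "nrm (u T) \<le> U / K * W T"
    if "T \<in> Pow S - {{}, S}" for T
  proof -
    have "card T < card S" using that fin by (intro psubset_card_mono) auto
    then show "\<bar>l T\<bar> \<le> \<gamma> * U\<^sup>2 / K * W T" "nrm (u T) \<le> U / K * W T"
      using less(1)[of T] that Pfin[OF that] by (auto simp: W_def nrm_def)
  qed
  have compl: "S - T \<in> Pow S - {{}, S}" if "T \<in> Pow S - {{}, S}" for T using that by auto
  have prodS: "prod \<beta> T * prod \<beta> (S - T) = prod \<beta> S" if "T \<subseteq> S" for T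
    using prod.subset_diff[OF that fin, of \<beta>] by (simp add: mult.commute)
  \<comment> \<open>For a singleton the coefficient term contains the undifferentiated
    eigenfunction, which is bounded by \<open>U\<close> without the gain 1 / K, but the convolution
    sums are empty. For larger sets every derivative that occurs has the gain. In both cases
    \<theta> + (3/2) R C / K is at most 1; this requirement determines \<open>K\<close>.\<close>
  define \<theta> where "\<theta> = (if card S = 1 then 1 else 1 / K)"
  define C where "C = (if card S = 1 then 0 else C_eps \<epsilon>)"
  have C0: "C \<ge> 0" using Ce by (simp add: C_def)
  have theta0: "\<theta> \<ge> 0" using K1 by (simp add: \<theta>_def)
  have theta_C: "\<theta> + 3/2 * (R * C / K) \<le> 1"
    using K1 by (simp add: \<theta>_def C_def field_simps) (simp add: K R_def)
  have sumW: "(\<Sum>T\<in>Pow S - {{}, S}. W T * W (S - T)) \<le> C * W S"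
  proof (cases "card S = 1")
    case True
    then obtain s where "S = {s}" by (auto simp: card_1_singleton_iff)
    then have "Pow S - {{}, S} = {}" by auto
    then show ?thesis using True by (simp only: sum.empty) (simp add: C_def)
  next
    case False
    have "(\<Sum>T\<in>Pow S - {{}, S}. W T * W (S - T)) =
      (\<Sum>T\<in>Pow S - {{}, S}. fact (card T) powr (1+\<epsilon>) * fact (card (S - T)) powr (1+\<epsilon>)) * prod \<beta> S"
      unfolding sum_distrib_right
    proof (rule sum.cong[OF refl])
      fix T assume "T \<in> Pow S - {{}, S}"
      then show "W T * W (S - T) = fact (card T) powr (1+\<epsilon>) * fact (card (S - T)) powr (1+\<epsilon>) * prod \<beta> S"
        using prodS[of T, symmetric] by (simp add: W_def mult_ac)
    qed
    also have "\<dots> \<le> (fact (card S) powr (1+\<epsilon>) * C_eps \<epsilon>) * prod \<beta> S"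
      by (intro mult_right_mono sum_proper_subsets_fact_le fin ne eps prod_nonneg beta)
    finally show ?thesis using False by (simp add: W_def C_def mult_ac)
  qed
  have first: "\<bar>\<Sum>s\<in>S. B s (u (S - {s})) v\<bar> \<le> \<gamma> * U / K * (\<theta> * W S) * nrm v" if v: "v \<in> V" for v
  proof -
    have nrm_le: "nrm (u (S - {s})) \<le> U * \<theta> * W (S - {s})" if "s \<in> S" for s
    proof (cases "card S = 1")
      case True
      then have "S = {s}" using that by (auto simp: card_1_singleton_iff)
      then show ?thesis using U True by (simp add: nrm_def W_def \<theta>_def)
    next
      case False
      then have "S - {s} \<noteq> {}" using that by (metis card_1_singleton_iff insert_Diff One_nat_def)
      then show ?thesis using that IH(2)[of "S - {s}"] False by (auto simp: \<theta>_def)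
    qed
    have "\<bar>\<Sum>s\<in>S. B s (u (S - {s})) v\<bar> \<le> (\<Sum>s\<in>S. \<bar>B s (u (S - {s})) v\<bar>)" by (rule sum_abs)
    also have "\<dots> \<le> (\<Sum>s\<in>S. \<gamma> * U / K * \<theta> * nrm v * (fact (card S) powr (1+\<epsilon>) * prod \<beta> S) / card S)"
    proof (rule sum_mono)
      fix s assume s: "s \<in> S"
      have cs: "card S > 0" using fin ne by (simp add: card_gt_0_iff)
      \<comment> \<open>The sum over \<open>s\<close> has n = \<open>card S\<close> terms, and n
        ((n-1)!)^(1+\<epsilon>) stays below (n!)^(1+\<epsilon>) because n \<le>
        n^(1+\<epsilon>).\<close>
      have f: "fact (card S - 1) powr (1+\<epsilon>) * card S \<le> fact (card S) powr (1+\<epsilon>)"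
      proof -
        have "(fact (card S) :: real) = fact (card S - 1) * card S"
          using fact_reduce[OF cs] by (simp add: mult.commute)
        then have "fact (card S) powr (1+\<epsilon>) = fact (card S - 1) powr (1+\<epsilon>) * real (card S) powr (1+\<epsilon>)"
          by (simp add: powr_mult)
        moreover have "real (card S) powr 1 \<le> real (card S) powr (1+\<epsilon>)"
          using cs eps by (intro powr_mono) auto
        ultimately show ?thesis using cs by (simp add: mult_left_mono)
      qed
      have "\<bar>B s (u (S - {s})) v\<bar> \<le> \<beta> s * \<gamma> / K * (nrm (u (S - {s})) * nrm v)"
        using B_le[of "u (S - {s})" v s] uV fin v by (simp add: nrm_def)
      also have "\<dots> \<le> \<beta> s * \<gamma> / K * (U * \<theta> * W (S - {s}) * nrm v)"
        using nrm_le[OF s] nrm0[OF v] beta gam K1 by (intro mult_left_mono mult_right_mono) auto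
      also have "\<dots> = \<gamma> * U / K * \<theta> * nrm v * (fact (card S - 1) powr (1+\<epsilon>) * (\<beta> s * prod \<beta> (S - {s})))"
        using s fin by (simp add: W_def mult_ac)
      also have "\<beta> s * prod \<beta> (S - {s}) = prod \<beta> S" using s fin by (simp add: prod.remove)
      also have "\<gamma> * U / K * \<theta> * nrm v * (fact (card S - 1) powr (1+\<epsilon>) * prod \<beta> S) \<le>
          \<gamma> * U / K * \<theta> * nrm v * ((fact (card S) powr (1+\<epsilon>) / card S) * prod \<beta> S)"
        using f cs gam U K1 nrm0[OF v] beta theta0
        by (intro mult_left_mono mult_right_mono) (auto simp: field_simps prod_nonneg)
      finally show "\<bar>B s (u (S - {s})) v\<bar> \<le> \<gamma> * U / K * \<theta> * nrm v * (fact (card S) powr (1+\<epsilon>) * prod \<beta> S) / card S"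
        by simp
    qed
    also have "\<dots> = \<gamma> * U / K * (\<theta> * W S) * nrm v"
      using fin ne by (simp add: W_def)
    finally show ?thesis .
  qed
  have conv: "\<bar>\<Sum>T\<in>Pow S - {{}, S}. l (S - T) * M (u T) v\<bar> \<le> \<gamma> * U / K * (R * C / K * W S) * nrm v"
    if v: "v \<in> V" for v
  proof -
    have "\<bar>\<Sum>T\<in>Pow S - {{}, S}. l (S - T) * M (u T) v\<bar> \<le>
        (\<Sum>T\<in>Pow S - {{}, S}. \<bar>l (S - T) * M (u T) v\<bar>)" by (rule sum_abs)
    also have "\<dots> \<le> (\<Sum>T\<in>Pow S - {{}, S}. (\<gamma> * U\<^sup>2 / K * W (S - T)) * (m * (U / K * W T * nrm v)))"
    proof (rule sum_mono)
      fix T assume T: "T \<in> Pow S - {{}, S}"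
      have "\<bar>M (u T) v\<bar> \<le> m * (U / K * W T * nrm v)"
        using M_le[of "u T" v] mult_left_mono[OF mult_right_mono[OF IH(2)[OF T] nrm0[OF v]] m]
          uV Pfin[OF T] v by (simp add: nrm_def)
      then show "\<bar>l (S - T) * M (u T) v\<bar> \<le> (\<gamma> * U\<^sup>2 / K * W (S - T)) * (m * (U / K * W T * nrm v))"
        unfolding abs_mult using gam K1 W0 by (intro mult_mono IH(1)[OF compl[OF T]]) auto
    qed
    also have "\<dots> = (\<gamma> * U / K * (R / K) * nrm v) * (\<Sum>T\<in>Pow S - {{}, S}. W T * W (S - T))"
      unfolding sum_distrib_left R_def by (intro sum.cong) (auto simp: power2_eq_square)
    also have "\<dots> \<le> (\<gamma> * U / K * (R / K) * nrm v) * (C * W S)"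
      using gam U K1 R0 nrm0[OF v] by (intro mult_left_mono sumW) auto
    finally show ?thesis by (simp add: mult_ac)
  qed
  have split: "(\<Sum>T\<in>Pow S. f T) = f {} + f S + (\<Sum>T\<in>Pow S - {{}, S}. f T)" for f :: "'i set \<Rightarrow> real"
    using fin ne by (subst sum.subset_diff[of "{{}, S}"]) auto
  have M00: "M ?u ?u = 1" using E2[of "{}"] by simp
  have E1S: "A (u S) v - l {} * M (u S) v = l S * M ?u v - (\<Sum>s\<in>S. B s (u (S - {s})) v)
      + (\<Sum>T\<in>Pow S - {{}, S}. l (S - T) * M (u T) v)" if "v \<in> V" for v
    using E1[OF fin that] split[of "\<lambda>T. l (S - T) * M (u T) v"] by simp
  have eig: "A ?u v = l {} * M ?u v" if "v \<in> V" for v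
    using E1[of "{}" v] that by simp
  have uSV: "u S \<in> V" using uV fin by simp
  \<comment> \<open>Tested with the eigenfunction, the equation loses its unknown \<open>u S\<close>
    by symmetry and can be solved for \<open>l S\<close>.\<close>
  have zero_test: "A (u S) ?u - l {} * M (u S) ?u = 0"
    using eig[OF uSV] symbil_sym[OF A uSV uV0] symbil_sym[OF M uSV uV0] by simp
  have nu: "nrm ?u \<le> U" using U by (simp add: nrm_def)
  have comb: "first + conv \<le> \<gamma> * U / K * (\<theta> * W S + R * C / K * W S) * x"
    if "first \<le> \<gamma> * U / K * (\<theta> * W S) * x" "conv \<le> \<gamma> * U / K * (R * C / K * W S) * x" for first conv x
    using that by (simp add: algebra_simps)
  have l_bd: "\<bar>l S\<bar> \<le> \<gamma> * U\<^sup>2 / K * W S"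
  proof -
    have "\<bar>l S\<bar> = \<bar>(\<Sum>s\<in>S. B s (u (S - {s})) ?u) - (\<Sum>T\<in>Pow S - {{}, S}. l (S - T) * M (u T) ?u)\<bar>"
      using E1S[OF uV0] zero_test M00 by simp
    also have "\<dots> \<le> \<gamma> * U / K * (\<theta> * W S + R * C / K * W S) * nrm ?u"
      using comb[OF first[OF uV0] conv[OF uV0]] by linarith
    also have "\<dots> \<le> \<gamma> * U / K * W S * U"
    proof (rule mult_mono[OF mult_left_mono nu])
      have "R * C / K \<ge> 0" using R0 C0 K1 by simp
      then have "(\<theta> + R * C / K) * W S \<le> 1 * W S"
        using theta_C W0 by (intro mult_right_mono) linarith+
      then show "\<theta> * W S + R * C / K * W S \<le> W S" by (simp add: algebra_simps)
    qed (use gam U K1 W0 nrm0[OF uV0] in auto)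
    finally show ?thesis by (simp add: power2_eq_square mult_ac)
  qed
  have u_bd: "nrm (u S) \<le> U / K * W S"
  proof -
    define p where "p = M (u S) ?u"
    \<comment> \<open>The component that is \<open>M\<close>-orthogonal to the eigenfunction, where
      the spectral gap gives coercivity; \<open>p\<close> is the coefficient of the parallel
      component.\<close>
    define w where "w = u S - p *\<^sub>R ?u"
    note sA = symbil_simps[OF A] and sM = symbil_simps[OF M] and sG = symbil_simps[OF G]
    have wV: "w \<in> V" using uSV uV0 by (simp add: w_def sM)
    have Mw: "M ?u w = 0" "M w ?u = 0"
      using uSV uV0 M00 symbil_sym[OF M uSV uV0] by (auto simp: w_def sM p_def)
    have "\<gamma> * G w w \<le> A w w - l {} * M w w"
      using coercive[OF wV] Mw by simp
    \<comment> \<open>The parallel component drops out because the eigenfunction solves the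
      undifferentiated equation. In the differentiated equation tested with \<open>w\<close>, the
      unknown \<open>l S\<close> disappears as well.\<close>
    also have "\<dots> = A (u S) w - l {} * M (u S) w"
    proof -
      have "A w w = A (u S) w - p * A ?u w" "M w w = M (u S) w - p * M ?u w"
        using symbil_diff_left[OF A, of "u S" "p *\<^sub>R ?u" w] symbil_diff_left[OF M, of "u S" "p *\<^sub>R ?u" w]
          uSV uV0 wV by (simp_all add: sA(3,9) sM(3,9) flip: w_def)
      then show ?thesis using eig[OF wV] Mw by simp
    qed
    also have "\<dots> \<le> \<gamma> * U / K * (\<theta> * W S + R * C / K * W S) * nrm w"
    proof (rule order_trans[OF _ comb[OF first[OF wV] conv[OF wV]]])
      show "A (u S) w - l {} * M (u S) w \<le> \<bar>\<Sum>s\<in>S. B s (u (S - {s})) w\<bar>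
          + \<bar>\<Sum>T\<in>Pow S - {{}, S}. l (S - T) * M (u T) w\<bar>"
        unfolding E1S[OF wV] Mw(1) by linarith
    qed
    finally have "\<gamma> * (nrm w * nrm w) \<le> \<gamma> * (U / K * (\<theta> * W S + R * C / K * W S) * nrm w)"
      using G_nonneg[OF wV] by (simp add: nrm_def mult_ac)
    then have *: "nrm w * nrm w \<le> U / K * (\<theta> * W S + R * C / K * W S) * nrm w"
      using gam by (simp only: mult_le_cancel_left_pos)
    have w_bd: "nrm w \<le> U / K * (\<theta> * W S + R * C / K * W S)"
    proof (cases "nrm w = 0")
      case True
      then show ?thesis using U K1 theta0 W0 R0 C0 by simp
    next
      case False
      then have "nrm w > 0" using nrm0[OF wV] by simp
      then show ?thesis using * by (simp only: mult_le_cancel_right_pos)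
    qed
    \<comment> \<open>The empty and the full subset both contribute \<open>p\<close>, so the
      normalisation determines 2 p. Hence the parallel component costs only half a
      convolution.\<close>
    have "M ?u (u S) + M (u S) ?u + (\<Sum>T\<in>Pow S - {{}, S}. M (u T) (u (S - T))) = 0"
      using E2[OF fin] split[of "\<lambda>T. M (u T) (u (S - T))"] ne by (simp only: Diff_empty Diff_cancel if_False)
    then have "2 * p = - (\<Sum>T\<in>Pow S - {{}, S}. M (u T) (u (S - T)))"
      using symbil_sym[OF M uSV uV0] unfolding p_def by linarith
    then have "2 * \<bar>p\<bar> \<le> (\<Sum>T\<in>Pow S - {{}, S}. \<bar>M (u T) (u (S - T))\<bar>)"
      using sum_abs[of "\<lambda>T. M (u T) (u (S - T))" "Pow S - {{}, S}"] by linarith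
    also have "\<dots> \<le> (\<Sum>T\<in>Pow S - {{}, S}. m * (U / K)\<^sup>2 * (W T * W (S - T)))"
    proof (rule sum_mono)
      fix T assume T: "T \<in> Pow S - {{}, S}"
      have V: "u T \<in> V" "u (S - T) \<in> V" using uV Pfin[OF T] Pfin[OF compl[OF T]] by auto
      have "\<bar>M (u T) (u (S - T))\<bar> \<le> m * (nrm (u T) * nrm (u (S - T)))"
        using M_le[OF V] by (simp add: nrm_def)
      also have "\<dots> \<le> m * ((U / K * W T) * (U / K * W (S - T)))"
        using nrm0 V U K1 W0 by (intro mult_left_mono[OF _ m] mult_mono[OF IH(2)[OF T] IH(2)[OF compl[OF T]]]) auto
      finally show "\<bar>M (u T) (u (S - T))\<bar> \<le> m * (U / K)\<^sup>2 * (W T * W (S - T))"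
        by (simp add: power2_eq_square mult_ac)
    qed
    also have "\<dots> = m * (U / K)\<^sup>2 * (\<Sum>T\<in>Pow S - {{}, S}. W T * W (S - T))"
      by (simp add: sum_distrib_left)
    also have "\<dots> \<le> m * (U / K)\<^sup>2 * (C * W S)"
      using m by (intro mult_left_mono sumW) auto
    finally have p_bd: "\<bar>p\<bar> \<le> m * (U / K)\<^sup>2 * (C * W S) / 2" by simp
    have "nrm (u S) \<le> nrm w + nrm (p *\<^sub>R ?u)"
      using symbil_triangle[OF G G_nonneg, of w "p *\<^sub>R ?u"] wV uV0 by (simp add: nrm_def w_def sG)
    also have "nrm (p *\<^sub>R ?u) = \<bar>p\<bar> * nrm ?u"
      using uV0 by (simp add: nrm_def sG real_sqrt_mult)
    \<comment> \<open>The orthogonal part contributes \<theta> + R C / K and the parallel part half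
      of R C / K, whence the 3/2 in \<open>K\<close>.\<close>
    also have "nrm w + \<bar>p\<bar> * nrm ?u \<le> U / K * (\<theta> * W S + R * C / K * W S) + (m * (U / K)\<^sup>2 * (C * W S) / 2) * U"
      using nrm0[OF uV0] m C0 W0 by (intro add_mono[OF w_bd mult_mono[OF p_bd nu]]) auto
    also have "\<dots> = U / K * ((\<theta> + 3/2 * (R * C / K)) * W S)"
    proof -
      have "m * (U / K)\<^sup>2 * U = U / K * (R / K)" by (simp add: R_def power2_eq_square)
      then have "(m * (U / K)\<^sup>2 * (C * W S) / 2) * U = U / K * (R / K) * (C * W S) / 2"
        by (metis (no_types, lifting) mult.assoc mult.commute times_divide_eq_left)
      then show ?thesis by (simp only:) (simp add: algebra_simps)
    qed
    also have "\<dots> \<le> U / K * (1 * W S)"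
      using theta_C W0 U K1 by (intro mult_left_mono mult_right_mono) auto
    finally show ?thesis by simp
  qed
  show ?case using l_bd u_bd by (simp add: W_def nrm_def)
qed

section \<open>Smooth functions\<close>

lemma frechet_derivative_everywhere:
  assumes "\<And>x. (f has_derivative F x) (at x)"
  shows "frechet_derivative f (at x) = F x"
  using frechet_derivative_at[OF assms] by simp

text \<open>Allows an explicit derivative in place of the one selected by
  \<open>frechet_derivative\<close>, so that smoothness follows from differentiation rules by
  induction on the order.\<close>

lemma times_cont_diff_SucI:
  assumes "\<And>x. (f has_derivative F x) (at x)" and "\<And>h. times_cont_diff k (\<lambda>x. F x h)"
  shows "times_cont_diff (Suc k) f"
  using assms frechet_derivative_everywhere[of f F, OF assms(1)]
  by (auto simp: differentiable_def)

lemma times_cont_diff_SucD: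
  assumes "times_cont_diff (Suc k) f"
  shows "(f has_derivative frechet_derivative f (at x)) (at x)"
    and "times_cont_diff k (\<lambda>x. frechet_derivative f (at x) h)"
  using assms frechet_derivative_works by auto

lemma times_cont_diff_continuous: "times_cont_diff k f \<Longrightarrow> continuous_on UNIV f"
  by (cases k) (auto intro!: continuous_at_imp_continuous_on differentiable_imp_continuous_within)

lemma times_cont_diff_Suc_imp: "times_cont_diff (Suc k) f \<Longrightarrow> times_cont_diff k f"
proof (induction k arbitrary: f)
  case 0
  then show ?case using times_cont_diff_continuous[OF 0] by simp
next
  case (Suc k)
  then show ?case by (meson times_cont_diff.simps(2))
qed

lemma times_cont_diff_const: "times_cont_diff k (\<lambda>x. c)"
  by (induction k arbitrary: c)
    (auto intro!: times_cont_diff_SucI[where F = "\<lambda>x h. 0"] derivative_eq_intros simp del: times_cont_diff.simps(2))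

lemma times_cont_diff_add:
  "times_cont_diff k f \<Longrightarrow> times_cont_diff k g \<Longrightarrow> times_cont_diff k (\<lambda>x. f x + g x)"
proof (induction k arbitrary: f g)
  case 0
  then show ?case by (simp add: continuous_on_add)
next
  case (Suc k)
  show ?case
    by (rule times_cont_diff_SucI[where F = "\<lambda>x h. frechet_derivative f (at x) h + frechet_derivative g (at x) h"])
      (intro has_derivative_add Suc.IH times_cont_diff_SucD[OF Suc.prems(1)] times_cont_diff_SucD[OF Suc.prems(2)])+
qed

lemma times_cont_diff_mult:
  "times_cont_diff k f \<Longrightarrow> times_cont_diff k g \<Longrightarrow> times_cont_diff k (\<lambda>x. f x * g x)"
proof (induction k arbitrary: f g)
  case 0
  then show ?case by (simp add: continuous_on_mult)
next
  case (Suc k)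
  note f = times_cont_diff_SucD[OF Suc.prems(1)] times_cont_diff_Suc_imp[OF Suc.prems(1)]
  note g = times_cont_diff_SucD[OF Suc.prems(2)] times_cont_diff_Suc_imp[OF Suc.prems(2)]
  show ?case
    by (rule times_cont_diff_SucI[where F = "\<lambda>x h. f x * frechet_derivative g (at x) h + frechet_derivative f (at x) h * g x"])
      (intro has_derivative_mult times_cont_diff_add Suc.IH f g)+
qed

lemma times_cont_diff_prod:
  "(\<And>i. i \<in> I \<Longrightarrow> times_cont_diff k (f i)) \<Longrightarrow> times_cont_diff k (\<lambda>x. \<Prod>i\<in>I. f i x)"
  by (induction I rule: infinite_finite_induct) (auto intro: times_cont_diff_const times_cont_diff_mult)

section \<open>Smooth bump functions on boxes\<close>

definition exp_tail :: "nat \<Rightarrow> real \<Rightarrow> real" where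
  "exp_tail k t = (if t > 0 then (1 / t) ^ k * exp (- (1 / t)) else 0)"

lemma exp_tail_tendsto_0: "(exp_tail k \<longlongrightarrow> 0) (at_right 0)"
proof -
  have "((\<lambda>t. (inverse t) ^ k / exp (inverse t)) \<longlongrightarrow> (0::real)) (at_right 0)"
    by (rule filterlim_compose[OF tendsto_power_div_exp_0 filterlim_inverse_at_top_right])
  then show ?thesis
    by (rule Lim_transform_eventually)
      (auto simp: exp_tail_def eventually_at_right_field exp_minus divide_inverse intro!: exI[of _ 1])
qed

text \<open>The powers of 1 / t are built into \<open>exp_tail\<close> so that derivatives are
  linear combinations of members of the same family. At 0 the difference quotient from the right is
  \<open>exp_tail (Suc k)\<close>, which tends to 0; from the left it vanishes.\<close>

lemma exp_tail_has_derivative: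
  "(exp_tail k has_real_derivative exp_tail (k + 2) t - real k * exp_tail (k + 1) t) (at t)"
proof -
  consider "t > 0" | "t < 0" | "t = 0" by linarith
  then show ?thesis
  proof cases
    case 1
    have inv: "((\<lambda>t. 1 / t) has_real_derivative - (1 / t)\<^sup>2) (at t)"
      using 1 by (auto intro!: derivative_eq_intros simp: power2_eq_square)
    have "((\<lambda>t. (1 / t) ^ k * exp (- (1 / t))) has_real_derivative
        real k * (1 / t) ^ (k - 1) * - (1 / t)\<^sup>2 * exp (- (1 / t)) + exp (- (1 / t)) * (1 / t)\<^sup>2 * (1 / t) ^ k) (at t)"
      by (rule DERIV_cong[OF DERIV_mult[OF DERIV_power[OF inv, of k] DERIV_chain2[OF DERIV_exp DERIV_minus[OF inv]]]]) simp
    moreover have "real k * (1 / t) ^ (k - 1) * - (1 / t)\<^sup>2 * exp (- (1 / t)) + exp (- (1 / t)) * (1 / t)\<^sup>2 * (1 / t) ^ k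
        = exp_tail (k + 2) t - real k * exp_tail (k + 1) t"
      using 1 by (cases k) (simp_all add: exp_tail_def power_add power2_eq_square mult_ac)
    ultimately have "((\<lambda>t. (1 / t) ^ k * exp (- (1 / t))) has_real_derivative
        exp_tail (k + 2) t - real k * exp_tail (k + 1) t) (at t)" by (simp only:)
    then show ?thesis
      by (rule has_field_derivative_transform_within_open[of _ _ _ "{0<..}"]) (use 1 in \<open>auto simp: exp_tail_def\<close>)
  next
    case 2
    have "((\<lambda>t. 0) has_real_derivative 0) (at t)" by simp
    then have "(exp_tail k has_real_derivative 0) (at t)"
      by (rule has_field_derivative_transform_within_open[of _ _ _ "{..<0}"]) (use 2 in \<open>auto simp: exp_tail_def\<close>)
    then show ?thesis using 2 by (simp add: exp_tail_def)
  next
    case 3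
    have "((\<lambda>h. exp_tail k h / h) \<longlongrightarrow> 0) (at_right 0)"
      by (rule Lim_transform_eventually[OF exp_tail_tendsto_0[of "Suc k"]])
        (auto simp: exp_tail_def eventually_at_right_field intro!: exI[of _ 1])
    moreover have "((\<lambda>h. exp_tail k h / h) \<longlongrightarrow> 0) (at_left 0)"
      by (rule Lim_transform_eventually[OF tendsto_const])
        (auto simp: exp_tail_def eventually_at_left_field intro!: exI[of _ "-1"])
    ultimately have "((\<lambda>h. exp_tail k h / h) \<longlongrightarrow> 0) (at 0)" by (simp add: filterlim_split_at)
    then show ?thesis using 3 by (simp add: DERIV_def exp_tail_def)
  qed
qed

lemma times_cont_diff_exp_tail:
  "times_cont_diff k (\<lambda>x :: real^'n. exp_tail m (c * x $ i + d))"
proof (induction k arbitrary: m)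
  case 0
  have "continuous_on UNIV (exp_tail m)"
    by (meson DERIV_continuous_on exp_tail_has_derivative has_field_derivative_at_within)
  then have "continuous_on UNIV (\<lambda>x :: real^'n. exp_tail m (c * x $ i + d))"
    by (rule continuous_on_compose2) (auto intro!: continuous_intros)
  then show ?case by simp
next
  case (Suc k)
  define F where "F x h = (exp_tail (m + 2) (c * x $ i + d) + - real m * exp_tail (m + 1) (c * x $ i + d)) * (c * h $ i)"
    for x h :: "real^'n"
  show ?case
  proof (rule times_cont_diff_SucI[where F = F])
    fix x :: "real^'n"
    have "((\<lambda>x :: real^'n. c * x $ i + d) has_derivative (\<lambda>h. c * h $ i)) (at x)"
      by (auto intro!: derivative_eq_intros bounded_linear.has_derivative[OF bounded_linear_vec_nth])
    from has_derivative_compose[OF this exp_tail_has_derivative[THEN has_field_derivative_imp_has_derivative]]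
    show "((\<lambda>x :: real^'n. exp_tail m (c * x $ i + d)) has_derivative F x) (at x)"
      by (simp add: F_def[abs_def])
    show "times_cont_diff k (\<lambda>x. F x h)" for h
      unfolding F_def by (intro times_cont_diff_mult times_cont_diff_add Suc times_cont_diff_const)
  qed
qed

text \<open>As m grows, each factor exp(-1/(m s)) tends to 1 for s > 0, so these functions converge
  pointwise to the indicator of the open box. They link test functions with measures of
  boxes.\<close>

definition box_bump :: "real^'n \<Rightarrow> real^'n \<Rightarrow> real \<Rightarrow> real^'n \<Rightarrow> real" where
  "box_bump a b m x = (\<Prod>i\<in>UNIV. exp_tail 0 (m * x $ i + - m * a $ i) * exp_tail 0 (- m * x $ i + m * b $ i))"

lemma exp_tail_0: "0 \<le> exp_tail 0 t" "exp_tail 0 t \<le> 1"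
  by (auto simp: exp_tail_def)

lemma box_bump_range: "0 \<le> box_bump a b m x" "box_bump a b m x \<le> 1"
  by (auto simp: box_bump_def exp_tail_0 intro!: prod_nonneg prod_le_1 mult_le_one mult_nonneg_nonneg)

lemma box_bump_outside:
  assumes "m > 0" "x \<notin> box a b"
  shows "box_bump a b m x = 0"
proof -
  obtain i where "\<not> (a $ i < x $ i \<and> x $ i < b $ i)" using assms(2) by (auto simp: mem_box_cart)
  then have "\<not> m * (x $ i - a $ i) > 0 \<or> \<not> m * (b $ i - x $ i) > 0" using assms(1) by (auto simp: zero_less_mult_iff)
  then have "exp_tail 0 (m * x $ i + - m * a $ i) * exp_tail 0 (- m * x $ i + m * b $ i) = 0"
    by (auto simp: exp_tail_def algebra_simps)
  then show ?thesis unfolding box_bump_def by (intro prod_zero) auto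
qed

lemma box_bump_test:
  assumes "m > 0" "cbox a b \<subseteq> D"
  shows "box_bump a b m \<in> test_functions D"
proof -
  have "closure {x. box_bump a b m x \<noteq> 0} \<subseteq> cbox a b"
  proof (rule closure_minimal)
    show "{x. box_bump a b m x \<noteq> 0} \<subseteq> cbox a b"
      using box_bump_outside[OF assms(1)] box_subset_cbox by blast
  qed (rule closed_cbox)
  moreover have "compact (closure {x. box_bump a b m x \<noteq> 0})"
    using calculation by (meson bounded_cbox bounded_closure bounded_subset closed_closure closure_subset compact_eq_bounded_closed)
  moreover have "times_cont_diff k (box_bump a b m)" for k
    unfolding box_bump_def[abs_def] by (intro times_cont_diff_prod times_cont_diff_mult times_cont_diff_exp_tail)
  ultimately show ?thesis using assms(2) by (auto simp: test_functions_def)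
qed

lemma exp_tail_0_tendsto_1:
  assumes "t > 0"
  shows "(\<lambda>n. exp_tail 0 (real (Suc n) * t)) \<longlonglongrightarrow> 1"
proof -
  have "(\<lambda>n. exp (- (inverse (real (Suc n)) * (1 / t)))) \<longlonglongrightarrow> exp (- (0 * (1 / t)))"
    by (intro tendsto_intros LIMSEQ_inverse_real_of_nat)
  moreover have "exp_tail 0 (real (Suc n) * t) = exp (- (inverse (real (Suc n)) * (1 / t)))" for n
    using assms by (simp add: exp_tail_def zero_less_mult_iff inverse_eq_divide)
  ultimately show ?thesis by simp
qed

lemma box_bump_tendsto: "(\<lambda>n. box_bump a b (real (Suc n)) x) \<longlonglongrightarrow> indicator (box a b) x"
proof (cases "x \<in> box a b")
  case True
  have "(\<lambda>n. \<Prod>i\<in>UNIV. exp_tail 0 (real (Suc n) * (x $ i - a $ i)) * exp_tail 0 (real (Suc n) * (b $ i - x $ i)))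
      \<longlonglongrightarrow> (\<Prod>i\<in>(UNIV :: 'a set). 1 * 1)"
    using True by (intro tendsto_prod tendsto_mult exp_tail_0_tendsto_1) (auto simp: mem_box_cart)
  then show ?thesis using True by (simp add: box_bump_def algebra_simps)
next
  case False
  then show ?thesis by (simp add: box_bump_outside)
qed

section \<open>Test functions and their gradients\<close>

lemma test_function_add: "\<phi> \<in> test_functions D \<Longrightarrow> \<psi> \<in> test_functions D \<Longrightarrow> (\<lambda>x. \<phi> x + \<psi> x) \<in> test_functions D"
proof -
  assume a: "\<phi> \<in> test_functions D" "\<psi> \<in> test_functions D"
  have "closure {x. \<phi> x + \<psi> x \<noteq> 0} \<subseteq> closure {x. \<phi> x \<noteq> 0} \<union> closure {x. \<psi> x \<noteq> 0}"
    unfolding closure_Un[symmetric] by (rule closure_mono) auto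
  moreover have "bounded {x. \<phi> x + \<psi> x \<noteq> 0}"
    by (rule bounded_subset[of "{x. \<phi> x \<noteq> 0} \<union> {x. \<psi> x \<noteq> 0}"])
      (use a in \<open>auto simp: test_functions_def\<close>)
  ultimately have "compact (closure {x. \<phi> x + \<psi> x \<noteq> 0})" "closure {x. \<phi> x + \<psi> x \<noteq> 0} \<subseteq> D"
    using a by (auto simp: test_functions_def)
  then show ?thesis using a by (auto simp: test_functions_def intro: times_cont_diff_add)
qed

lemma test_function_scale: "\<phi> \<in> test_functions D \<Longrightarrow> (\<lambda>x. c * \<phi> x) \<in> test_functions D"
  by (cases "c = 0")
    (auto simp: test_functions_def times_cont_diff_const intro!: times_cont_diff_mult)

lemma test_function_zero: "(\<lambda>x. 0) \<in> test_functions D"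
  by (simp add: test_functions_def times_cont_diff_const)

context
  fixes D :: "(real^'n) set" and \<phi>
  assumes phi: "\<phi> \<in> test_functions D"
begin

lemma test_function_has_derivative: "(\<phi> has_derivative (\<lambda>h. h \<bullet> classical_grad \<phi> x)) (at x)"
proof -
  have d: "(\<phi> has_derivative frechet_derivative \<phi> (at x)) (at x)"
    using phi times_cont_diff_SucD(1)[of 0 \<phi>] by (auto simp: test_functions_def simp del: times_cont_diff.simps)
  interpret l: bounded_linear "frechet_derivative \<phi> (at x)" using d by (rule has_derivative_bounded_linear)
  have "frechet_derivative \<phi> (at x) = (\<lambda>h. h \<bullet> classical_grad \<phi> x)"
  proof
    fix h
    have "frechet_derivative \<phi> (at x) (\<Sum>i\<in>UNIV. h $ i *\<^sub>R axis i 1) = (\<Sum>i\<in>UNIV. h $ i * classical_grad \<phi> x $ i)"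
      by (simp add: l.sum l.scaleR classical_grad_def)
    also have "(\<Sum>i\<in>UNIV. h $ i *\<^sub>R axis i 1) = h"
      using basis_expansion[of h] by (simp add: scalar_mult_eq_scaleR)
    finally show "frechet_derivative \<phi> (at x) h = h \<bullet> classical_grad \<phi> x" by (simp add: inner_vec_def)
  qed
  then show ?thesis using d by simp
qed

lemma test_function_continuous: "continuous_on S \<phi>"
  using phi times_cont_diff_continuous[of 0 \<phi>] by (auto simp: test_functions_def intro: continuous_on_subset simp del: times_cont_diff.simps)

lemma test_function_grad_continuous: "continuous_on S (classical_grad \<phi>)"
proof -
  have "times_cont_diff (Suc 0) \<phi>" using phi by (auto simp: test_functions_def simp del: times_cont_diff.simps)
  from times_cont_diff_SucD(2)[OF this]
  have "continuous_on S (\<lambda>x. frechet_derivative \<phi> (at x) h)" for h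
    by (auto intro: continuous_on_subset)
  then show ?thesis unfolding classical_grad_def[abs_def] by (intro continuous_on_vec_lambda)
qed

text \<open>One compact set serves for the function and its gradient: its complement is open and the
  function vanishes there, so the derivative is zero too.\<close>

lemma test_function_support:
  obtains K where "compact K" "K \<subseteq> D" "\<And>x. x \<notin> K \<Longrightarrow> \<phi> x = 0" "\<And>x. x \<notin> K \<Longrightarrow> classical_grad \<phi> x = 0"
proof -
  define K where "K = closure {x. \<phi> x \<noteq> 0}"
  have K: "compact K" "K \<subseteq> D" using phi unfolding test_functions_def K_def by blast+
  have zero: "\<phi> x = 0" if "x \<notin> K" for x
    using that closure_subset[of "{x. \<phi> x \<noteq> 0}"] unfolding K_def by blast
  have "classical_grad \<phi> x = 0" if x: "x \<notin> K" for x
  proof -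
    have "(\<phi> has_derivative (\<lambda>h. 0)) (at x)"
    proof (rule has_derivative_transform_within_open[OF has_derivative_const])
      show "open (- K)" using K(1) by (simp add: compact_imp_closed open_Compl)
    qed (use x zero in auto)
    from has_derivative_unique[OF this test_function_has_derivative]
    have "classical_grad \<phi> x \<bullet> classical_grad \<phi> x = 0" by metis
    then show ?thesis by simp
  qed
  then show thesis using that K zero by blast
qed

end

section \<open>The fundamental lemma and uniqueness of weak gradients\<close>

lemma open_sets_lebesgue [simp]: "open D \<Longrightarrow> D \<in> sets lebesgue" for D :: "'a::euclidean_space set"
  by (metis borel_open sets_completionI_sets sets_lborel)

lemma integral_lebesgue_on_indicator:
  fixes f :: "'a::euclidean_space \<Rightarrow> 'b::{banach, second_countable_topology}"
  assumes "D \<in> sets lebesgue"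
  shows "integral\<^sup>L (lebesgue_on D) f = (LINT x|lebesgue. indicator D x *\<^sub>R f x)"
    and "integrable (lebesgue_on D) f \<longleftrightarrow> integrable lebesgue (\<lambda>x. indicator D x *\<^sub>R f x)"
  using assms by (simp_all add: integral_restrict_space integrable_restrict_space)

lemma AE_lebesgue_on_iff:
  "D \<in> sets lebesgue \<Longrightarrow> (AE x in lebesgue_on D. P x) \<longleftrightarrow> (AE x in lebesgue. x \<in> D \<longrightarrow> P x)"
  by (simp add: AE_restrict_space_iff)

context
  fixes D :: "(real^'n) set" and f :: "real^'n \<Rightarrow> real"
  assumes D: "open D" and f: "locally_integrable D f"
    and test: "\<And>\<phi>. \<phi> \<in> test_functions D \<Longrightarrow> (LINT x|lebesgue_on D. \<phi> x * f x) = 0"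
begin

lemma integrable_indicator_cbox:
  assumes "cbox a b \<subseteq> D"
  shows "integrable lebesgue (\<lambda>x. indicator (cbox a b) x * f x)"
  using f assms integral_lebesgue_on_indicator(2)[of "cbox a b" f]
  by (auto simp: locally_integrable_def)

lemma integrable_indicator_box:
  assumes "cbox a b \<subseteq> D"
  shows "integrable lebesgue (\<lambda>x. indicator (box a b) x * f x)"
proof -
  have "integrable lebesgue (\<lambda>x. indicator (box a b) x *\<^sub>R (indicator (cbox a b) x * f x))"
    by (intro integrable_mult_indicator integrable_indicator_cbox assms) simp
  also have "(\<lambda>x. indicator (box a b) x *\<^sub>R (indicator (cbox a b) x * f x)) = (\<lambda>x. indicator (box a b) x * f x)"
    using box_subset_cbox[of a b] by (auto simp: fun_eq_iff indicator_def)
  finally show ?thesis .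
qed

text \<open>Dominated convergence along the bump functions, with the integrable restriction of |f|
  to the closed box as majorant.\<close>

lemma integral_box_zero:
  assumes cb: "cbox a b \<subseteq> D"
  shows "(LINT x|lebesgue. indicator (box a b) x * f x) = 0"
proof -
  define F where "F = (\<lambda>x. indicator (cbox a b) x * f x)"
  have F: "integrable lebesgue F" using integrable_indicator_cbox[OF cb] by (simp add: F_def)
  have cont: "box_bump a b (real (Suc n)) \<in> borel_measurable lebesgue" for n
  proof -
    have "continuous_on UNIV (box_bump a b (real (Suc n)))"
      by (rule test_function_continuous[OF box_bump_test[OF _ cb]]) simp
    then have "box_bump a b (real (Suc n)) \<in> borel_measurable lborel"
      by (simp add: borel_measurable_continuous_onI)
    then show ?thesis by (rule measurable_completion)
  qed
  have zero: "(LINT x|lebesgue. box_bump a b (real (Suc n)) x * F x) = 0" for n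
  proof -
    have "(LINT x|lebesgue. box_bump a b (real (Suc n)) x * F x)
        = (LINT x|lebesgue. indicator D x *\<^sub>R (box_bump a b (real (Suc n)) x * f x))"
    proof (intro Bochner_Integration.integral_cong refl)
      fix x show "box_bump a b (real (Suc n)) x * F x = indicator D x *\<^sub>R (box_bump a b (real (Suc n)) x * f x)"
        using box_bump_outside[of "real (Suc n)" x a b] box_subset_cbox[of a b] cb
        by (cases "x \<in> box a b") (auto simp: F_def indicator_def)
    qed
    also have "\<dots> = (LINT x|lebesgue_on D. box_bump a b (real (Suc n)) x * f x)"
      using D by (simp add: integral_lebesgue_on_indicator)
    also have "\<dots> = 0" by (rule test[OF box_bump_test[OF _ cb]]) simp
    finally show ?thesis .
  qed
  have "(\<lambda>n. LINT x|lebesgue. box_bump a b (real (Suc n)) x * F x) \<longlonglongrightarrow> (LINT x|lebesgue. indicator (box a b) x * F x)"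
  proof (rule integral_dominated_convergence[where w = "\<lambda>x. norm (F x)"])
    show "AE x in lebesgue. (\<lambda>n. box_bump a b (real (Suc n)) x * F x) \<longlonglongrightarrow> indicator (box a b) x * F x"
      by (intro AE_I2 tendsto_mult_right box_bump_tendsto)
    show "AE x in lebesgue. norm (box_bump a b (real (Suc n)) x * F x) \<le> norm (F x)" for n
      using box_bump_range[of a b "real (Suc n)"] by (intro AE_I2) (simp add: abs_mult mult_left_le_one_le)
    show "(\<lambda>x. box_bump a b (real (Suc n)) x * F x) \<in> borel_measurable lebesgue" for n
      by (intro borel_measurable_times cont borel_measurable_integrable F)
    show "(\<lambda>x. indicator (box a b) x * F x) \<in> borel_measurable lebesgue"
      by (intro borel_measurable_times borel_measurable_indicator borel_measurable_integrable F) simp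
  qed (use F in auto)
  then have "(LINT x|lebesgue. indicator (box a b) x * F x) = 0" by (simp only: zero) (simp add: LIMSEQ_const_iff)
  moreover have "indicator (box a b) x * F x = indicator (box a b) x * f x" for x
    using box_subset_cbox[of a b] by (auto simp: F_def indicator_def)
  ultimately show ?thesis by simp
qed

text \<open>Dynkin argument: open boxes are stable under intersection and generate the Borel sets,
  and the sets with vanishing integral are closed under complements and countable disjoint
  unions.\<close>

lemma integral_Borel_subset_box_zero:
  assumes cb: "cbox a b \<subseteq> D" and S: "S \<in> sets borel"
  shows "(LINT x|lebesgue. indicator S x * (indicator (box a b) x * f x)) = 0"
proof -
  define F where "F = (\<lambda>x. indicator (box a b) x * f x)"
  have F: "integrable lebesgue F" using integrable_indicator_box[OF cb] by (simp add: F_def)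
  have IF: "integrable lebesgue (\<lambda>x. indicator A x * F x)" if "A \<in> sets borel" for A
    using integrable_mult_indicator[OF _ F, of A] that by simp
  let ?G = "range (\<lambda>(a, b). box a b :: (real^'n) set)"
  have G: "Int_stable ?G" by (auto simp: Int_stable_def box_Int_box)
  have borel: "sets borel = sigma_sets UNIV ?G" unfolding borel_eq_box by (simp add: image_def)
  have sub: "?G \<subseteq> Pow UNIV" by simp
  have "S \<in> sigma_sets UNIV ?G" using S borel by simp
  from G sub this have "(LINT x|lebesgue. indicator S x * F x) = 0"
  proof (induction rule: sigma_sets_induct_disjoint)
    case (basic A)
    then obtain c d where "A = box c d" by auto
    then obtain p q where pq: "A \<inter> box a b = box p q" by (auto simp: box_Int_box)
    have eq: "indicator A x * F x = indicator (box p q) x * f x" for x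
      unfolding pq[symmetric] by (simp add: F_def indicator_inter_arith)
    \<comment> \<open>If the intersection is empty, the closed box with the same corners may stick
      out of \<open>cbox a b\<close>; otherwise it is the closure of the intersection.\<close>
    show ?case
    proof (cases "box p q = {}")
      case True
      then show ?thesis by (simp add: eq)
    next
      case False
      then have "cbox p q = closure (box p q)" by simp
      also have "\<dots> \<subseteq> cbox a b"
        using pq box_subset_cbox[of a b] by (intro closure_minimal) auto
      finally show ?thesis using integral_box_zero[of p q] cb by (simp add: eq)
    qed
  next
    case empty
    then show ?case by simp
  next
    case (compl A)
    have "(LINT x|lebesgue. indicator (UNIV - A) x * F x) = (LINT x|lebesgue. F x - indicator A x * F x)"
      by (intro Bochner_Integration.integral_cong) (auto simp: indicator_def)
    also have "\<dots> = 0"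
      using compl IF[of A] F integral_box_zero[OF cb] borel by (simp add: F_def)
    finally show ?case .
  next
    case (union A)
    have AB: "A i \<in> sets borel" for i
      unfolding borel by (rule subsetD[OF union(2) rangeI])
    have A: "A i \<in> sets lebesgue" for i
      by (rule sets_completionI_sets) (simp add: AB)
    have "(\<Union>i. A i) \<in> sets borel" using AB by (rule sets.countable_UN[OF image_subsetI])
    then have "set_integrable lebesgue (\<Union>i. A i) F"
      using IF by (simp add: set_integrable_def)
    from lebesgue_integral_countable_add[OF A _ this] union(1,3)
    show ?case by (simp add: set_lebesgue_integral_def disjoint_family_on_def)
  qed
  then show ?thesis by (simp add: F_def)
qed

text \<open>A Lebesgue set differs from a Borel set by a null set, so all set integrals of
  \<open>f\<close> over the open box vanish and \<open>f\<close> is zero there almost everywhere.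
  The boundary of a box is negligible.\<close>

lemma AE_box_zero:
  assumes cb: "cbox a b \<subseteq> D"
  shows "AE x in lebesgue. x \<in> cbox a b \<longrightarrow> f x = 0"
proof -
  interpret finite_measure "lebesgue_on (box a b)"
    by (intro finite_measure_lebesgue_on) simp
  have "AE x in lebesgue_on (box a b). f x = 0"
  proof (rule density_zero)
    show "integrable (lebesgue_on (box a b)) f"
      using integrable_indicator_box[OF cb] by (simp add: integral_lebesgue_on_indicator)
    fix A assume "A \<in> sets (lebesgue_on (box a b))"
    then have A: "A \<in> sets lebesgue" by (auto simp: sets_restrict_space_iff)
    then obtain S N N' where S: "A = S \<union> N" "N \<subseteq> N'" "N' \<in> null_sets lborel" "S \<in> sets lborel"
      by (rule sets_completionE)
    have "set_lebesgue_integral (lebesgue_on (box a b)) A f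
        = (LINT x|lebesgue. indicator A x * (indicator (box a b) x * f x))"
      by (simp add: set_lebesgue_integral_def integral_lebesgue_on_indicator mult.left_commute)
    also have "\<dots> = (LINT x|lebesgue. indicator S x * (indicator (box a b) x * f x))"
    proof (rule integral_cong_AE)
      have F: "(\<lambda>x. indicator (box a b) x * f x) \<in> borel_measurable lebesgue"
        using integrable_indicator_box[OF cb] by simp
      show "(\<lambda>x. indicator A x * (indicator (box a b) x * f x)) \<in> borel_measurable lebesgue"
        "(\<lambda>x. indicator S x * (indicator (box a b) x * f x)) \<in> borel_measurable lebesgue"
        using A S(4) by (intro borel_measurable_times F borel_measurable_indicator; simp)+
      have "AE x in lebesgue. x \<notin> N'"
        using S(3) by (intro AE_not_in null_sets_completionI)
      then show "AE x in lebesgue. indicator A x * (indicator (box a b) x * f x) = indicator S x * (indicator (box a b) x * f x)"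
        by eventually_elim (use S(1,2) in \<open>auto simp: indicator_def\<close>)
    qed
    also have "\<dots> = 0" using S(4) by (intro integral_Borel_subset_box_zero cb) simp
    finally show "set_lebesgue_integral (lebesgue_on (box a b)) A f = 0" .
  qed
  then have "AE x in lebesgue. x \<in> box a b \<longrightarrow> f x = 0" by (simp add: AE_lebesgue_on_iff)
  moreover have "AE x in lebesgue. x \<notin> cbox a b - box a b"
    using negligible_frontier_interval[of a b] unfolding negligible_iff_null_sets by (rule AE_not_in)
  ultimately show ?thesis by eventually_elim auto
qed

text \<open>The fundamental lemma of the calculus of variations, assembled from countably many
  closed boxes that exhaust the open set.\<close>

lemma AE_zero_of_test_integrals: "AE x in lebesgue_on D. f x = 0"
proof -
  obtain \<D> where cD: "countable \<D>" and \<D>: "\<D> \<subseteq> Pow D" "\<And>X. X \<in> \<D> \<Longrightarrow> \<exists>a b. X = cbox a b" "\<Union>\<D> = D"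
    using open_countable_Union_open_cbox[OF D] by metis
  have "AE x in lebesgue. \<forall>X\<in>\<D>. x \<in> X \<longrightarrow> f x = 0"
    unfolding AE_ball_countable[OF cD]
  proof
    fix X assume X: "X \<in> \<D>"
    then obtain a b where "X = cbox a b" using \<D>(2) by blast
    then show "AE x in lebesgue. x \<in> X \<longrightarrow> f x = 0" using AE_box_zero[of a b] X \<D>(1) by auto
  qed
  then have "AE x in lebesgue. x \<in> D \<longrightarrow> f x = 0"
    by eventually_elim (use \<D>(3) in auto)
  then show ?thesis using D by (simp add: AE_lebesgue_on_iff)
qed

end

lemma locally_integrable_diff:
  "locally_integrable D f \<Longrightarrow> locally_integrable D g \<Longrightarrow> locally_integrable D (\<lambda>x. f x - g x)"
  by (auto simp: locally_integrable_def)

text \<open>Local integrability suffices, since the factor is bounded on the compact set and zero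
  outside.\<close>

lemma integrable_test_mult:
  fixes f :: "real^'n \<Rightarrow> 'b::euclidean_space"
  assumes D: "open D" and f: "locally_integrable D f" and K: "compact K" "K \<subseteq> D"
    and psi: "continuous_on UNIV \<psi>" "\<And>x. x \<notin> K \<Longrightarrow> \<psi> x = (0::real)"
  shows "integrable (lebesgue_on D) (\<lambda>x. \<psi> x *\<^sub>R f x)"
proof -
  have KS: "K \<in> sets lebesgue" using K(1) by (simp add: compact_imp_closed borel_closed)
  have F: "integrable lebesgue (\<lambda>x. indicator K x *\<^sub>R f x)"
    using f K KS by (auto simp: locally_integrable_def integral_lebesgue_on_indicator)
  obtain B where B: "\<And>x. x \<in> K \<Longrightarrow> \<bar>\<psi> x\<bar> \<le> B"
  proof -
    have "compact (\<psi> ` K)" using psi(1) K(1) by (intro compact_continuous_image) (auto intro: continuous_on_subset)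
    then show ?thesis using that by (force dest!: compact_imp_bounded simp: bounded_real)
  qed
  have m: "\<psi> \<in> borel_measurable lebesgue"
    using psi(1) by (intro measurable_completion) (simp add: borel_measurable_continuous_onI)
  have "integrable lebesgue (\<lambda>x. \<psi> x *\<^sub>R (indicator K x *\<^sub>R f x))"
  proof (rule Bochner_Integration.integrable_bound[of _ "\<lambda>x. B *\<^sub>R (indicator K x *\<^sub>R f x)"])
    show "AE x in lebesgue. norm (\<psi> x *\<^sub>R (indicator K x *\<^sub>R f x)) \<le> norm (B *\<^sub>R (indicator K x *\<^sub>R f x))"
      using B by (intro AE_I2) (force simp: indicator_def intro!: mult_right_mono)
    show "integrable lebesgue (\<lambda>x. B *\<^sub>R (indicator K x *\<^sub>R f x))" by (rule integrable_scaleR_right[OF F])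
    show "(\<lambda>x. \<psi> x *\<^sub>R (indicator K x *\<^sub>R f x)) \<in> borel_measurable lebesgue"
      by (rule borel_measurable_scaleR[OF m borel_measurable_integrable[OF F]])
  qed
  also have "(\<lambda>x. \<psi> x *\<^sub>R (indicator K x *\<^sub>R f x)) = (\<lambda>x. indicator D x *\<^sub>R (\<psi> x *\<^sub>R f x))"
    using psi(2) K(2) by (auto simp: fun_eq_iff indicator_def)
  finally show ?thesis using D by (simp add: integral_lebesgue_on_indicator)
qed

lemma integrable_test_function_mult:
  fixes f :: "real^'n \<Rightarrow> 'b::euclidean_space"
  assumes "open D" "locally_integrable D f" "\<phi> \<in> test_functions D"
  shows "integrable (lebesgue_on D) (\<lambda>x. \<phi> x *\<^sub>R f x)"
proof -
  obtain K where "compact K" "K \<subseteq> D" "\<And>x. x \<notin> K \<Longrightarrow> \<phi> x = 0"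
    by (rule test_function_support[OF assms(3)]) blast
  then show ?thesis using assms test_function_continuous by (intro integrable_test_mult)
qed

lemma integrable_test_grad_mult:
  assumes "open D" "locally_integrable D (u :: real^'n \<Rightarrow> real)" "\<phi> \<in> test_functions D"
  shows "integrable (lebesgue_on D) (\<lambda>x. u x *\<^sub>R classical_grad \<phi> x)"
proof -
  obtain K where K: "compact K" "K \<subseteq> D" "\<And>x. x \<notin> K \<Longrightarrow> classical_grad \<phi> x = 0"
    by (rule test_function_support[OF assms(3)]) blast
  have "integrable (lebesgue_on D) (\<lambda>x. \<Sum>i\<in>Basis. (classical_grad \<phi> x \<bullet> i) *\<^sub>R u x *\<^sub>R i)"
  proof (rule Bochner_Integration.integrable_sum)
    fix i :: "real^'n"
    have "integrable (lebesgue_on D) (\<lambda>x. (classical_grad \<phi> x \<bullet> i) *\<^sub>R u x)"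
      using K test_function_grad_continuous[OF assms(3)]
      by (intro integrable_test_mult assms) (auto intro!: continuous_intros)
    then have "integrable (lebesgue_on D) (\<lambda>x. ((classical_grad \<phi> x \<bullet> i) *\<^sub>R u x) *\<^sub>R i)"
      by (rule integrable_scaleR_left)
    then show "integrable (lebesgue_on D) (\<lambda>x. (classical_grad \<phi> x \<bullet> i) *\<^sub>R u x *\<^sub>R i)" by simp
  qed
  also have "(\<lambda>x. \<Sum>i\<in>Basis. (classical_grad \<phi> x \<bullet> i) *\<^sub>R u x *\<^sub>R i) = (\<lambda>x. u x *\<^sub>R classical_grad \<phi> x)"
  proof
    fix x
    have "(\<Sum>i\<in>Basis. (classical_grad \<phi> x \<bullet> i) *\<^sub>R u x *\<^sub>R i) = u x *\<^sub>R (\<Sum>i\<in>Basis. (classical_grad \<phi> x \<bullet> i) *\<^sub>R i)"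
      by (simp add: scaleR_sum_right mult.commute)
    then show "(\<Sum>i\<in>Basis. (classical_grad \<phi> x \<bullet> i) *\<^sub>R u x *\<^sub>R i) = u x *\<^sub>R classical_grad \<phi> x"
      by (simp only: euclidean_representation)
  qed
  finally show ?thesis .
qed

text \<open>The fundamental lemma applied to each component of the difference. It is the reason why
  \<open>weak_grad\<close>, a mere choice, respects sums and multiples almost everywhere.\<close>

lemma weak_grad_unique:
  assumes D: "open D" and g: "is_weak_grad D u g" and h: "is_weak_grad D u h"
  shows "AE x in lebesgue_on D. g x = h x"
proof -
  have li: "locally_integrable D (\<lambda>x. g x - h x)"
    using g h by (auto simp: is_weak_grad_def intro: locally_integrable_diff)
  have "AE x in lebesgue_on D. (g x - h x) \<bullet> i = 0" for i
  proof (rule AE_zero_of_test_integrals[OF D])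
    show "locally_integrable D (\<lambda>x. (g x - h x) \<bullet> i)"
      using li by (auto simp: locally_integrable_def)
    fix \<phi> assume phi: "\<phi> \<in> test_functions D"
    have ig: "integrable (lebesgue_on D) (\<lambda>x. \<phi> x *\<^sub>R g x)" "integrable (lebesgue_on D) (\<lambda>x. \<phi> x *\<^sub>R h x)"
      using g h phi D by (auto simp: is_weak_grad_def intro: integrable_test_function_mult)
    have "(LINT x|lebesgue_on D. \<phi> x * ((g x - h x) \<bullet> i)) = (LINT x|lebesgue_on D. (\<phi> x *\<^sub>R g x - \<phi> x *\<^sub>R h x) \<bullet> i)"
      by (intro Bochner_Integration.integral_cong) (auto simp: inner_diff_left algebra_simps)
    also have "\<dots> = ((LINT x|lebesgue_on D. \<phi> x *\<^sub>R g x) - (LINT x|lebesgue_on D. \<phi> x *\<^sub>R h x)) \<bullet> i"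
      using ig by (simp add: integral_inner_left)
    also have "\<dots> = 0"
    proof -
      have eq_g: "(LINT x|lebesgue_on D. u x *\<^sub>R classical_grad \<phi> x) = - (LINT x|lebesgue_on D. \<phi> x *\<^sub>R g x)"
        using g phi by (simp only: is_weak_grad_def)
      have eq_h: "(LINT x|lebesgue_on D. u x *\<^sub>R classical_grad \<phi> x) = - (LINT x|lebesgue_on D. \<phi> x *\<^sub>R h x)"
        using h phi by (simp only: is_weak_grad_def)
      from trans[OF sym[OF eq_g] eq_h]
      have "(LINT x|lebesgue_on D. \<phi> x *\<^sub>R g x) = (LINT x|lebesgue_on D. \<phi> x *\<^sub>R h x)"
        by (simp only: neg_equal_iff_equal)
      then show ?thesis by (simp only: diff_self inner_zero_left)
    qed
    finally show "(LINT x|lebesgue_on D. \<phi> x * ((g x - h x) \<bullet> i)) = 0" .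
  qed
  then have "\<forall>i\<in>Basis. AE x in lebesgue_on D. (g x - h x) \<bullet> i = 0" by blast
  then have "AE x in lebesgue_on D. \<forall>i\<in>Basis. (g x - h x) \<bullet> i = 0"
    by (simp only: AE_ball_countable[OF countable_finite[OF finite_Basis]])
  then show ?thesis
  proof (eventually_elim)
    case (elim x)
    then have "g x - h x = 0" by (simp only: euclidean_eq_iff[of "g x - h x" 0] inner_zero_left)
    then show "g x = h x" by simp
  qed
qed

section \<open>Square-integrable functions\<close>

definition L2_inner :: "(real^'n) set \<Rightarrow> (real^'n \<Rightarrow> 'b::euclidean_space) \<Rightarrow> (real^'n \<Rightarrow> 'b) \<Rightarrow> real" where
  "L2_inner D f g = (LINT x|lebesgue_on D. f x \<bullet> g x)"

lemma L2_norm_eq: "L2_norm D f = sqrt (L2_inner D f f)"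
  by (simp add: L2_norm_def L2_inner_def dot_square_norm)

lemma L2_inner_nonneg: "L2_inner D f f \<ge> 0"
  by (simp add: L2_inner_def integral_nonneg_AE)

lemma L2I: "f \<in> borel_measurable (lebesgue_on D) \<Longrightarrow> integrable (lebesgue_on D) (\<lambda>x. f x \<bullet> f x) \<Longrightarrow> f \<in> L2 D"
  by (simp add: L2_def dot_square_norm)

lemma L2D:
  assumes "f \<in> L2 D"
  shows "f \<in> borel_measurable (lebesgue_on D)" "integrable (lebesgue_on D) (\<lambda>x. (norm (f x))\<^sup>2)"
  using assms by (auto simp: L2_def)

lemma L2_inner_integrable:
  assumes "f \<in> L2 D" "g \<in> L2 D"
  shows "integrable (lebesgue_on D) (\<lambda>x. f x \<bullet> g x)"
proof (rule Bochner_Integration.integrable_bound)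
  show "integrable (lebesgue_on D) (\<lambda>x. (norm (f x))\<^sup>2 + (norm (g x))\<^sup>2)"
    using assms by (auto simp: L2_def)
  show "AE x in lebesgue_on D. norm (f x \<bullet> g x) \<le> norm ((norm (f x))\<^sup>2 + (norm (g x))\<^sup>2)"
  proof (rule AE_I2)
    fix x
    have "\<bar>f x \<bullet> g x\<bar> \<le> norm (f x) * norm (g x)" by (rule Cauchy_Schwarz_ineq2)
    also have "\<dots> \<le> (norm (f x))\<^sup>2 + (norm (g x))\<^sup>2"
      using sum_squares_bound[of "norm (f x)" "norm (g x)"] mult_nonneg_nonneg[OF norm_ge_zero norm_ge_zero, of "f x" "g x"]
      by linarith
    finally show "norm (f x \<bullet> g x) \<le> norm ((norm (f x))\<^sup>2 + (norm (g x))\<^sup>2)" by simp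
  qed
  show "(\<lambda>x. f x \<bullet> g x) \<in> borel_measurable (lebesgue_on D)"
    using assms by (auto simp: L2_def)
qed

lemma L2_bounded_mult:
  assumes f: "f \<in> L2 D" and a: "a \<in> borel_measurable (lebesgue_on D)" "AE x in lebesgue_on D. \<bar>a x\<bar> \<le> K"
  shows "(\<lambda>x. a x *\<^sub>R f x) \<in> L2 D"
proof -
  have m: "(\<lambda>x. a x *\<^sub>R f x) \<in> borel_measurable (lebesgue_on D)"
    using f a by (auto simp: L2_def)
  have "integrable (lebesgue_on D) (\<lambda>x. (norm (a x *\<^sub>R f x))\<^sup>2)"
  proof (rule Bochner_Integration.integrable_bound)
    show "integrable (lebesgue_on D) (\<lambda>x. K\<^sup>2 * (norm (f x))\<^sup>2)"
      using f by (auto simp: L2_def)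
    show "AE x in lebesgue_on D. norm ((norm (a x *\<^sub>R f x))\<^sup>2) \<le> norm (K\<^sup>2 * (norm (f x))\<^sup>2)"
      using a(2) by eventually_elim (auto simp: power_mult_distrib abs_le_square_iff[symmetric] intro!: mult_right_mono)
  qed (use m in measurable)
  then show ?thesis using m by (simp add: L2_def)
qed

lemma L2_scale: "f \<in> L2 D \<Longrightarrow> (\<lambda>x. c *\<^sub>R f x) \<in> L2 D"
  by (rule L2_bounded_mult[of _ _ _ "\<bar>c\<bar>"]) auto

lemma L2_add:
  assumes "f \<in> L2 D" "g \<in> L2 D"
  shows "(\<lambda>x. f x + g x) \<in> L2 D"
proof (rule L2I)
  show "integrable (lebesgue_on D) (\<lambda>x. (f x + g x) \<bullet> (f x + g x))"
    unfolding inner_add using assms by (intro Bochner_Integration.integrable_add L2_inner_integrable)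
qed (use assms in \<open>auto simp: L2_def\<close>)

lemma subspace_L2: "subspace (L2 D :: (real^'n \<Rightarrow> 'b::euclidean_space) set)"
proof (rule subspaceI)
  show "(0 :: real^'n \<Rightarrow> 'b) \<in> L2 D" by (simp add: L2_def zero_fun_def)
next
  fix f g :: "real^'n \<Rightarrow> 'b" and c assume "f \<in> L2 D"
  then show "c *\<^sub>R f \<in> L2 D" using L2_scale[of f D c] by (simp add: scaleR_fun_def)
  assume "g \<in> L2 D"
  then show "f + g \<in> L2 D" using L2_add[of f D g] \<open>f \<in> L2 D\<close> by (simp add: plus_fun_def)
qed

lemma symbil_L2_inner: "symbil (L2 D :: (real^'n \<Rightarrow> 'b::euclidean_space) set) (L2_inner D)"
  unfolding symbil_def
proof (intro conjI ballI allI subspace_L2)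
  fix f g h :: "real^'n \<Rightarrow> 'b" and c
  assume "f \<in> L2 D"
  show "L2_inner D (c *\<^sub>R f) h = c * L2_inner D f h" by (simp add: L2_inner_def)
  assume "g \<in> L2 D"
  show "L2_inner D f g = L2_inner D g f" by (simp add: L2_inner_def inner_commute)
  assume "h \<in> L2 D"
  show "L2_inner D (f + g) h = L2_inner D f h + L2_inner D g h"
    using L2_inner_integrable[OF \<open>f \<in> L2 D\<close> \<open>h \<in> L2 D\<close>] L2_inner_integrable[OF \<open>g \<in> L2 D\<close> \<open>h \<in> L2 D\<close>]
    by (simp add: L2_inner_def inner_add_left)
qed

lemma L2_inner_cong_AE:
  assumes "AE x in lebesgue_on D. f x = f' x" "AE x in lebesgue_on D. g x = g' x"
    and "f \<in> borel_measurable (lebesgue_on D)" "f' \<in> borel_measurable (lebesgue_on D)"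
    and "g \<in> borel_measurable (lebesgue_on D)" "g' \<in> borel_measurable (lebesgue_on D)"
  shows "L2_inner D f g = L2_inner D f' g'"
  unfolding L2_inner_def
proof (rule integral_cong_AE)
  show "AE x in lebesgue_on D. f x \<bullet> g x = f' x \<bullet> g' x"
    using assms(1,2) by eventually_elim simp
qed (use assms in measurable)

text \<open>Completeness of Lebesgue measure: a change on a null set preserves
  measurability.\<close>

lemma borel_measurable_lebesgue_on_AE:
  fixes f g :: "real^'n \<Rightarrow> 'b::euclidean_space"
  assumes D: "D \<in> sets lebesgue" and f: "f \<in> borel_measurable (lebesgue_on D)"
    and eq: "AE x in lebesgue_on D. f x = g x"
  shows "g \<in> borel_measurable (lebesgue_on D)"
proof -
  have "(\<lambda>x. indicator D x *\<^sub>R f x) \<in> borel_measurable lebesgue"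
    using f D by (simp add: borel_measurable_restrict_space_iff)
  moreover have "AE x in lebesgue. indicator D x *\<^sub>R f x = indicator D x *\<^sub>R g x"
    using eq D by (auto simp: AE_lebesgue_on_iff indicator_def elim: eventually_mono)
  ultimately have "(\<lambda>x. indicator D x *\<^sub>R g x) \<in> borel_measurable lebesgue"
    by (rule borel_measurable_AE)
  then show ?thesis using D by (simp add: borel_measurable_restrict_space_iff)
qed

lemma L2_cong_AE:
  fixes f g :: "real^'n \<Rightarrow> 'b::euclidean_space"
  assumes D: "D \<in> sets lebesgue" and f: "f \<in> L2 D" and eq: "AE x in lebesgue_on D. f x = g x"
  shows "g \<in> L2 D"
proof -
  have g: "g \<in> borel_measurable (lebesgue_on D)"
    using borel_measurable_lebesgue_on_AE[OF D L2D(1)[OF f] eq] .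
  moreover have "integrable (lebesgue_on D) (\<lambda>x. (norm (g x))\<^sup>2)"
  proof (rule integrable_cong_AE_imp[OF L2D(2)[OF f]])
    show "AE x in lebesgue_on D. (norm (f x))\<^sup>2 = (norm (g x))\<^sup>2"
      using eq by eventually_elim simp
  qed (use g in measurable)
  ultimately show ?thesis by (simp add: L2_def)
qed

context
  fixes D :: "(real^'n) set"
  assumes open_D: "open D" and bounded_D: "bounded D"
begin

lemma D_lmeasurable: "D \<in> lmeasurable"
  using open_D bounded_D by (simp add: lmeasurable_open)

lemma D_finite: "finite_measure (lebesgue_on D)"
  by (rule finite_measure_lebesgue_on[OF D_lmeasurable])

lemma L2_const: "(\<lambda>x. c) \<in> L2 D"
  using finite_measure.integrable_const[OF D_finite] by (simp add: L2_def)

lemma L2_imp_integrable: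
  fixes f :: "real^'n \<Rightarrow> 'b::euclidean_space"
  assumes "f \<in> L2 D"
  shows "integrable (lebesgue_on D) f"
proof (rule Bochner_Integration.integrable_bound)
  show "integrable (lebesgue_on D) (\<lambda>x. 1 + (norm (f x))\<^sup>2)"
    using assms finite_measure.integrable_const[OF D_finite] by (intro Bochner_Integration.integrable_add) (auto simp: L2_def)
  show "AE x in lebesgue_on D. norm (f x) \<le> norm (1 + (norm (f x))\<^sup>2)"
  proof (rule AE_I2)
    fix x
    have "2 * norm (f x) \<le> 1 + (norm (f x))\<^sup>2"
      using sum_squares_bound[of 1 "norm (f x)"] by simp
    then show "norm (f x) \<le> norm (1 + (norm (f x))\<^sup>2)"
      using norm_ge_zero[of "f x"] by (smt (verit) real_norm_def)
  qed
qed (use assms in \<open>auto simp: L2_def\<close>)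

lemma L2_imp_locally_integrable:
  fixes f :: "real^'n \<Rightarrow> 'b::euclidean_space"
  assumes "f \<in> L2 D"
  shows "locally_integrable D f"
  unfolding locally_integrable_def
proof (intro allI impI)
  fix K assume K: "compact K \<and> K \<subseteq> D"
  then have KS: "K \<in> sets lebesgue" by (simp add: compact_imp_closed borel_closed)
  have "integrable lebesgue (\<lambda>x. indicator K x *\<^sub>R (indicator D x *\<^sub>R f x))"
  proof (rule integrable_mult_indicator[OF KS])
    show "integrable lebesgue (\<lambda>x. indicator D x *\<^sub>R f x)"
      using L2_imp_integrable[OF assms] open_D by (simp add: integral_lebesgue_on_indicator)
  qed
  also have "(\<lambda>x. indicator K x *\<^sub>R (indicator D x *\<^sub>R f x)) = (\<lambda>x. indicator K x *\<^sub>R f x)"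
    using K by (auto simp: fun_eq_iff indicator_def)
  finally show "integrable (lebesgue_on K) f" using KS by (simp add: integral_lebesgue_on_indicator)
qed

lemma nn_integral_L2:
  "f \<in> L2 D \<Longrightarrow> (\<integral>\<^sup>+x. ennreal ((norm (f x))\<^sup>2) \<partial>lebesgue_on D) = ennreal (L2_inner D f f)"
  unfolding L2_inner_def dot_square_norm using L2D(2)[of f D] by (intro nn_integral_eq_integral) auto

text \<open>The Riesz-Fischer argument: a subsequence with geometrically small increments converges
  almost everywhere, and Fatou's lemma turns the Cauchy property into convergence of the whole
  sequence to that limit.\<close>

lemma L2_complete:
  fixes X :: "nat \<Rightarrow> real^'n \<Rightarrow> 'b::euclidean_space"
  assumes X: "\<And>n. X n \<in> L2 D"
    and cauchy: "\<And>e. e > 0 \<Longrightarrow> \<exists>N. \<forall>m\<ge>N. \<forall>n\<ge>N. L2_inner D (X m - X n) (X m - X n) < e"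
  obtains f where "f \<in> L2 D" "(\<lambda>n. L2_inner D (X n - f) (X n - f)) \<longlonglongrightarrow> 0"
proof -
  interpret finite_measure "lebesgue_on D" by (rule D_finite)
  note mem = symbil_mem[OF symbil_L2_inner[of D]]
  have "\<forall>k. \<exists>N. \<forall>m\<ge>N. \<forall>n\<ge>N. L2_inner D (X m - X n) (X m - X n) < (1/4)^k"
    using cauchy by simp
  then obtain N where N: "\<And>k m n. m \<ge> N k \<Longrightarrow> n \<ge> N k \<Longrightarrow> L2_inner D (X m - X n) (X m - X n) < (1/4)^k"
    by metis
  define r where "r k = (\<Sum>i\<le>k. N i)" for k
  have rN: "r k \<ge> N i" if "i \<le> k" for i k
    unfolding r_def using that by (intro member_le_sum) auto
  define d where "d k x = X (r (Suc k)) x - X (r k) x" for k x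
  have dL2: "d k \<in> L2 D" for k
    using mem(2)[OF X X, of "r (Suc k)" "r k"] by (simp add: d_def[abs_def] fun_diff_def)
  have d_small: "L2_inner D (d k) (d k) \<le> (1/4)^k" for k
    using N[of k "r (Suc k)" "r k"] rN[of k k] rN[of k "Suc k"]
    by (simp add: d_def[abs_def] fun_diff_def)
  define c where "c = measure (lebesgue_on D) (space (lebesgue_on D))"
  \<comment> \<open>The inequality |d| \<le> 2^k |d|^2 + 2^(-k), a consequence of (2^k |d| - 1)^2
    \<ge> 0, converts the bound 4^(-k) on the squared norms into a summable bound on the integrals
    of |d|. Finite measure of \<open>D\<close> enters through \<open>c\<close>.\<close>
  have norm_d: "(\<integral>\<^sup>+x. ennreal (norm (d k x)) \<partial>lebesgue_on D) \<le> ennreal ((1 + c) * (1/2)^k)" for k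
  proof -
    have int: "integrable (lebesgue_on D) (\<lambda>x. norm (d k x))"
      using L2_imp_integrable[OF dL2] by simp
    have int2: "integrable (lebesgue_on D) (\<lambda>x. 2^k * (norm (d k x))\<^sup>2 + (1/2)^k)"
      using L2D(2)[OF dL2[of k]] by simp
    have "(LINT x|lebesgue_on D. norm (d k x)) \<le> (LINT x|lebesgue_on D. 2^k * (norm (d k x))\<^sup>2 + (1/2)^k)"
    proof (rule integral_mono[OF int int2])
      fix x
      have "0 \<le> (2^k * norm (d k x) - 1)\<^sup>2" by simp
      then have "2^k * norm (d k x) \<le> (2^k * norm (d k x))\<^sup>2 + 1"
        by (simp add: power2_diff) (smt (verit) norm_ge_zero zero_le_mult_iff zero_le_power)
      then have "2^k * norm (d k x) \<le> 2^k * (2^k * (norm (d k x))\<^sup>2 + (1/2)^k)"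
        by (simp add: power_mult_distrib power2_eq_square algebra_simps power_divide)
      then show "norm (d k x) \<le> 2^k * (norm (d k x))\<^sup>2 + (1/2)^k" by simp
    qed
    also have "\<dots> = 2^k * L2_inner D (d k) (d k) + c * (1/2)^k"
      using L2D(2)[OF dL2[of k]] by (simp add: L2_inner_def dot_square_norm c_def)
    also have "\<dots> \<le> 2^k * (1/4)^k + c * (1/2)^k"
      using d_small by (intro add_right_mono mult_left_mono) auto
    also have "\<dots> = (1 + c) * (1/2)^k"
      by (simp add: algebra_simps flip: power_mult_distrib)
    finally show ?thesis using int by (simp add: nn_integral_eq_integral ennreal_leI)
  qed
  have c0: "c \<ge> 0" by (simp add: c_def)
  have "(\<integral>\<^sup>+x. (\<Sum>k. ennreal (norm (d k x))) \<partial>lebesgue_on D) = (\<Sum>k. \<integral>\<^sup>+x. ennreal (norm (d k x)) \<partial>lebesgue_on D)"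
    using L2D(1)[OF dL2] by (intro nn_integral_suminf) measurable
  also have "\<dots> \<le> (\<Sum>k. ennreal ((1 + c) * (1/2)^k))"
    by (intro suminf_le norm_d) auto
  also have "\<dots> = ennreal (\<Sum>k. (1 + c) * (1/2)^k)"
    using c0 by (intro suminf_ennreal2) (auto intro!: summable_mult)
  also have "\<dots> < \<infinity>" by simp
  finally have "AE x in lebesgue_on D. (\<Sum>k. ennreal (norm (d k x))) \<noteq> \<infinity>"
    using L2D(1)[OF dL2] by (intro nn_integral_PInf_AE) auto
  then have conv: "AE x in lebesgue_on D. (\<lambda>k. X (r k) x) \<longlonglongrightarrow> lim (\<lambda>k. X (r k) x)"
  proof eventually_elim
    case (elim x)
    then have "summable (\<lambda>k. norm (d k x))"
      by (intro summable_suminf_not_top) (auto simp: top_ennreal_def)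
    then have "summable (\<lambda>k. d k x)" by (rule summable_norm_cancel)
    then have "convergent (\<lambda>n. \<Sum>k<n. d k x)" by (simp add: summable_iff_convergent)
    then have "convergent (\<lambda>n. (\<Sum>k<n. d k x) + X (r 0) x)"
      by (intro convergent_add convergent_const)
    moreover have "(\<Sum>k<n. d k x) + X (r 0) x = X (r n) x" for n
      using sum_lessThan_telescope[of "\<lambda>k. X (r k) x" n] by (simp add: d_def)
    ultimately show ?case by (simp add: convergent_LIMSEQ_iff)
  qed
  define f where "f x = lim (\<lambda>k. X (r k) x)" for x
  have fm: "f \<in> borel_measurable (lebesgue_on D)"
    unfolding f_def using L2D(1)[OF X] by (intro borel_measurable_lim_metric)
  \<comment> \<open>For fixed n the integrand is the lower limit of squared distances to the
    subsequence, whose integrals are at most (1/4)^k once both indices exceed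
    \<open>N k\<close>.\<close>
  have est: "(\<integral>\<^sup>+x. ennreal ((norm (X n x - f x))\<^sup>2) \<partial>lebesgue_on D) \<le> ennreal ((1/4)^k)" if n: "n \<ge> N k" for n k
  proof -
    have "(\<integral>\<^sup>+x. ennreal ((norm (X n x - f x))\<^sup>2) \<partial>lebesgue_on D)
        = (\<integral>\<^sup>+x. liminf (\<lambda>j. ennreal ((norm (X n x - X (r j) x))\<^sup>2)) \<partial>lebesgue_on D)"
    proof (rule nn_integral_cong_AE)
      show "AE x in lebesgue_on D. ennreal ((norm (X n x - f x))\<^sup>2) = liminf (\<lambda>j. ennreal ((norm (X n x - X (r j) x))\<^sup>2))"
        using conv
      proof eventually_elim
        case (elim x)
        then have "(\<lambda>j. ennreal ((norm (X n x - X (r j) x))\<^sup>2)) \<longlonglongrightarrow> ennreal ((norm (X n x - f x))\<^sup>2)"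
          unfolding f_def by (intro tendsto_ennrealI tendsto_intros)
        then show ?case by (rule lim_imp_Liminf[OF trivial_limit_sequentially, symmetric])
      qed
    qed
    also have "\<dots> \<le> liminf (\<lambda>j. \<integral>\<^sup>+x. ennreal ((norm (X n x - X (r j) x))\<^sup>2) \<partial>lebesgue_on D)"
      using L2D(1)[OF X] by (intro nn_integral_liminf) measurable
    also have "\<dots> \<le> ennreal ((1/4)^k)"
    proof (rule Liminf_le)
      show "\<forall>\<^sub>F j in sequentially. (\<integral>\<^sup>+x. ennreal ((norm (X n x - X (r j) x))\<^sup>2) \<partial>lebesgue_on D) \<le> ennreal ((1/4)^k)"
      proof (rule eventually_sequentiallyI[of k])
        fix j assume "j \<ge> k"
        then have "L2_inner D (X n - X (r j)) (X n - X (r j)) \<le> (1/4)^k"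
          using N[of k n "r j"] n rN[of k j] by simp
        then show "(\<integral>\<^sup>+x. ennreal ((norm (X n x - X (r j) x))\<^sup>2) \<partial>lebesgue_on D) \<le> ennreal ((1/4)^k)"
          using nn_integral_L2[OF mem(2)[OF X X], of n "r j"] by (simp add: ennreal_leI)
      qed
    qed simp
    finally show ?thesis .
  qed
  have diff: "X n - f \<in> L2 D" if "n \<ge> N k" for n k
  proof -
    have "integrable (lebesgue_on D) (\<lambda>x. (norm (X n x - f x))\<^sup>2)"
      using est[OF that] L2D(1)[OF X] fm
      by (intro integrableI_nonneg) (auto simp: top_unique less_top[symmetric])
    then show ?thesis using L2D(1)[OF X] fm by (simp add: L2_def fun_diff_def)
  qed
  have f: "f \<in> L2 D"
    using mem(2)[OF X[of "N 0"] diff[of 0 "N 0"]] by simp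
  have "(\<lambda>n. L2_inner D (X n - f) (X n - f)) \<longlonglongrightarrow> 0"
  proof (rule LIMSEQ_I)
    fix e :: real assume "e > 0"
    then obtain k where k: "(1/4)^k < e" using real_arch_pow_inv[of e "1/4"] by auto
    show "\<exists>no. \<forall>n\<ge>no. norm (L2_inner D (X n - f) (X n - f) - 0) < e"
    proof (intro exI[of _ "N k"] allI impI)
      fix n assume n: "n \<ge> N k"
      have "ennreal (L2_inner D (X n - f) (X n - f)) \<le> ennreal ((1/4)^k)"
        using est[OF n] nn_integral_L2[OF diff[OF n]] by simp
      then have "L2_inner D (X n - f) (X n - f) \<le> (1/4)^k" by (simp add: ennreal_le_iff)
      then show "norm (L2_inner D (X n - f) (X n - f) - 0) < e"
        using k L2_inner_nonneg[of D "X n - f"] by simp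
    qed
  qed
  then show thesis using f that by blast
qed

end

section \<open>Translations of continuously differentiable functions of compact support\<close>

lemma lborel_integral_translate:
  fixes f :: "'a::euclidean_space \<Rightarrow> 'b::{banach, second_countable_topology}"
  assumes "f \<in> borel_measurable borel"
  shows "(LINT x|lborel. f (x + c)) = (LINT x|lborel. f x)"
proof -
  have "(LINT x|lborel. f x) = (LINT x|distr lborel borel ((+) c). f x)"
    by (simp only: lborel_distr_plus)
  also have "\<dots> = (LINT x|lborel. f (c + x))"
    using assms by (intro integral_distr) measurable
  finally show ?thesis by (simp add: add.commute)
qed

lemma integrable_lborel_compact_support:
  fixes f :: "'a::euclidean_space \<Rightarrow> 'b::{banach, second_countable_topology}"
  assumes "continuous_on UNIV f" "bounded K" "\<And>x. x \<notin> K \<Longrightarrow> f x = 0"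
  shows "integrable lborel f"
proof -
  obtain R where "\<forall>x\<in>K. norm x \<le> R" using assms(2) unfolding bounded_iff by blast
  then have R: "K \<subseteq> cball 0 R" by auto
  have "integrable lborel (\<lambda>x. indicator (cball 0 R) x *\<^sub>R f x)"
    using borel_integrable_compact[of "cball 0 R" f] assms(1) by (auto simp: set_integrable_def intro: continuous_on_subset)
  also have "(\<lambda>x. indicator (cball 0 R) x *\<^sub>R f x) = f"
  proof
    fix x
    show "indicator (cball 0 R) x *\<^sub>R f x = f x"
    proof (cases "x \<in> cball 0 R")
      case False
      then have "x \<notin> K" using R by blast
      then show ?thesis using assms(3) by simp
    qed simp
  qed
  finally show ?thesis .
qed

text \<open>A function on the whole space with its gradient, both zero off a compact set. The
  setting covers test functions and also the product of two test functions, which is what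
  integration by parts needs.\<close>

locale smooth_compact =
  fixes F :: "'a::euclidean_space \<Rightarrow> real" and g :: "'a \<Rightarrow> 'a" and K :: "'a set"
  assumes F: "(F has_derivative (\<lambda>h. h \<bullet> g x)) (at x)"
    and g: "continuous_on UNIV g"
    and K: "compact K" and F0: "x \<notin> K \<Longrightarrow> F x = 0" and g0: "x \<notin> K \<Longrightarrow> g x = 0"
begin

lemma F_cont: "continuous_on UNIV F"
  using F by (intro continuous_at_imp_continuous_on) (auto intro: has_derivative_continuous)

lemma F_borel [measurable]: "F \<in> borel_measurable borel"
  using F_cont by (rule borel_measurable_continuous_onI)

lemma g_borel [measurable]: "g \<in> borel_measurable borel"
  using g by (rule borel_measurable_continuous_onI)

lemma quotient_tendsto: "(\<lambda>n. real (Suc n) * (F (x + h /\<^sub>R real (Suc n)) - F x)) \<longlonglongrightarrow> h \<bullet> g x"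
proof -
  have line: "((\<lambda>t. x + t *\<^sub>R h) has_derivative (\<lambda>t. t *\<^sub>R h)) (at 0)"
    by (auto intro!: derivative_eq_intros)
  have "(F has_derivative (\<lambda>h. h \<bullet> g x)) (at (x + 0 *\<^sub>R h))" using F by simp
  from has_derivative_compose[OF line this]
  have "((\<lambda>t. F (x + t *\<^sub>R h)) has_real_derivative h \<bullet> g x) (at 0)"
    by (simp add: has_field_derivative_def mult_commute_abs)
  then have lim: "((\<lambda>t. (F (x + t *\<^sub>R h) - F x) / t) \<longlongrightarrow> h \<bullet> g x) (at 0)"
    by (simp add: DERIV_def)
  have "filterlim (\<lambda>n. inverse (real (Suc n))) (at 0) sequentially"
    using LIMSEQ_inverse_real_of_nat by (simp add: filterlim_at)
  from filterlim_compose[OF lim this] show ?thesis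
    by (simp add: divide_inverse mult.commute)
qed

lemma Lipschitz:
  obtains B where "B \<ge> 0" "\<And>x y. \<bar>F y - F x\<bar> \<le> B * norm (y - x)"
proof -
  have "compact (g ` K)" using g K by (intro compact_continuous_image) (auto intro: continuous_on_subset)
  then obtain B where B: "B > 0" "\<And>x. x \<in> K \<Longrightarrow> norm (g x) \<le> B"
    by (auto dest!: compact_imp_bounded simp: bounded_pos)
  have gB: "norm (g x) \<le> B" for x using B g0[of x] by (cases "x \<in> K") auto
  have "norm (F y - F x) \<le> B * norm (y - x)" for x y
  proof (rule differentiable_bound[of UNIV F "\<lambda>x h. h \<bullet> g x"])
    fix z
    show "onorm (\<lambda>h. h \<bullet> g z) \<le> B"
    proof (rule onorm_bound)
      show "norm (h \<bullet> g z) \<le> B * norm h" for h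
        using Cauchy_Schwarz_ineq2[of h "g z"] mult_left_mono[OF gB[of z] norm_ge_zero[of h]]
        by (simp add: mult.commute)
    qed (use B in simp)
  qed (use F in auto)
  then show thesis using that[of B] B by (simp add: less_imp_le)
qed

text \<open>By the Lipschitz bound the quotients are at most B |h|. They vanish outside a ball
  enlarged by |h|, where the point and its translate both miss the support.\<close>

lemma quotient_dominated:
  obtains w where "integrable lborel w" "\<And>x. w x \<ge> 0"
    "\<And>n x. \<bar>real (Suc n) * (F (x + h /\<^sub>R real (Suc n)) - F x)\<bar> \<le> w x"
    "integrable lborel (\<lambda>x. (w x)\<^sup>2)"
proof -
  obtain B where B: "B \<ge> 0" "\<And>x y. \<bar>F y - F x\<bar> \<le> B * norm (y - x)" using Lipschitz by blast
  obtain R where "\<forall>x\<in>K. norm x \<le> R" using compact_imp_bounded[OF K] unfolding bounded_iff by blast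
  then have R: "K \<subseteq> cball 0 R" by auto
  define S where "S = cball (0::'a) (R + norm h)"
  define w where "w x = B * norm h * indicator S x" for x
  have bound: "\<bar>real (Suc n) * (F (x + h /\<^sub>R real (Suc n)) - F x)\<bar> \<le> w x" for n x
  proof (cases "x \<in> S")
    case True
    have "\<bar>real (Suc n) * (F (x + h /\<^sub>R real (Suc n)) - F x)\<bar> \<le> real (Suc n) * (B * norm (h /\<^sub>R real (Suc n)))"
      using B(2)[of "x + h /\<^sub>R real (Suc n)" x] by (simp add: abs_mult)
    also have "\<dots> = B * norm h" by (simp add: divide_inverse)
    finally show ?thesis using True by (simp add: w_def)
  next
    case False
    have n: "norm (h /\<^sub>R real (Suc n)) \<le> norm h"
      by (simp add: divide_inverse mult_left_le_one_le inverse_le_1_iff)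
    have "norm x \<le> norm (x + h /\<^sub>R real (Suc n)) + norm (h /\<^sub>R real (Suc n))"
      using norm_triangle_ineq4[of "x + h /\<^sub>R real (Suc n)" "h /\<^sub>R real (Suc n)"] by simp
    moreover have "norm x > R + norm h" using False by (simp add: S_def)
    ultimately have "norm (x + h /\<^sub>R real (Suc n)) > R" "norm x > R"
      using n norm_ge_zero[of h] by linarith+
    then have "x + h /\<^sub>R real (Suc n) \<notin> K" "x \<notin> K" using R by (auto simp: subset_iff)
    then show ?thesis using False by (simp add: F0 w_def)
  qed
  have S: "integrable lborel (\<lambda>x. c * indicator S x)" for c :: real
    unfolding S_def by (intro integrable_mult_right integrable_real_indicator emeasure_bounded_finite bounded_cball) simp
  have "(w x)\<^sup>2 = (B * norm h)\<^sup>2 * indicator S x" for x by (simp add: w_def power_mult_distrib indicator_def)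
  then have "integrable lborel (\<lambda>x. (w x)\<^sup>2)" using S[of "(B * norm h)\<^sup>2"] by (simp only:)
  moreover have "integrable lborel w" using S[of "B * norm h"] unfolding w_def[abs_def] .
  moreover have "w x \<ge> 0" for x using B by (simp add: w_def)
  ultimately show thesis using that bound by blast
qed

lemma F_integrable: "integrable lborel F"
  by (rule integrable_lborel_compact_support[OF F_cont compact_imp_bounded[OF K] F0])

lemma F_translate_cont: "continuous_on UNIV (\<lambda>x. F (x + h))"
  by (rule continuous_on_compose2[OF F_cont]) (auto intro!: continuous_intros)

lemma F_translate_integrable: "integrable lborel (\<lambda>x. F (x + h))"
proof (rule integrable_lborel_compact_support)
  show "continuous_on UNIV (\<lambda>x. F (x + h))"
    by (rule F_translate_cont)
  show "bounded ((\<lambda>x. x - h) ` K)" by (intro bounded_translation_minus compact_imp_bounded K)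
  show "F (x + h) = 0" if "x \<notin> (\<lambda>x. x - h) ` K" for x
    using that by (intro F0) (force simp: image_iff)
qed

text \<open>The integrals of the difference quotients vanish by translation invariance, and the
  quotients converge dominatedly to the directional derivative.\<close>

lemma integral_derivative_zero: "(LINT x|lborel. h \<bullet> g x) = 0"
proof -
  obtain w where w: "integrable lborel w"
    "\<And>n x. \<bar>real (Suc n) * (F (x + h /\<^sub>R real (Suc n)) - F x)\<bar> \<le> w x"
    by (rule quotient_dominated[of h]) blast
  have "(\<lambda>n. LINT x|lborel. real (Suc n) * (F (x + h /\<^sub>R real (Suc n)) - F x)) \<longlonglongrightarrow> (LINT x|lborel. h \<bullet> g x)"
    by (rule integral_dominated_convergence[where w = w]) (use w quotient_tendsto in auto)
  moreover have "(LINT x|lborel. real (Suc n) * (F (x + h /\<^sub>R real (Suc n)) - F x)) = 0" for n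
    using F_integrable F_translate_integrable lborel_integral_translate[OF F_borel] by simp
  ultimately show ?thesis by (simp add: LIMSEQ_const_iff)
qed

lemma diff_square_integrable: "integrable lborel (\<lambda>x. (F (x + h) - F (x + k))\<^sup>2)"
proof (rule integrable_lborel_compact_support)
  show "continuous_on UNIV (\<lambda>x. (F (x + h) - F (x + k))\<^sup>2)"
    by (intro continuous_on_power continuous_on_diff F_translate_cont)
  show "bounded ((\<lambda>x. x - h) ` K \<union> (\<lambda>x. x - k) ` K)"
    by (intro bounded_Un[THEN iffD2] conjI bounded_translation_minus compact_imp_bounded K)
  show "(F (x + h) - F (x + k))\<^sup>2 = 0" if "x \<notin> (\<lambda>x. x - h) ` K \<union> (\<lambda>x. x - k) ` K" for x
  proof -
    have "x \<notin> (\<lambda>x. x - h) ` K" "x \<notin> (\<lambda>x. x - k) ` K" using that by blast+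
    then have "x + h \<notin> K" "x + k \<notin> K" by (metis add_diff_cancel image_eqI)+
    then show ?thesis by (simp add: F0)
  qed
qed

text \<open>The increment along \<open>h\<close> is a sum of N = n + 1 increments along h / N.
  Cauchy-Schwarz for the sum costs a factor N, and by translation invariance the N integrals are
  equal.\<close>

lemma diff_square_subdivide:
  "(LINT x|lborel. (F (x + h) - F x)\<^sup>2) \<le>
     (LINT x|lborel. (real (Suc n) * (F (x + h /\<^sub>R real (Suc n)) - F x))\<^sup>2)"
proof -
  define N where "N = Suc n"
  define k where "k = h /\<^sub>R real N"
  define d where "d i x = (F (x + real (Suc i) *\<^sub>R k) - F (x + real i *\<^sub>R k))\<^sup>2" for i x
  have "real N *\<^sub>R k = h" by (simp add: k_def N_def)
  have dI: "(LINT x|lborel. d i x) = (LINT x|lborel. (F (x + k) - F x)\<^sup>2)" for i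
  proof -
    have "(LINT x|lborel. (F (x + k) - F x)\<^sup>2) = (LINT x|lborel. (F (x + real i *\<^sub>R k + k) - F (x + real i *\<^sub>R k))\<^sup>2)"
      by (rule lborel_integral_translate[symmetric, where f = "\<lambda>x. (F (x + k) - F x)\<^sup>2"]) measurable
    then show ?thesis by (simp add: d_def scaleR_add_left add_ac)
  qed
  have "(LINT x|lborel. (F (x + h) - F x)\<^sup>2) \<le> (LINT x|lborel. real N * (\<Sum>i<N. d i x))"
  proof (rule integral_mono)
    show "integrable lborel (\<lambda>x. (F (x + h) - F x)\<^sup>2)" using diff_square_integrable[of h 0] by simp
    show "integrable lborel (\<lambda>x. real N * (\<Sum>i<N. d i x))"
      unfolding d_def by (intro integrable_mult_right Bochner_Integration.integrable_sum diff_square_integrable)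
    fix x
    have "F (x + h) - F x = (\<Sum>i<N. F (x + real (Suc i) *\<^sub>R k) - F (x + real i *\<^sub>R k))"
      using sum_lessThan_telescope[of "\<lambda>i. F (x + real i *\<^sub>R k)" N] \<open>real N *\<^sub>R k = h\<close> by simp
    then show "(F (x + h) - F x)\<^sup>2 \<le> real N * (\<Sum>i<N. d i x)"
      using sum_squared_le_sum_of_squares[of "\<lambda>i. F (x + real (Suc i) *\<^sub>R k) - F (x + real i *\<^sub>R k)" "{..<N}"]
      by (simp add: d_def mult.commute)
  qed
  also have "\<dots> = real N * (\<Sum>i<N. LINT x|lborel. d i x)"
    unfolding d_def by (subst integral_mult_right_zero, subst Bochner_Integration.integral_sum) (auto intro: diff_square_integrable)
  also have "\<dots> = (real N)\<^sup>2 * (LINT x|lborel. (F (x + k) - F x)\<^sup>2)"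
    by (simp add: dI power2_eq_square)
  also have "\<dots> = (LINT x|lborel. (real N * (F (x + k) - F x))\<^sup>2)"
    by (simp add: power_mult_distrib)
  finally show ?thesis by (simp only: k_def N_def)
qed

text \<open>The limit of ever finer subdivisions; it replaces integration of the gradient along the
  segment from x to x + h.\<close>

lemma translate_diff_square_le: "(LINT x|lborel. (F (x + h) - F x)\<^sup>2) \<le> (LINT x|lborel. (h \<bullet> g x)\<^sup>2)"
proof -
  obtain w where w: "integrable lborel (\<lambda>x. (w x)\<^sup>2)" "\<And>x. w x \<ge> 0"
    "\<And>n x. \<bar>real (Suc n) * (F (x + h /\<^sub>R real (Suc n)) - F x)\<bar> \<le> w x"
    by (rule quotient_dominated[of h]) blast
  have "(\<lambda>n. LINT x|lborel. (real (Suc n) * (F (x + h /\<^sub>R real (Suc n)) - F x))\<^sup>2) \<longlonglongrightarrow> (LINT x|lborel. (h \<bullet> g x)\<^sup>2)"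
  proof (rule integral_dominated_convergence[where w = "\<lambda>x. (w x)\<^sup>2"])
    show "AE x in lborel. (\<lambda>n. (real (Suc n) * (F (x + h /\<^sub>R real (Suc n)) - F x))\<^sup>2) \<longlonglongrightarrow> (h \<bullet> g x)\<^sup>2"
      by (intro AE_I2 tendsto_power quotient_tendsto)
    show "AE x in lborel. norm ((real (Suc n) * (F (x + h /\<^sub>R real (Suc n)) - F x))\<^sup>2) \<le> (w x)\<^sup>2" for n
    proof (rule AE_I2)
      fix x
      have "\<bar>real (Suc n) * (F (x + h /\<^sub>R real (Suc n)) - F x)\<bar>\<^sup>2 \<le> (w x)\<^sup>2"
        by (rule power_mono[OF w(3)]) simp
      then show "norm ((real (Suc n) * (F (x + h /\<^sub>R real (Suc n)) - F x))\<^sup>2) \<le> (w x)\<^sup>2"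
        by (simp only: power2_abs real_norm_def abs_power2)
    qed
  qed (use w in auto)
  then show ?thesis
    by (rule LIMSEQ_le_const) (use diff_square_subdivide in blast)
qed

lemma translate_diff_square_le_norm:
  "(LINT x|lborel. (F (x + h) - F x)\<^sup>2) \<le> (norm h)\<^sup>2 * (LINT x|lborel. (norm (g x))\<^sup>2)"
proof -
  have ig: "integrable lborel (\<lambda>x. (norm (g x))\<^sup>2)" "integrable lborel (\<lambda>x. (h \<bullet> g x)\<^sup>2)"
    by (rule integrable_lborel_compact_support[OF _ compact_imp_bounded[OF K]];
        (intro continuous_intros g)?; simp add: g0)+
  have "(LINT x|lborel. (h \<bullet> g x)\<^sup>2) \<le> (LINT x|lborel. (norm h)\<^sup>2 * (norm (g x))\<^sup>2)"
  proof (rule integral_mono)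
    fix x show "(h \<bullet> g x)\<^sup>2 \<le> (norm h)\<^sup>2 * (norm (g x))\<^sup>2"
      using Cauchy_Schwarz_ineq[of h "g x"] by (simp add: dot_square_norm)
  qed (use ig in auto)
  then show ?thesis using translate_diff_square_le[of h] by simp
qed

text \<open>A translation that separates the support from its translate turns the left-hand side
  of the previous estimate into twice the integral of \<open>F\<^sup>2\<close>.\<close>

lemma Poincare:
  assumes "\<And>x. x \<in> K \<Longrightarrow> x + h \<notin> K"
  shows "2 * (LINT x|lborel. (F x)\<^sup>2) \<le> (norm h)\<^sup>2 * (LINT x|lborel. (norm (g x))\<^sup>2)"
proof -
  have i1: "integrable lborel (\<lambda>x. (F x)\<^sup>2)"
    by (rule integrable_lborel_compact_support[OF _ compact_imp_bounded[OF K]])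
      (auto intro!: continuous_intros F_cont F0)
  have sq: "(F (x + h) - F x)\<^sup>2 = (F (x + h))\<^sup>2 + (F x)\<^sup>2" for x
  proof -
    have "F (x + h) = 0 \<or> F x = 0" using assms[of x] F0 by blast
    then show ?thesis by auto
  qed
  have i2: "integrable lborel (\<lambda>x. (F (x + h))\<^sup>2)"
    using Bochner_Integration.integrable_diff[OF diff_square_integrable[of h 0] i1] by (simp add: sq)
  have "(LINT x|lborel. (F (x + h) - F x)\<^sup>2) = (LINT x|lborel. (F (x + h))\<^sup>2) + (LINT x|lborel. (F x)\<^sup>2)"
    using i1 i2 by (simp add: sq)
  also have "(LINT x|lborel. (F (x + h))\<^sup>2) = (LINT x|lborel. (F x)\<^sup>2)"
    by (rule lborel_integral_translate[where f = "\<lambda>x. (F x)\<^sup>2"]) measurable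
  finally show ?thesis using translate_diff_square_le_norm[of h] by simp
qed

end

section \<open>Sobolev spaces\<close>

lemma symbil_subset: "symbil V B \<Longrightarrow> subspace W \<Longrightarrow> W \<subseteq> V \<Longrightarrow> symbil W B"
  unfolding symbil_def by blast

lemma eventually_pairs_less_mono:
  fixes f g :: "nat \<Rightarrow> nat \<Rightarrow> real"
  assumes "\<exists>N. \<forall>m\<ge>N. \<forall>n\<ge>N. f m n < e" and "\<And>m n. g m n \<le> f m n"
  shows "\<exists>N. \<forall>m\<ge>N. \<forall>n\<ge>N. g m n < e"
  using assms by (meson le_less_trans)

lemma test_smooth_compact:
  assumes "\<phi> \<in> test_functions D"
  obtains K where "smooth_compact \<phi> (classical_grad \<phi>) K" "K \<subseteq> D"
proof -
  obtain K where "compact K" "K \<subseteq> D" "\<And>x. x \<notin> K \<Longrightarrow> \<phi> x = 0" "\<And>x. x \<notin> K \<Longrightarrow> classical_grad \<phi> x = 0"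
    by (rule test_function_support[OF assms]) blast
  then show thesis
    using test_function_has_derivative[OF assms] test_function_grad_continuous[OF assms]
    by (intro that[of K] smooth_compact.intro) auto
qed

lemma integral_lebesgue_on_lborel:
  fixes f :: "'a::euclidean_space \<Rightarrow> 'b::{banach, second_countable_topology}"
  assumes D: "D \<in> sets lebesgue" and f: "f \<in> borel_measurable borel" and f0: "\<And>x. x \<notin> D \<Longrightarrow> f x = 0"
  shows "integral\<^sup>L (lebesgue_on D) f = integral\<^sup>L lborel f"
    and "integrable (lebesgue_on D) f \<longleftrightarrow> integrable lborel f"
proof -
  have "(\<lambda>x. indicator D x *\<^sub>R f x) = f" using f0 by (auto simp: fun_eq_iff indicator_def)
  then show "integral\<^sup>L (lebesgue_on D) f = integral\<^sup>L lborel f" "integrable (lebesgue_on D) f \<longleftrightarrow> integrable lborel f"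
    using D f by (simp_all add: integral_lebesgue_on_indicator integral_completion integrable_completion)
qed

text \<open>The gradient of the product of the two test functions has integral zero.\<close>

lemma integral_by_parts_test:
  assumes D: "D \<in> sets lebesgue" and phi: "\<phi> \<in> test_functions D" and psi: "\<psi> \<in> test_functions D"
  shows "(LINT x|lebesgue_on D. \<phi> x *\<^sub>R classical_grad \<psi> x) = - (LINT x|lebesgue_on D. \<psi> x *\<^sub>R classical_grad \<phi> x)"
proof -
  obtain K where K: "smooth_compact \<phi> (classical_grad \<phi>) K" "K \<subseteq> D" by (rule test_smooth_compact[OF phi])
  obtain L where L: "smooth_compact \<psi> (classical_grad \<psi>) L" "L \<subseteq> D" by (rule test_smooth_compact[OF psi])
  interpret p: smooth_compact \<phi> "classical_grad \<phi>" K by (rule K)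
  interpret q: smooth_compact \<psi> "classical_grad \<psi>" L by (rule L)
  define G where "G x = \<phi> x *\<^sub>R classical_grad \<psi> x + \<psi> x *\<^sub>R classical_grad \<phi> x" for x
  interpret pq: smooth_compact "\<lambda>x. \<phi> x * \<psi> x" G K
  proof
    show "((\<lambda>x. \<phi> x * \<psi> x) has_derivative (\<lambda>h. h \<bullet> G x)) (at x)" for x
      by (rule has_derivative_eq_rhs[OF has_derivative_mult[OF p.F q.F]])
        (auto simp: G_def inner_add_right mult.commute)
    show "continuous_on UNIV G"
      unfolding G_def by (intro continuous_intros p.F_cont q.F_cont p.g q.g)
  qed (auto simp: p.K p.F0 p.g0 G_def)
  have i1: "integrable lborel (\<lambda>x. \<phi> x *\<^sub>R classical_grad \<psi> x)"
    by (rule integrable_lborel_compact_support[OF _ compact_imp_bounded[OF p.K]])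
      (auto simp: p.F0 intro!: continuous_on_scaleR p.F_cont q.g)
  have i2: "integrable lborel (\<lambda>x. \<psi> x *\<^sub>R classical_grad \<phi> x)"
    by (rule integrable_lborel_compact_support[OF _ compact_imp_bounded[OF q.K]])
      (auto simp: q.F0 intro!: continuous_on_scaleR q.F_cont p.g)
  have iG: "integrable lborel G" unfolding G_def using i1 i2 by simp
  have "h \<bullet> integral\<^sup>L lborel G = 0" for h
    using pq.integral_derivative_zero[of h] iG by (simp add: integral_inner_right)
  then have "integral\<^sup>L lborel G = 0" using inner_eq_zero_iff by blast
  then have "(LINT x|lborel. \<phi> x *\<^sub>R classical_grad \<psi> x) + (LINT x|lborel. \<psi> x *\<^sub>R classical_grad \<phi> x) = 0"
    unfolding G_def using i1 i2 by simp
  moreover have "(LINT x|lebesgue_on D. \<phi> x *\<^sub>R classical_grad \<psi> x) = (LINT x|lborel. \<phi> x *\<^sub>R classical_grad \<psi> x)"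
    using p.F0 K(2) by (intro integral_lebesgue_on_lborel(1)[OF D]) auto
  moreover have "(LINT x|lebesgue_on D. \<psi> x *\<^sub>R classical_grad \<phi> x) = (LINT x|lborel. \<psi> x *\<^sub>R classical_grad \<phi> x)"
    using q.F0 L(2) by (intro integral_lebesgue_on_lborel(1)[OF D]) auto
  ultimately show ?thesis by (simp only: eq_neg_iff_add_eq_0)
qed

definition grad_inner :: "(real^'n) set \<Rightarrow> (real^'n \<Rightarrow> real) \<Rightarrow> (real^'n \<Rightarrow> real) \<Rightarrow> real" where
  "grad_inner D u v = L2_inner D (weak_grad D u) (weak_grad D v)"

lemma V_norm_eq: "V_norm D v = sqrt (grad_inner D v v)"
  by (simp add: V_norm_def L2_norm_eq grad_inner_def)

lemma H1_norm_eq: "H1_norm D v = sqrt (grad_inner D v v + L2_inner D v v)"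
  by (simp add: H1_norm_def L2_norm_eq grad_inner_def L2_inner_nonneg add.commute)

lemma grad_inner_nonneg: "grad_inner D v v \<ge> 0"
  by (simp add: grad_inner_def L2_inner_nonneg)

context
  fixes D :: "(real^'n) set"
  assumes open_D: "open D" and bounded_D: "bounded D"
begin

lemma continuous_bounded_L2:
  fixes f :: "real^'n \<Rightarrow> 'b::euclidean_space"
  assumes "continuous_on UNIV f" "bounded K" "\<And>x. x \<notin> K \<Longrightarrow> f x = 0" "K \<subseteq> D"
  shows "f \<in> L2 D"
proof -
  have D: "D \<in> sets lebesgue" using open_D by simp
  have m: "f \<in> borel_measurable borel" using assms(1) by (rule borel_measurable_continuous_onI)
  have "integrable lborel (\<lambda>x. (norm (f x))\<^sup>2)"
    by (rule integrable_lborel_compact_support[OF _ assms(2)]) (use assms in \<open>auto intro!: continuous_intros\<close>)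
  moreover have "(\<lambda>x. (norm (f x))\<^sup>2) \<in> borel_measurable borel" using m by measurable
  ultimately have "integrable (lebesgue_on D) (\<lambda>x. (norm (f x))\<^sup>2)"
    using assms(3,4) by (subst integral_lebesgue_on_lborel(2)[OF D]) auto
  moreover have "f \<in> borel_measurable (lebesgue_on D)"
    using m by (intro measurable_restrict_space1 measurable_completion) simp
  ultimately show ?thesis by (simp add: L2_def)
qed

lemma test_function_L2:
  fixes v :: "'b::euclidean_space"
  assumes "\<phi> \<in> test_functions D"
  shows "\<phi> \<in> L2 D" "classical_grad \<phi> \<in> L2 D" "(\<lambda>x. classical_grad \<phi> x \<bullet> h) \<in> L2 D" "(\<lambda>x. \<phi> x *\<^sub>R v) \<in> L2 D"
proof -
  obtain K where SC: "smooth_compact \<phi> (classical_grad \<phi>) K" "K \<subseteq> D" by (rule test_smooth_compact[OF assms])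
  interpret smooth_compact \<phi> "classical_grad \<phi>" K by (rule SC)
  show "\<phi> \<in> L2 D" "classical_grad \<phi> \<in> L2 D" "(\<lambda>x. classical_grad \<phi> x \<bullet> h) \<in> L2 D" "(\<lambda>x. \<phi> x *\<^sub>R v) \<in> L2 D"
    by (rule continuous_bounded_L2[OF _ compact_imp_bounded[OF K] _ SC(2)];
        auto intro!: F_cont g continuous_on_scaleR continuous_on_inner simp: F0 g0)+
qed

text \<open>Taking components along every vector \<open>h\<close> turns the vector identity into
  equations between inner products in \<open>L2\<close>, which are linear in \<open>u\<close> and
  \<open>g\<close> and survive limits.\<close>

lemma is_weak_grad_L2_iff:
  assumes u: "u \<in> L2 D" and g: "g \<in> L2 D"
  shows "is_weak_grad D u g \<longleftrightarrow> (\<forall>\<phi>\<in>test_functions D. \<forall>h.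
     L2_inner D u (\<lambda>x. classical_grad \<phi> x \<bullet> h) = - L2_inner D g (\<lambda>x. \<phi> x *\<^sub>R h))"
proof -
  have li: "locally_integrable D u" "locally_integrable D g"
    using L2_imp_locally_integrable[OF open_D bounded_D u] L2_imp_locally_integrable[OF open_D bounded_D g] by auto
  have "(LINT x|lebesgue_on D. u x *\<^sub>R classical_grad \<phi> x) = - (LINT x|lebesgue_on D. \<phi> x *\<^sub>R g x) \<longleftrightarrow>
     (\<forall>h. L2_inner D u (\<lambda>x. classical_grad \<phi> x \<bullet> h) = - L2_inner D g (\<lambda>x. \<phi> x *\<^sub>R h))"
    if phi: "\<phi> \<in> test_functions D" for \<phi>
  proof -
    have "L2_inner D u (\<lambda>x. classical_grad \<phi> x \<bullet> h) = (LINT x|lebesgue_on D. u x *\<^sub>R classical_grad \<phi> x) \<bullet> h" for h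
      using integrable_test_grad_mult[OF open_D li(1) phi] by (simp add: L2_inner_def flip: integral_inner_left)
    moreover have "L2_inner D g (\<lambda>x. \<phi> x *\<^sub>R h) = (LINT x|lebesgue_on D. \<phi> x *\<^sub>R g x) \<bullet> h" for h
      using integrable_test_function_mult[OF open_D li(2) phi] by (simp add: L2_inner_def flip: integral_inner_left)
    moreover have "a = - b \<longleftrightarrow> (\<forall>h. a \<bullet> h = - (b \<bullet> h))" for a b :: "real^'n"
      unfolding inner_minus_left[symmetric] by (metis inner_commute vector_eq_ldot)
    ultimately show ?thesis by simp
  qed
  then show ?thesis unfolding is_weak_grad_def using li by blast
qed

lemma test_is_weak_grad:
  assumes phi: "\<phi> \<in> test_functions D"
  shows "is_weak_grad D \<phi> (classical_grad \<phi>)"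
  unfolding is_weak_grad_def
  using L2_imp_locally_integrable[OF open_D bounded_D test_function_L2(1)[OF phi]]
    L2_imp_locally_integrable[OF open_D bounded_D test_function_L2(2)[OF phi]] integral_by_parts_test[OF _ phi] open_D
  by auto

lemma H1D:
  assumes "u \<in> H1 D"
  shows "u \<in> L2 D" "weak_grad D u \<in> L2 D" "is_weak_grad D u (weak_grad D u)"
  using assms someI_ex[of "is_weak_grad D u"] by (auto simp: H1_def weak_grad_def)

text \<open>Any square-integrable weak gradient may stand in for the chosen representative
  \<open>weak_grad\<close>.\<close>

lemma H1I:
  assumes "u \<in> L2 D" "g \<in> L2 D" "is_weak_grad D u g"
  shows "u \<in> H1 D" "AE x in lebesgue_on D. weak_grad D u x = g x"
proof -
  have "is_weak_grad D u (weak_grad D u)"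
    using assms(3) someI[of "is_weak_grad D u"] by (auto simp: weak_grad_def)
  then show ae: "AE x in lebesgue_on D. weak_grad D u x = g x"
    by (rule weak_grad_unique[OF open_D _ assms(3)])
  then have "AE x in lebesgue_on D. g x = weak_grad D u x" by eventually_elim simp
  then have "weak_grad D u \<in> L2 D" by (rule L2_cong_AE[OF open_sets_lebesgue[OF open_D] assms(2)])
  then show "u \<in> H1 D" using assms by (auto simp: H1_def)
qed

lemma H1_add:
  assumes "u \<in> H1 D" "v \<in> H1 D"
  shows "u + v \<in> H1 D" "AE x in lebesgue_on D. weak_grad D (u + v) x = (weak_grad D u + weak_grad D v) x"
proof -
  note u = H1D[OF assms(1)] and v = H1D[OF assms(2)]
  note S = subspace_add[OF subspace_L2]
  have "is_weak_grad D (u + v) (weak_grad D u + weak_grad D v)"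
    unfolding is_weak_grad_L2_iff[OF S[OF u(1) v(1)] S[OF u(2) v(2)]]
  proof (intro ballI allI)
    fix \<phi> and h :: "real^'n" assume phi: "\<phi> \<in> test_functions D"
    note t = test_function_L2[OF phi]
    show "L2_inner D (u + v) (\<lambda>x. classical_grad \<phi> x \<bullet> h) = - L2_inner D (weak_grad D u + weak_grad D v) (\<lambda>x. \<phi> x *\<^sub>R h)"
      unfolding symbil_add_left[OF symbil_L2_inner u(1) v(1) t(3)] symbil_add_left[OF symbil_L2_inner u(2) v(2) t(4)]
      using u(3)[unfolded is_weak_grad_L2_iff[OF u(1,2)]] v(3)[unfolded is_weak_grad_L2_iff[OF v(1,2)]] phi by simp
  qed
  then show "u + v \<in> H1 D" "AE x in lebesgue_on D. weak_grad D (u + v) x = (weak_grad D u + weak_grad D v) x"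
    by (rule H1I[OF S[OF u(1) v(1)] S[OF u(2) v(2)]])+
qed

lemma H1_diff:
  assumes "u \<in> H1 D" "v \<in> H1 D"
  shows "u - v \<in> H1 D" "AE x in lebesgue_on D. weak_grad D (u - v) x = (weak_grad D u - weak_grad D v) x"
proof -
  note u = H1D[OF assms(1)] and v = H1D[OF assms(2)]
  note S = subspace_diff[OF subspace_L2]
  have "is_weak_grad D (u - v) (weak_grad D u - weak_grad D v)"
    unfolding is_weak_grad_L2_iff[OF S[OF u(1) v(1)] S[OF u(2) v(2)]]
  proof (intro ballI allI)
    fix \<phi> and h :: "real^'n" assume phi: "\<phi> \<in> test_functions D"
    note t = test_function_L2[OF phi]
    show "L2_inner D (u - v) (\<lambda>x. classical_grad \<phi> x \<bullet> h) = - L2_inner D (weak_grad D u - weak_grad D v) (\<lambda>x. \<phi> x *\<^sub>R h)"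
      unfolding symbil_diff_left[OF symbil_L2_inner u(1) v(1) t(3)] symbil_diff_left[OF symbil_L2_inner u(2) v(2) t(4)]
      using u(3)[unfolded is_weak_grad_L2_iff[OF u(1,2)]] v(3)[unfolded is_weak_grad_L2_iff[OF v(1,2)]] phi by simp
  qed
  then show "u - v \<in> H1 D" "AE x in lebesgue_on D. weak_grad D (u - v) x = (weak_grad D u - weak_grad D v) x"
    by (rule H1I[OF S[OF u(1) v(1)] S[OF u(2) v(2)]])+
qed

lemma H1_scale:
  assumes "u \<in> H1 D"
  shows "c *\<^sub>R u \<in> H1 D" "AE x in lebesgue_on D. weak_grad D (c *\<^sub>R u) x = (c *\<^sub>R weak_grad D u) x"
proof -
  note u = H1D[OF assms(1)]
  note S = subspace_scale[OF subspace_L2]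
  have "is_weak_grad D (c *\<^sub>R u) (c *\<^sub>R weak_grad D u)"
    unfolding is_weak_grad_L2_iff[OF S[OF u(1)] S[OF u(2)]]
  proof (intro ballI allI)
    fix \<phi> and h :: "real^'n" assume phi: "\<phi> \<in> test_functions D"
    note t = test_function_L2[OF phi]
    show "L2_inner D (c *\<^sub>R u) (\<lambda>x. classical_grad \<phi> x \<bullet> h) = - L2_inner D (c *\<^sub>R weak_grad D u) (\<lambda>x. \<phi> x *\<^sub>R h)"
      unfolding symbil_scale_left[OF symbil_L2_inner u(1) t(3)] symbil_scale_left[OF symbil_L2_inner u(2) t(4)]
      using u(3)[unfolded is_weak_grad_L2_iff[OF u(1,2)]] phi by simp
  qed
  then show "c *\<^sub>R u \<in> H1 D" "AE x in lebesgue_on D. weak_grad D (c *\<^sub>R u) x = (c *\<^sub>R weak_grad D u) x"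
    by (rule H1I[OF S[OF u(1)] S[OF u(2)]])+
qed

lemma test_function_H1:
  assumes "\<phi> \<in> test_functions D"
  shows "\<phi> \<in> H1 D" "AE x in lebesgue_on D. weak_grad D \<phi> x = classical_grad \<phi> x"
  using H1I[OF test_function_L2(1,2)[OF assms] test_is_weak_grad[OF assms]] .

lemma subspace_H1: "subspace (H1 D)"
proof (rule subspaceI)
  have "(0 :: real^'n \<Rightarrow> real) = (\<lambda>x. 0)" by (simp add: zero_fun_def)
  then show "0 \<in> H1 D" using test_function_H1(1)[OF test_function_zero] by simp
qed (auto intro: H1_add H1_scale)

lemma symbil_L2_H1: "symbil (H1 D) (L2_inner D)"
  by (rule symbil_subset[OF symbil_L2_inner subspace_H1]) (auto simp: H1_def)

lemma symbil_grad_H1: "symbil (H1 D) (grad_inner D)"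
  unfolding symbil_def
proof (intro conjI ballI allI subspace_H1)
  fix u v w c assume u: "u \<in> H1 D"
  assume w: "w \<in> H1 D"
  note mu = H1D(2)[OF u] and mw = H1D(2)[OF w]
  have "L2_inner D (weak_grad D (c *\<^sub>R u)) (weak_grad D w) = L2_inner D (c *\<^sub>R weak_grad D u) (weak_grad D w)"
    using H1_scale[OF u] mu mw H1D(2)[OF H1_scale(1)[OF u]] subspace_scale[OF subspace_L2 mu]
    by (intro L2_inner_cong_AE) (auto intro: L2D(1))
  then show "grad_inner D (c *\<^sub>R u) w = c * grad_inner D u w"
    using symbil_scale_left[OF symbil_L2_inner mu mw] by (simp add: grad_inner_def)
  assume v: "v \<in> H1 D"
  note mv = H1D(2)[OF v]
  show "grad_inner D u v = grad_inner D v u"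
    unfolding grad_inner_def by (rule symbil_sym[OF symbil_L2_inner mu mv])
  have "L2_inner D (weak_grad D (u + v)) (weak_grad D w) = L2_inner D (weak_grad D u + weak_grad D v) (weak_grad D w)"
    using H1_add[OF u v] mu mv mw H1D(2)[OF H1_add(1)[OF u v]] subspace_add[OF subspace_L2 mu mv]
    by (intro L2_inner_cong_AE) (auto intro: L2D(1))
  then show "grad_inner D (u + v) w = grad_inner D u w + grad_inner D v w"
    using symbil_add_left[OF symbil_L2_inner mu mv mw] by (simp add: grad_inner_def)
qed

definition H1_inner :: "(real^'n \<Rightarrow> real) \<Rightarrow> (real^'n \<Rightarrow> real) \<Rightarrow> real" where
  "H1_inner u v = 1 * grad_inner D u v + 1 * L2_inner D u v"

lemma symbil_H1: "symbil (H1 D) H1_inner"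
  unfolding H1_inner_def[abs_def] by (rule symbil_lincomb[OF symbil_grad_H1 symbil_L2_H1])

lemma H1_inner_nonneg: "H1_inner u u \<ge> 0"
  by (simp add: H1_inner_def grad_inner_nonneg L2_inner_nonneg)

lemma H1_norm_tendsto_iff: "(\<lambda>k. H1_norm D (X k)) \<longlonglongrightarrow> 0 \<longleftrightarrow> (\<lambda>k. H1_inner (X k) (X k)) \<longlonglongrightarrow> 0"
proof
  have eq: "H1_norm D u = sqrt (H1_inner u u)" for u by (simp add: H1_norm_eq H1_inner_def)
  { assume "(\<lambda>k. H1_norm D (X k)) \<longlonglongrightarrow> 0"
    from tendsto_power[OF this, of 2] show "(\<lambda>k. H1_inner (X k) (X k)) \<longlonglongrightarrow> 0"
      by (simp add: eq H1_inner_nonneg) }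
  assume "(\<lambda>k. H1_inner (X k) (X k)) \<longlonglongrightarrow> 0"
  from tendsto_real_sqrt[OF this] show "(\<lambda>k. H1_norm D (X k)) \<longlonglongrightarrow> 0" by (simp add: eq)
qed

lemma H10_iff:
  "u \<in> H10 D \<longleftrightarrow> u \<in> H1 D \<and> (\<exists>\<phi>. (\<forall>k. \<phi> k \<in> test_functions D) \<and> (\<lambda>k. H1_inner (\<phi> k - u) (\<phi> k - u)) \<longlonglongrightarrow> 0)"
  by (simp add: H10_def H1_norm_tendsto_iff[symmetric] fun_diff_def)

lemma H10_D: "u \<in> H10 D \<Longrightarrow> u \<in> H1 D"
  by (simp add: H10_def)

lemma H1_tendsto_D:
  assumes "(\<lambda>k. H1_inner (X k) (X k)) \<longlonglongrightarrow> 0"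
  shows "(\<lambda>k. grad_inner D (X k) (X k)) \<longlonglongrightarrow> 0" "(\<lambda>k. L2_inner D (X k) (X k)) \<longlonglongrightarrow> 0"
  by (rule Lim_null_comparison[OF _ assms]; simp add: H1_inner_def grad_inner_nonneg L2_inner_nonneg)+

lemma subspace_H10: "subspace (H10 D)"
proof (rule subspaceI)
  have "(0 :: real^'n \<Rightarrow> real) = (\<lambda>x. 0)" by (simp add: zero_fun_def)
  then have 0: "0 \<in> test_functions D" using test_function_zero[of D] by simp
  show "0 \<in> H10 D"
    unfolding H10_iff using test_function_H1(1)[OF 0] 0 symbil_zero[OF symbil_H1]
    by (intro conjI exI[of _ "\<lambda>k. 0"]) auto
next
  fix u v c assume u: "u \<in> H10 D"
  then obtain \<phi> where uH: "u \<in> H1 D" and phi: "\<And>k. \<phi> k \<in> test_functions D"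
    and lim: "(\<lambda>k. H1_inner (\<phi> k - u) (\<phi> k - u)) \<longlonglongrightarrow> 0" unfolding H10_iff by blast
  have phiH: "\<phi> k \<in> H1 D" for k using test_function_H1(1)[OF phi] .
  note mem = symbil_mem[OF symbil_H1]
  have scale: "c *\<^sub>R \<phi> k \<in> test_functions D" for k
    using test_function_scale[OF phi, of c k] by (simp add: scaleR_fun_def)
  have "H1_inner (c *\<^sub>R \<phi> k - c *\<^sub>R u) (c *\<^sub>R \<phi> k - c *\<^sub>R u) = c\<^sup>2 * H1_inner (\<phi> k - u) (\<phi> k - u)" for k
    using uH phiH symbil_scale_left[OF symbil_H1, of "\<phi> k - u" "c *\<^sub>R (\<phi> k - u)"]
      symbil_scale_right[OF symbil_H1, of "\<phi> k - u" "\<phi> k - u"] mem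
    by (simp add: power2_eq_square flip: scaleR_diff_right)
  moreover have "(\<lambda>k. c\<^sup>2 * H1_inner (\<phi> k - u) (\<phi> k - u)) \<longlonglongrightarrow> 0"
    using tendsto_mult_right_zero[OF lim] .
  ultimately show "c *\<^sub>R u \<in> H10 D"
    unfolding H10_iff using H1_scale(1)[OF uH] scale
    by (intro conjI exI[of _ "\<lambda>k. c *\<^sub>R \<phi> k"]) auto
  assume v: "v \<in> H10 D"
  then obtain \<psi> where vH: "v \<in> H1 D" and psi: "\<And>k. \<psi> k \<in> test_functions D"
    and lim': "(\<lambda>k. H1_inner (\<psi> k - v) (\<psi> k - v)) \<longlonglongrightarrow> 0" unfolding H10_iff by blast
  have psiH: "\<psi> k \<in> H1 D" for k using test_function_H1(1)[OF psi] .
  have "(\<lambda>k. sqrt (H1_inner (\<phi> k + \<psi> k - (u + v)) (\<phi> k + \<psi> k - (u + v)))) \<longlonglongrightarrow> 0"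
  proof (rule Lim_null_comparison)
    show "\<forall>\<^sub>F k in sequentially. norm (sqrt (H1_inner (\<phi> k + \<psi> k - (u + v)) (\<phi> k + \<psi> k - (u + v))))
       \<le> sqrt (H1_inner (\<phi> k - u) (\<phi> k - u)) + sqrt (H1_inner (\<psi> k - v) (\<psi> k - v))"
    proof (intro always_eventually allI)
      fix k
      have "\<phi> k + \<psi> k - (u + v) = (\<phi> k - u) + (\<psi> k - v)" by (rule add_diff_add)
      with symbil_triangle[OF symbil_H1 H1_inner_nonneg mem(2)[OF phiH uH] mem(2)[OF psiH vH], of k k]
      show "norm (sqrt (H1_inner (\<phi> k + \<psi> k - (u + v)) (\<phi> k + \<psi> k - (u + v))))
       \<le> sqrt (H1_inner (\<phi> k - u) (\<phi> k - u)) + sqrt (H1_inner (\<psi> k - v) (\<psi> k - v))"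
        by (simp only: real_norm_def abs_of_nonneg real_sqrt_ge_zero H1_inner_nonneg)
    qed
    show "(\<lambda>k. sqrt (H1_inner (\<phi> k - u) (\<phi> k - u)) + sqrt (H1_inner (\<psi> k - v) (\<psi> k - v))) \<longlonglongrightarrow> 0"
      using tendsto_add[OF tendsto_real_sqrt[OF lim] tendsto_real_sqrt[OF lim']] by simp
  qed
  from tendsto_power[OF this, of 2]
  have "(\<lambda>k. H1_inner (\<phi> k + \<psi> k - (u + v)) (\<phi> k + \<psi> k - (u + v))) \<longlonglongrightarrow> 0"
    by (simp add: H1_inner_nonneg)
  then show "u + v \<in> H10 D"
    unfolding H10_iff using H1_add(1)[OF uH vH] test_function_add[OF phi psi]
    by (intro conjI exI[of _ "\<lambda>k. \<phi> k + \<psi> k"]) (auto simp: plus_fun_def)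
qed

lemma symbil_H10: "symbil (H10 D) H1_inner" "symbil (H10 D) (L2_inner D)" "symbil (H10 D) (grad_inner D)"
  using symbil_subset[OF _ subspace_H10] symbil_H1 symbil_L2_H1 symbil_grad_H1 H10_D by blast+

text \<open>Each member of the sequence is approximated by a test function to within 1 / (n + 1);
  these test functions have the same limit.\<close>

lemma H10_closed:
  assumes X: "\<And>n::nat. X n \<in> H10 D" and u: "u \<in> H1 D" and lim: "(\<lambda>n. H1_inner (X n - u) (X n - u)) \<longlonglongrightarrow> 0"
  shows "u \<in> H10 D"
proof -
  have "\<exists>\<phi>\<in>test_functions D. H1_inner (\<phi> - X n) (\<phi> - X n) < (1 / real (Suc n))\<^sup>2" for n
  proof -
    obtain \<phi> where phi: "\<And>k. \<phi> k \<in> test_functions D" "(\<lambda>k. H1_inner (\<phi> k - X n) (\<phi> k - X n)) \<longlonglongrightarrow> 0"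
      using X[of n] unfolding H10_iff by blast
    have "\<forall>\<^sub>F k in sequentially. H1_inner (\<phi> k - X n) (\<phi> k - X n) < (1 / real (Suc n))\<^sup>2"
      by (rule order_tendstoD(2)[OF phi(2)]) simp
    then obtain k where "H1_inner (\<phi> k - X n) (\<phi> k - X n) < (1 / real (Suc n))\<^sup>2"
      by (auto simp: eventually_sequentially)
    then show ?thesis using phi(1) by blast
  qed
  then obtain \<phi> where phi: "\<And>n. \<phi> n \<in> test_functions D"
    "\<And>n. H1_inner (\<phi> n - X n) (\<phi> n - X n) < (1 / real (Suc n))\<^sup>2" by metis
  have phiH: "\<phi> n \<in> H1 D" and XH: "X n \<in> H1 D" for n
    using test_function_H1(1)[OF phi(1)] H10_D[OF X] by auto
  note mem = symbil_mem[OF symbil_H1]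
  have "(\<lambda>n. sqrt (H1_inner (\<phi> n - u) (\<phi> n - u))) \<longlonglongrightarrow> 0"
  proof (rule Lim_null_comparison)
    show "\<forall>\<^sub>F n in sequentially. norm (sqrt (H1_inner (\<phi> n - u) (\<phi> n - u)))
        \<le> 1 / real (Suc n) + sqrt (H1_inner (X n - u) (X n - u))"
    proof (intro always_eventually allI)
      fix n
      have "sqrt (H1_inner (\<phi> n - X n) (\<phi> n - X n)) \<le> 1 / real (Suc n)"
        using phi(2)[of n] by (intro real_le_lsqrt) (auto simp: H1_inner_nonneg)
      moreover have "sqrt (H1_inner (\<phi> n - u) (\<phi> n - u)) \<le> sqrt (H1_inner (\<phi> n - X n) (\<phi> n - X n)) + sqrt (H1_inner (X n - u) (X n - u))"
      proof -
        have "(\<phi> n - X n) + (X n - u) = \<phi> n - u" by simp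
        with symbil_triangle[OF symbil_H1 H1_inner_nonneg mem(2)[OF phiH XH] mem(2)[OF XH u], of n n n]
        show ?thesis by (simp only:)
      qed
      ultimately show "norm (sqrt (H1_inner (\<phi> n - u) (\<phi> n - u)))
        \<le> 1 / real (Suc n) + sqrt (H1_inner (X n - u) (X n - u))" by (simp add: H1_inner_nonneg)
    qed
    show "(\<lambda>n. 1 / real (Suc n) + sqrt (H1_inner (X n - u) (X n - u))) \<longlonglongrightarrow> 0"
      using tendsto_add[OF LIMSEQ_inverse_real_of_nat tendsto_real_sqrt[OF lim]] by (simp add: inverse_eq_divide)
  qed
  from tendsto_power[OF this, of 2]
  have "(\<lambda>n. H1_inner (\<phi> n - u) (\<phi> n - u)) \<longlonglongrightarrow> 0" by (simp add: H1_inner_nonneg)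
  then show ?thesis unfolding H10_iff using u phi(1) by blast
qed

text \<open>The functions and their gradients converge separately in \<open>L2\<close>. The identity
  defining weak gradients passes to the limit, so the second limit is the gradient of the
  first.\<close>

lemma H10_complete:
  assumes X: "\<And>n::nat. X n \<in> H10 D"
    and cauchy: "\<And>e. e > 0 \<Longrightarrow> \<exists>N. \<forall>m\<ge>N. \<forall>n\<ge>N. grad_inner D (X m - X n) (X m - X n) + L2_inner D (X m - X n) (X m - X n) < e"
  shows "\<exists>u\<in>H10 D. (\<lambda>n. grad_inner D (X n - u) (X n - u) + L2_inner D (X n - u) (X n - u)) \<longlonglongrightarrow> 0"
proof -
  have XH: "X n \<in> H1 D" for n using X H10_D by blast
  note XL = H1D(1)[OF XH] and wL = H1D(2)[OF XH]
  note memL = symbil_mem[OF symbil_L2_inner[of D]]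
  have grad_diff: "L2_inner D (weak_grad D u - weak_grad D v) (weak_grad D u - weak_grad D v) = grad_inner D (u - v) (u - v)"
    if "u \<in> H1 D" "v \<in> H1 D" for u v
    unfolding grad_inner_def
    using H1_diff[OF that] L2D(1)[OF H1D(2)[OF H1_diff(1)[OF that]]] L2D(1)[OF memL(2)[OF H1D(2)[OF that(1)] H1D(2)[OF that(2)]]]
    by (intro L2_inner_cong_AE) (auto elim: eventually_mono)
  have c1: "\<exists>N. \<forall>m\<ge>N. \<forall>n\<ge>N. L2_inner D (X m - X n) (X m - X n) < e" if "e > 0" for e
    by (rule eventually_pairs_less_mono[OF cauchy[OF that]]) (simp add: grad_inner_nonneg)
  have c2: "\<exists>N. \<forall>m\<ge>N. \<forall>n\<ge>N. L2_inner D (weak_grad D (X m) - weak_grad D (X n)) (weak_grad D (X m) - weak_grad D (X n)) < e" if "e > 0" for e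
    by (rule eventually_pairs_less_mono[OF cauchy[OF that]]) (simp add: grad_diff[OF XH XH] L2_inner_nonneg)
  obtain u where u: "u \<in> L2 D" "(\<lambda>n. L2_inner D (X n - u) (X n - u)) \<longlonglongrightarrow> 0"
    using L2_complete[OF open_D bounded_D XL c1] by blast
  obtain g where g: "g \<in> L2 D" "(\<lambda>n. L2_inner D (weak_grad D (X n) - g) (weak_grad D (X n) - g)) \<longlonglongrightarrow> 0"
    using L2_complete[OF open_D bounded_D wL c2] by blast
  have "is_weak_grad D u g"
    unfolding is_weak_grad_L2_iff[OF u(1) g(1)]
  proof (intro ballI allI)
    fix \<phi> and h :: "real^'n" assume phi: "\<phi> \<in> test_functions D"
    note t = test_function_L2[OF phi]
    have "(\<lambda>n. L2_inner D (X n) (\<lambda>x. classical_grad \<phi> x \<bullet> h)) \<longlonglongrightarrow> L2_inner D u (\<lambda>x. classical_grad \<phi> x \<bullet> h)"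
      by (rule symbil_tendsto(2)[OF symbil_L2_inner L2_inner_nonneg XL u t(3)])
    moreover have "(\<lambda>n. - L2_inner D (weak_grad D (X n)) (\<lambda>x. \<phi> x *\<^sub>R h)) \<longlonglongrightarrow> - L2_inner D g (\<lambda>x. \<phi> x *\<^sub>R h)"
      by (intro tendsto_minus symbil_tendsto(2)[OF symbil_L2_inner L2_inner_nonneg wL g t(4)])
    moreover have "L2_inner D (X n) (\<lambda>x. classical_grad \<phi> x \<bullet> h) = - L2_inner D (weak_grad D (X n)) (\<lambda>x. \<phi> x *\<^sub>R h)" for n
      using H1D(3)[OF XH] phi unfolding is_weak_grad_L2_iff[OF XL wL] by blast
    ultimately show "L2_inner D u (\<lambda>x. classical_grad \<phi> x \<bullet> h) = - L2_inner D g (\<lambda>x. \<phi> x *\<^sub>R h)"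
      using LIMSEQ_unique by auto
  qed
  note uH = H1I[OF u(1) g(1) this]
  have "L2_inner D (weak_grad D (X n) - g) (weak_grad D (X n) - g)
      = L2_inner D (weak_grad D (X n) - weak_grad D u) (weak_grad D (X n) - weak_grad D u)" for n
  proof (rule L2_inner_cong_AE)
    show "AE x in lebesgue_on D. (weak_grad D (X n) - g) x = (weak_grad D (X n) - weak_grad D u) x"
      using uH(2) by eventually_elim simp
    then show "AE x in lebesgue_on D. (weak_grad D (X n) - g) x = (weak_grad D (X n) - weak_grad D u) x" .
  qed (use L2D(1)[OF memL(2)[OF wL[of n] g(1)]] L2D(1)[OF memL(2)[OF wL[of n] H1D(2)[OF uH(1)]]] in auto)
  then have "(\<lambda>n. grad_inner D (X n - u) (X n - u)) \<longlonglongrightarrow> 0"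
    using g(2) grad_diff[OF XH uH(1)] by simp
  then have lim: "(\<lambda>n. grad_inner D (X n - u) (X n - u) + L2_inner D (X n - u) (X n - u)) \<longlonglongrightarrow> 0"
    using tendsto_add[OF _ u(2)] by fastforce
  then have "u \<in> H10 D"
    by (intro H10_closed[OF X uH(1)]) (simp add: H1_inner_def)
  then show ?thesis using lim by blast
qed

lemma H10_Poincare:
  obtains C where "C > 0" "\<And>u. u \<in> H10 D \<Longrightarrow> L2_inner D u u \<le> C * grad_inner D u u"
proof -
  obtain R where R: "R > 0" "\<forall>x\<in>D. norm x \<le> R" using bounded_D bounded_pos by blast
  obtain b :: "real^'n" where b: "b \<in> Basis" using nonempty_Basis by blast
  \<comment> \<open>Longer than the diameter 2 R of a ball containing \<open>D\<close>, so that
    translation by \<open>h\<close> moves every support off itself.\<close>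
  define h where "h = (2 * R + 1) *\<^sub>R b"
  have nh: "norm h = 2 * R + 1" using b R by (simp add: h_def)
  have test: "2 * L2_inner D \<phi> \<phi> \<le> (norm h)\<^sup>2 * grad_inner D \<phi> \<phi>" if phi: "\<phi> \<in> test_functions D" for \<phi>
  proof -
    obtain K where SC: "smooth_compact \<phi> (classical_grad \<phi>) K" "K \<subseteq> D" by (rule test_smooth_compact[OF phi])
    interpret smooth_compact \<phi> "classical_grad \<phi>" K by (rule SC)
    have D: "D \<in> sets lebesgue" using open_D by simp
    have "x + h \<notin> K" if "x \<in> K" for x
    proof
      assume "x + h \<in> K"
      then have "norm (x + h) \<le> R" "norm x \<le> R" using that SC(2) R by auto
      moreover have "norm h \<le> norm (x + h) + norm x" using norm_triangle_ineq4[of "x + h" x] by simp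
      ultimately show False using nh by simp
    qed
    from Poincare[OF this]
    have "2 * (LINT x|lborel. (\<phi> x)\<^sup>2) \<le> (norm h)\<^sup>2 * (LINT x|lborel. (norm (classical_grad \<phi> x))\<^sup>2)" .
    moreover have "(LINT x|lborel. (\<phi> x)\<^sup>2) = L2_inner D \<phi> \<phi>"
      unfolding L2_inner_def using F0 SC(2)
      by (subst integral_lebesgue_on_lborel(1)[OF D]) (auto simp: power2_eq_square)
    moreover have "(LINT x|lborel. (norm (classical_grad \<phi> x))\<^sup>2) = L2_inner D (classical_grad \<phi>) (classical_grad \<phi>)"
      unfolding L2_inner_def using g0 SC(2)
      by (subst integral_lebesgue_on_lborel(1)[OF D]) (auto simp: dot_square_norm)
    moreover have "L2_inner D (classical_grad \<phi>) (classical_grad \<phi>) = grad_inner D \<phi> \<phi>"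
      unfolding grad_inner_def using test_function_H1[OF phi] test_function_L2(2)[OF phi] H1D(2)[OF test_function_H1(1)[OF phi]]
      by (intro L2_inner_cong_AE) (auto intro: L2D(1) elim: eventually_mono)
    ultimately show ?thesis by simp
  qed
  have "2 * L2_inner D u u \<le> (norm h)\<^sup>2 * grad_inner D u u" if u: "u \<in> H10 D" for u
  proof -
    obtain \<phi> where uH: "u \<in> H1 D" and phi: "\<And>k. \<phi> k \<in> test_functions D"
      and lim: "(\<lambda>k. H1_inner (\<phi> k - u) (\<phi> k - u)) \<longlonglongrightarrow> 0" using u unfolding H10_iff by blast
    have phiH: "\<phi> k \<in> H1 D" for k using test_function_H1(1)[OF phi] .
    have "(\<lambda>k. L2_inner D (\<phi> k) (\<phi> k)) \<longlonglongrightarrow> L2_inner D u u"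
      by (rule symbil_tendsto(1)[where B = "L2_inner D", OF symbil_L2_H1 _ phiH uH H1_tendsto_D(2)[OF lim]]) (rule L2_inner_nonneg)
    moreover have "(\<lambda>k. grad_inner D (\<phi> k) (\<phi> k)) \<longlonglongrightarrow> grad_inner D u u"
      by (rule symbil_tendsto(1)[where B = "grad_inner D", OF symbil_grad_H1 _ phiH uH H1_tendsto_D(1)[OF lim]]) (rule grad_inner_nonneg)
    ultimately show ?thesis
      by (intro LIMSEQ_le[OF tendsto_mult_left tendsto_mult_left]) (use test[OF phi] in blast)+
  qed
  then show thesis using that[of "(norm h)\<^sup>2 / 2"] nh R by (simp add: field_simps)
qed

end

section \<open>The Rellich theorem\<close>

text \<open>Half-open cubes of side \<open>h\<close> indexed by integer vectors. The floor function
  makes them a partition of the space, so every point lies in exactly one cell.\<close>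

definition grid_cell :: "real \<Rightarrow> int^'n \<Rightarrow> (real^'n) set" where
  "grid_cell h k = {x. \<forall>i. \<lfloor>x $ i / h\<rfloor> = k $ i}"

definition grid_key :: "real \<Rightarrow> real^'n \<Rightarrow> int^'n" where
  "grid_key h x = (\<chi> i. \<lfloor>x $ i / h\<rfloor>)"

lemma grid_cell_iff: "x \<in> grid_cell h k \<longleftrightarrow> k = grid_key h x"
  by (auto simp: grid_cell_def grid_key_def vec_eq_iff)

lemma grid_cell_borel [measurable]: "grid_cell h k \<in> sets borel"
proof -
  have "grid_cell h k = (\<Inter>i\<in>UNIV. {x \<in> space borel. \<lfloor>x $ i / h\<rfloor> = k $ i})"
    by (auto simp: grid_cell_def)
  also have "\<dots> \<in> sets borel"
    by (intro sets.finite_INT) (auto intro!: measurable_sets_borel)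
  finally show ?thesis .
qed

lemma grid_cell_bounds:
  assumes "h > 0"
  shows "box (\<chi> i. h * real_of_int (k $ i)) (\<chi> i. h * (real_of_int (k $ i) + 1)) \<subseteq> grid_cell h k"
    and "grid_cell h k \<subseteq> cbox (\<chi> i. h * real_of_int (k $ i)) (\<chi> i. h * (real_of_int (k $ i) + 1))"
  using assms by (auto simp: grid_cell_def mem_box_cart floor_eq_iff field_simps less_imp_le)

text \<open>The cell lies between an open and a closed box of equal measure.\<close>

lemma emeasure_grid_cell:
  fixes k :: "int^'n"
  assumes "h > 0"
  shows "emeasure lborel (grid_cell h k) = ennreal (h ^ CARD('n))"
proof -
  let ?l = "\<chi> i. h * k $ i" and ?u = "\<chi> i. h * (real_of_int (k $ i) + 1)"
  have d: "?u - ?l = (\<chi> i. h)" by (simp add: vec_eq_iff algebra_simps)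
  have le: "?l \<bullet> b \<le> ?u \<bullet> b" and pr: "(?u - ?l) \<bullet> b = h" if "b \<in> Basis" for b :: "real^'n"
    using that assms unfolding d by (auto simp: Basis_vec_def inner_axis' algebra_simps inner_axis)
  have "emeasure lborel (box ?l ?u) = ennreal (h ^ CARD('n))" "emeasure lborel (cbox ?l ?u) = ennreal (h ^ CARD('n))"
    using le pr by (simp_all add: emeasure_lborel_box_eq emeasure_lborel_cbox_eq)
  then show ?thesis
    using emeasure_mono[OF grid_cell_bounds(1)[OF assms, of k], of lborel]
      emeasure_mono[OF grid_cell_bounds(2)[OF assms, of k], of lborel]
    by (intro antisym) simp_all
qed

lemma grid_cell_diff:
  assumes "h > 0" "x \<in> grid_cell h k" "y \<in> grid_cell h k"
  shows "y - x \<in> cbox (\<chi> i. -h) (\<chi> i. h)"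
  unfolding mem_box_cart
proof
  fix i
  have "x \<in> cbox (\<chi> i. h * real_of_int (k $ i)) (\<chi> i. h * (real_of_int (k $ i) + 1))" "y \<in> cbox (\<chi> i. h * real_of_int (k $ i)) (\<chi> i. h * (real_of_int (k $ i) + 1))"
    using grid_cell_bounds(2)[OF assms(1)] assms by blast+
  then have "h * real_of_int (k $ i) \<le> x $ i" "x $ i \<le> h * (real_of_int (k $ i) + 1)" "h * real_of_int (k $ i) \<le> y $ i" "y $ i \<le> h * (real_of_int (k $ i) + 1)"
    by (auto simp: mem_box_cart)
  then show "(\<chi> i. -h) $ i \<le> (y - x) $ i \<and> (y - x) $ i \<le> (\<chi> i. h) $ i"
    by (simp add: algebra_simps)
qed

lemma finite_grid_key:
  assumes "h > 0"
  shows "finite (grid_key h ` cball (0::real^'n) R)"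
proof -
  define M where "M = \<lceil>R / h\<rceil> + 1"
  have "grid_key h ` cball (0::real^'n) R \<subseteq> vec_lambda ` (PiE UNIV (\<lambda>_. {-M..M}))"
  proof
    fix k assume "k \<in> grid_key h ` cball (0::real^'n) R"
    then obtain x where x: "norm x \<le> R" "k = grid_key h x" by auto
    have "k $ i \<in> {-M..M}" for i
    proof -
      have "\<bar>x $ i\<bar> \<le> R" using component_le_norm_cart[of x i] x by linarith
      moreover define q where "q = x $ i / h"
      ultimately have "\<bar>q\<bar> \<le> R / h" using assms by (simp add: divide_right_mono)
      moreover have "k $ i = \<lfloor>q\<rfloor>" using x(2) by (simp add: grid_key_def q_def)
      ultimately show ?thesis unfolding M_def atLeastAtMost_iff by linarith
    qed
    then show "k \<in> vec_lambda ` (PiE UNIV (\<lambda>_. {-M..M}))"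
      by (intro image_eqI[of _ _ "\<lambda>i. k $ i"]) auto
  qed
  then show ?thesis by (rule finite_subset) (intro finite_imageI finite_PiE; simp)
qed

lemma nn_integral_lborel_translate:
  fixes f :: "'a::euclidean_space \<Rightarrow> ennreal"
  assumes "f \<in> borel_measurable borel"
  shows "(\<integral>\<^sup>+y. f y \<partial>lborel) = (\<integral>\<^sup>+z. f (x + z) \<partial>lborel)"
proof -
  have "(\<integral>\<^sup>+y. f y \<partial>lborel) = (\<integral>\<^sup>+y. f y \<partial>distr lborel borel ((+) x))"
    by (simp only: lborel_distr_plus)
  also have "\<dots> = (\<integral>\<^sup>+z. f (x + z) \<partial>lborel)"
    using assms by (intro nn_integral_distr) measurable
  finally show ?thesis .
qed

text \<open>The Poincare inequality on the cells of a grid: averaging \<open>(f x - f y)\<^sup>2\<close> over the pairs in a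
  cell gives the variance, and the substitution \<open>y = x + z\<close> turns it into translation differences.\<close>

lemma grid_variance_bound:
  fixes f :: "real^'n \<Rightarrow> real"
  assumes h: "h > 0" and f: "continuous_on UNIV f" and bd: "bounded K" and f0: "\<And>x. x \<notin> K \<Longrightarrow> f x = 0"
    and I: "finite I" "\<And>x. x \<in> K \<Longrightarrow> grid_key h x \<in> I"
    and E: "\<And>z. z \<in> cbox (\<chi> i. -h) (\<chi> i. h) \<Longrightarrow> (LINT x|lborel. (f (x + z) - f x)\<^sup>2) \<le> E"
      "\<And>z. integrable lborel (\<lambda>x. (f (x + z) - f x)\<^sup>2)"
  shows "(LINT x|lborel. (f x)\<^sup>2) \<le> (\<Sum>k\<in>I. (1 / h ^ CARD('n)) * (LINT x|lborel. indicator (grid_cell h k) x * f x)\<^sup>2)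
     + 2 ^ CARD('n) / 2 * E"
proof -
  define m where "m = h ^ CARD('n)"
  have m: "m > 0" using h by (simp add: m_def)
  define B where "B = (cbox (\<chi> i. -h) (\<chi> i. h) :: (real^'n) set)"
  have fm [measurable]: "f \<in> borel_measurable borel" using f by (rule borel_measurable_continuous_onI)
  have f1: "integrable lborel f" by (rule integrable_lborel_compact_support[OF f bd f0])
  have f2: "integrable lborel (\<lambda>x. (f x)\<^sup>2)"
    by (rule integrable_lborel_compact_support[OF _ bd]) (auto simp: f0 intro!: continuous_intros f)
  let ?Q = "grid_cell h :: int^'n \<Rightarrow> (real^'n) set"
  have Q1: "integrable lborel (indicator (?Q k) :: _ \<Rightarrow> real)" for k
    by (rule integrable_real_indicator) (use emeasure_grid_cell[OF h, of k] in simp_all)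
  have Qm: "(LINT x|lborel. indicator (?Q k) x) = m" for k
    using emeasure_grid_cell[OF h, of k] m by (simp add: measure_def m_def)
  have Qf: "integrable lborel (\<lambda>x. indicator (?Q k) x * f x)" "integrable lborel (\<lambda>x. indicator (?Q k) x * (f x)\<^sup>2)" for k
    using integrable_mult_indicator[OF _ f1, of "?Q k"] integrable_mult_indicator[OF _ f2, of "?Q k"] by simp_all
  define a where "a k = (LINT x|lborel. indicator (?Q k) x * f x)" for k
  define s where "s k = (LINT x|lborel. indicator (?Q k) x * (f x)\<^sup>2)" for k
  have expand: "indicator (?Q k) y * (f x - f y)\<^sup>2 = (f x)\<^sup>2 * indicator (?Q k) y - 2 * f x * (indicator (?Q k) y * f y)
     + indicator (?Q k) y * (f y)\<^sup>2" for k x y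
    by (simp add: power2_diff algebra_simps)
  have inner_int: "integrable lborel (\<lambda>y. indicator (?Q k) y * (f x - f y)\<^sup>2)" for k x
    unfolding expand by (intro Bochner_Integration.integrable_add Bochner_Integration.integrable_diff integrable_mult_right Q1 Qf)
  have inner_eq: "(LINT y|lborel. indicator (?Q k) y * (f x - f y)\<^sup>2) = (f x)\<^sup>2 * m - 2 * f x * a k + s k" for k x
    unfolding expand using Q1 Qf by (simp add: Qm a_def s_def del: Bochner_Integration.integral_indicator)
  have inner: "(\<integral>\<^sup>+y. ennreal (indicator (?Q k) y * (f x - f y)\<^sup>2) \<partial>lborel) = ennreal ((f x)\<^sup>2 * m - 2 * f x * a k + s k)" for k x
    unfolding inner_eq[symmetric] using inner_int by (intro nn_integral_eq_integral) auto
  \<comment> \<open>Integrated over pairs in a cell of measure m, the squares contribute m s twice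
    and the mixed term twice the square of the cell integral a.\<close>
  have J: "(\<integral>\<^sup>+x. \<integral>\<^sup>+y. ennreal (indicator (?Q k) x * (indicator (?Q k) y * (f x - f y)\<^sup>2)) \<partial>lborel \<partial>lborel)
      = ennreal (2 * m * s k - 2 * (a k)\<^sup>2)" for k
  proof -
    have pos: "(f x)\<^sup>2 * m - 2 * f x * a k + s k \<ge> 0" for x
      unfolding inner_eq[symmetric] by (intro integral_nonneg_AE) auto
    have eq: "indicator (?Q k) x * ((f x)\<^sup>2 * m - 2 * f x * a k + s k)
        = m * (indicator (?Q k) x * (f x)\<^sup>2) - 2 * a k * (indicator (?Q k) x * f x) + s k * indicator (?Q k) x" for x
      by (simp add: algebra_simps)
    have int: "integrable lborel (\<lambda>x. indicator (?Q k) x * ((f x)\<^sup>2 * m - 2 * f x * a k + s k))"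
      unfolding eq by (intro Bochner_Integration.integrable_add Bochner_Integration.integrable_diff integrable_mult_right Q1 Qf)
    have "(\<integral>\<^sup>+y. ennreal (indicator (?Q k) x * (indicator (?Q k) y * (f x - f y)\<^sup>2)) \<partial>lborel)
        = ennreal (indicator (?Q k) x * ((f x)\<^sup>2 * m - 2 * f x * a k + s k))" for x
      using inner[of k x] by (cases "x \<in> ?Q k") simp_all
    then have "(\<integral>\<^sup>+x. \<integral>\<^sup>+y. ennreal (indicator (?Q k) x * (indicator (?Q k) y * (f x - f y)\<^sup>2)) \<partial>lborel \<partial>lborel)
      = (\<integral>\<^sup>+x. ennreal (indicator (?Q k) x * ((f x)\<^sup>2 * m - 2 * f x * a k + s k)) \<partial>lborel)" by simp
    also have "\<dots> = ennreal (LINT x|lborel. indicator (?Q k) x * ((f x)\<^sup>2 * m - 2 * f x * a k + s k))"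
      using int pos by (intro nn_integral_eq_integral) auto
    also have "(LINT x|lborel. indicator (?Q k) x * ((f x)\<^sup>2 * m - 2 * f x * a k + s k)) = m * s k - 2 * a k * a k + s k * m"
      unfolding eq using Q1 Qf by (simp add: Qm a_def[symmetric] s_def[symmetric] del: Bochner_Integration.integral_indicator)
    also have "\<dots> = 2 * m * s k - 2 * (a k)\<^sup>2" by (simp add: power2_eq_square)
    finally show ?thesis .
  qed
  have s_a: "0 \<le> 2 * m * s k - 2 * (a k)\<^sup>2" for k
  proof -
    let ?w = "\<lambda>x. indicator (?Q k) x * (m * f x - a k)\<^sup>2 :: real"
    have eq: "?w x = m\<^sup>2 * (indicator (?Q k) x * (f x)\<^sup>2) - 2 * m * a k * (indicator (?Q k) x * f x) + (a k)\<^sup>2 * indicator (?Q k) x" for x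
      by (simp add: power2_diff algebra_simps)
    have "0 \<le> integral\<^sup>L lborel ?w" by (intro integral_nonneg_AE) auto
    also have "integral\<^sup>L lborel ?w = m\<^sup>2 * s k - 2 * m * a k * a k + (a k)\<^sup>2 * m"
      unfolding eq using Q1 Qf by (simp add: Qm a_def[symmetric] s_def[symmetric] del: Bochner_Integration.integral_indicator)
    also have "\<dots> = m * (m * s k - (a k)\<^sup>2)" by (simp add: power2_eq_square algebra_simps)
    finally show ?thesis using m by (simp add: zero_le_mult_iff)
  qed
  have E0: "E \<ge> 0"
  proof -
    have "0 \<in> cbox (\<chi> i. -h) ((\<chi> i. h) :: real^'n)" using h by (simp add: mem_box_cart)
    from E(1)[OF this] show ?thesis by simp
  qed
  \<comment> \<open>At most one summand is nonzero, the one for the cell of \<open>x\<close>. Two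
    points of the same cell differ by a vector of \<open>B\<close>.\<close>
  have cell: "(\<Sum>k\<in>I. ennreal (indicator (?Q k) x * (indicator (?Q k) y * (f x - f y)\<^sup>2)))
      \<le> ennreal (indicator B (y - x) * (f x - f y)\<^sup>2)" for x y
  proof -
    have "(\<Sum>k\<in>I. ennreal (indicator (?Q k) x * (indicator (?Q k) y * (f x - f y)\<^sup>2)))
       = (\<Sum>k\<in>I. if k = grid_key h x then ennreal (indicator (?Q k) y * (f x - f y)\<^sup>2) else 0)"
      by (intro sum.cong) (auto simp: grid_cell_iff indicator_def)
    also have "\<dots> \<le> ennreal (indicator (?Q (grid_key h x)) y * (f x - f y)\<^sup>2)"
      using I(1) by (simp add: sum.delta')
    also have "\<dots> \<le> ennreal (indicator B (y - x) * (f x - f y)\<^sup>2)"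
      using grid_cell_diff[OF h, of x "grid_key h x" y]
      by (intro ennreal_leI mult_right_mono) (auto simp: indicator_def B_def grid_cell_iff)
    finally show ?thesis .
  qed
  have Bm [measurable]: "B \<in> sets borel" by (simp add: B_def)
  \<comment> \<open>The cube of differences has side 2 h; the resulting 2^n, divided by the 2 in
    front of the variance, gives the constant in the claim.\<close>
  have measB: "emeasure lborel B = ennreal (2 ^ CARD('n) * m)"
  proof -
    have d: "(\<chi> i. h) - (\<chi> i. -h) = (\<chi> i. 2 * h :: real^'n)" by (simp add: vec_eq_iff)
    have "((\<chi> i. h) - (\<chi> i. -h)) \<bullet> b = 2 * h" "(\<chi> i. -h) \<bullet> b \<le> (\<chi> i. h) \<bullet> b" if "b \<in> Basis" for b :: "real^'n"
      using that h unfolding d by (auto simp: Basis_vec_def inner_axis)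
    then show ?thesis by (simp add: B_def emeasure_lborel_cbox_eq m_def power_mult_distrib)
  qed
  have "ennreal (\<Sum>k\<in>I. 2 * m * s k - 2 * (a k)\<^sup>2) = (\<Sum>k\<in>I. ennreal (2 * m * s k - 2 * (a k)\<^sup>2))"
    using s_a by (simp add: sum_ennreal)
  also have "\<dots> = (\<integral>\<^sup>+x. \<integral>\<^sup>+y. (\<Sum>k\<in>I. ennreal (indicator (?Q k) x * (indicator (?Q k) y * (f x - f y)\<^sup>2))) \<partial>lborel \<partial>lborel)"
    unfolding J[symmetric] by (simp add: nn_integral_sum del: sum_ennreal)
  also have "\<dots> \<le> (\<integral>\<^sup>+x. \<integral>\<^sup>+y. ennreal (indicator B (y - x) * (f x - f y)\<^sup>2) \<partial>lborel \<partial>lborel)"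
    by (intro nn_integral_mono cell)
  also have "\<dots> = (\<integral>\<^sup>+x. \<integral>\<^sup>+z. ennreal (indicator B z * (f x - f (x + z))\<^sup>2) \<partial>lborel \<partial>lborel)"
  proof (rule nn_integral_cong)
    fix x
    show "(\<integral>\<^sup>+y. ennreal (indicator B (y - x) * (f x - f y)\<^sup>2) \<partial>lborel) = (\<integral>\<^sup>+z. ennreal (indicator B z * (f x - f (x + z))\<^sup>2) \<partial>lborel)"
      by (subst nn_integral_lborel_translate[of _ x]) simp_all
  qed
  \<comment> \<open>After the exchange, the inner integral for fixed z in \<open>B\<close> is a
    translation difference, bounded by \<open>E\<close>.\<close>
  also have "\<dots> = (\<integral>\<^sup>+z. \<integral>\<^sup>+x. ennreal (indicator B z * (f x - f (x + z))\<^sup>2) \<partial>lborel \<partial>lborel)"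
    by (rule lborel_pair.Fubini'[symmetric]) measurable
  also have "\<dots> \<le> (\<integral>\<^sup>+z. ennreal E * indicator B z \<partial>lborel)"
  proof (rule nn_integral_mono)
    fix z
    show "(\<integral>\<^sup>+x. ennreal (indicator B z * (f x - f (x + z))\<^sup>2) \<partial>lborel) \<le> ennreal E * indicator B z"
    proof (cases "z \<in> B")
      case True
      have "(\<integral>\<^sup>+x. ennreal ((f (x + z) - f x)\<^sup>2) \<partial>lborel) = ennreal (LINT x|lborel. (f (x + z) - f x)\<^sup>2)"
        using E(2)[of z] by (intro nn_integral_eq_integral) auto
      also have "\<dots> \<le> ennreal E" using E(1)[of z] True by (intro ennreal_leI) (simp add: B_def)
      finally show ?thesis using True by (simp add: power2_commute)
    qed simp
  qed
  also have "\<dots> = ennreal E * emeasure lborel B" by (simp add: nn_integral_cmult_indicator)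
  also have "\<dots> = ennreal (E * (2 ^ CARD('n) * m))" using E0 m by (simp add: measB ennreal_mult)
  finally have "(\<Sum>k\<in>I. 2 * m * s k - 2 * (a k)\<^sup>2) \<le> E * (2 ^ CARD('n) * m)"
    using E0 m by (simp add: ennreal_le_iff)
  then have main: "2 * m * (\<Sum>k\<in>I. s k) - 2 * (\<Sum>k\<in>I. (a k)\<^sup>2) \<le> E * (2 ^ CARD('n) * m)"
    by (simp add: sum_subtractf sum_distrib_left)
  have cover: "(\<Sum>k\<in>I. indicator (?Q k) x * (f x)\<^sup>2) = (f x)\<^sup>2" for x
  proof -
    have "(\<Sum>k\<in>I. indicator (?Q k) x * (f x)\<^sup>2) = (\<Sum>k\<in>I. if k = grid_key h x then (f x)\<^sup>2 else 0)"
      by (intro sum.cong) (auto simp: grid_cell_iff indicator_def)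
    also have "\<dots> = (f x)\<^sup>2" using I(1) I(2)[of x] f0[of x] by (cases "x \<in> K") (auto simp: sum.delta')
    finally show ?thesis .
  qed
  have "(\<Sum>k\<in>I. s k) = (LINT x|lborel. (\<Sum>k\<in>I. indicator (?Q k) x * (f x)\<^sup>2))"
    unfolding s_def using Qf by (subst Bochner_Integration.integral_sum) auto
  also have "\<dots> = (LINT x|lborel. (f x)\<^sup>2)" unfolding cover ..
  finally have "2 * m * (LINT x|lborel. (f x)\<^sup>2) \<le> 2 * (\<Sum>k\<in>I. (a k)\<^sup>2) + E * (2 ^ CARD('n) * m)"
    using main by simp
  then have "(LINT x|lborel. (f x)\<^sup>2) \<le> (1 / m) * (\<Sum>k\<in>I. (a k)\<^sup>2) + 2 ^ CARD('n) / 2 * E"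
    using m by (simp add: field_simps)
  then show ?thesis by (simp add: a_def m_def sum_distrib_left)
qed

lemma finite_family_convergent_subsequence:
  fixes a :: "'i \<Rightarrow> nat \<Rightarrow> real"
  assumes "finite I" "\<And>k. k \<in> I \<Longrightarrow> bounded (range (a k))"
  shows "\<exists>r. strict_mono r \<and> (\<forall>k\<in>I. convergent (\<lambda>i. a k (r i)))"
  using assms
proof (induction I rule: finite_induct)
  case empty
  show ?case by (intro exI[of _ id]) (simp add: strict_mono_def)
next
  case (insert j I)
  then obtain r where r: "strict_mono r" "\<forall>k\<in>I. convergent (\<lambda>i. a k (r i))" by auto
  have "bounded (range (\<lambda>i. a j (r i)))"
    using insert(4)[of j] by (rule bounded_subset) auto
  then obtain l q where q: "strict_mono q" "((\<lambda>i. a j (r i)) \<circ> q) \<longlonglongrightarrow> l"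
    using bounded_imp_convergent_subsequence by metis
  have "convergent (\<lambda>i. a k ((r \<circ> q) i))" if "k \<in> insert j I" for k
  proof (cases "k = j")
    case True
    then show ?thesis using q(2) by (auto simp: convergent_def o_def)
  next
    case False
    then have "convergent (\<lambda>i. a k (r i))" using that r by auto
    from convergent_subseq_convergent[OF this q(1)] show ?thesis by (simp add: o_def)
  qed
  then show ?case using strict_mono_o[OF r(1) q(1)] by blast
qed

context
  fixes D :: "(real^'n) set"
  assumes open_D: "open D" and bounded_D: "bounded D"
begin

lemma indicator_grid_cell_L2: "(indicator (grid_cell h k) :: real^'n \<Rightarrow> real) \<in> L2 D"
proof -
  have m: "(indicator (grid_cell h k) :: real^'n \<Rightarrow> real) \<in> borel_measurable (lebesgue_on D)"
    by (intro measurable_restrict_space1 measurable_completion) simp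
  have "(\<lambda>x. (indicator (grid_cell h k) x :: real) *\<^sub>R (1::real)) \<in> L2 D"
    by (rule L2_bounded_mult[OF L2_const[OF open_D bounded_D] m, of 1]) (auto simp: indicator_def)
  then show ?thesis by (simp add: indicator_def[abs_def] cong: if_cong)
qed

text \<open>Finitely many linear functionals, the integrals over grid cells, control the L^2 norm up
  to a gradient term that is small for fine grids. The bound is shown for test functions and
  extended by density; a vector in the cube of differences has length at most n h.\<close>

lemma H10_grid_estimate:
  assumes h: "h > 0"
  obtains I where "finite I" "\<And>u. u \<in> H10 D \<Longrightarrow> L2_inner D u u \<le>
    (\<Sum>k\<in>I. (1 / h ^ CARD('n)) * (L2_inner D u (indicator (grid_cell h k)))\<^sup>2)
     + 2 ^ CARD('n) / 2 * ((real CARD('n) * h)\<^sup>2 * grad_inner D u u)"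
proof -
  obtain R where R: "\<forall>x\<in>D. norm x \<le> R" using bounded_D unfolding bounded_iff by blast
  define I where "I = grid_key h ` cball (0::real^'n) R"
  have I: "finite I" unfolding I_def by (rule finite_grid_key[OF h])
  have D: "D \<in> sets lebesgue" using open_D by simp
  have test: "L2_inner D \<phi> \<phi> \<le> (\<Sum>k\<in>I. (1 / h ^ CARD('n)) * (L2_inner D \<phi> (indicator (grid_cell h k)))\<^sup>2)
     + 2 ^ CARD('n) / 2 * ((real CARD('n) * h)\<^sup>2 * grad_inner D \<phi> \<phi>)" if phi: "\<phi> \<in> test_functions D" for \<phi>
  proof -
    obtain K where SC: "smooth_compact \<phi> (classical_grad \<phi>) K" "K \<subseteq> D" by (rule test_smooth_compact[OF phi])
    interpret smooth_compact \<phi> "classical_grad \<phi>" K by (rule SC)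
    have L2: "(LINT x|lborel. (\<phi> x)\<^sup>2) = L2_inner D \<phi> \<phi>"
      unfolding L2_inner_def using F0 SC(2)
      by (subst integral_lebesgue_on_lborel(1)[OF D]) (auto simp: power2_eq_square)
    have grad: "(LINT x|lborel. (norm (classical_grad \<phi> x))\<^sup>2) = grad_inner D \<phi> \<phi>"
    proof -
      have "(LINT x|lborel. (norm (classical_grad \<phi> x))\<^sup>2) = L2_inner D (classical_grad \<phi>) (classical_grad \<phi>)"
        unfolding L2_inner_def using g0 SC(2)
        by (subst integral_lebesgue_on_lborel(1)[OF D]) (auto simp: dot_square_norm)
      also have "\<dots> = grad_inner D \<phi> \<phi>"
        unfolding grad_inner_def
        using test_function_H1[OF open_D bounded_D phi] test_function_L2(2)[OF open_D bounded_D phi]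
          H1D(2)[OF open_D bounded_D test_function_H1(1)[OF open_D bounded_D phi]]
        by (intro L2_inner_cong_AE) (auto intro: L2D(1) elim: eventually_mono)
      finally show ?thesis .
    qed
    have cell: "(LINT x|lborel. indicator (grid_cell h k) x * \<phi> x) = L2_inner D \<phi> (indicator (grid_cell h k))" for k
      unfolding L2_inner_def using F0 SC(2)
      by (subst integral_lebesgue_on_lborel(1)[OF D]) (auto simp: mult.commute)
    have "(LINT x|lborel. (\<phi> x)\<^sup>2) \<le> (\<Sum>k\<in>I. (1 / h ^ CARD('n)) * (LINT x|lborel. indicator (grid_cell h k) x * \<phi> x)\<^sup>2)
      + 2 ^ CARD('n) / 2 * ((real CARD('n) * h)\<^sup>2 * (LINT x|lborel. (norm (classical_grad \<phi> x))\<^sup>2))"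
    proof (rule grid_variance_bound[OF h F_cont compact_imp_bounded[OF K] F0 I])
      show "grid_key h x \<in> I" if "x \<in> K" for x using that SC(2) R by (auto simp: I_def)
      show "integrable lborel (\<lambda>x. (\<phi> (x + z) - \<phi> x)\<^sup>2)" for z using diff_square_integrable[of z 0] by simp
      fix z :: "real^'n" assume "z \<in> cbox (\<chi> i. - h) (\<chi> i. h)"
      then have z: "\<bar>z $ i\<bar> \<le> h" for i by (auto simp: mem_box_cart abs_le_iff minus_le_iff)
      have "norm z \<le> (\<Sum>i\<in>UNIV. \<bar>z $ i\<bar>)" by (rule norm_le_l1_cart)
      also have "\<dots> \<le> real CARD('n) * h" using sum_bounded_above[of UNIV "\<lambda>i. \<bar>z $ i\<bar>" h] z by simp
      finally have "(norm z)\<^sup>2 \<le> (real CARD('n) * h)\<^sup>2" by (intro power_mono) auto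
      then have "(norm z)\<^sup>2 * (LINT x|lborel. (norm (classical_grad \<phi> x))\<^sup>2) \<le> (real CARD('n) * h)\<^sup>2 * (LINT x|lborel. (norm (classical_grad \<phi> x))\<^sup>2)"
        by (intro mult_right_mono integral_nonneg_AE) auto
      with translate_diff_square_le_norm[of z]
      show "(LINT x|lborel. (\<phi> (x + z) - \<phi> x)\<^sup>2) \<le> (real CARD('n) * h)\<^sup>2 * (LINT x|lborel. (norm (classical_grad \<phi> x))\<^sup>2)"
        by linarith
    qed
    then show ?thesis unfolding L2 grad cell .
  qed
  note ind = indicator_grid_cell_L2
  show thesis
  proof (rule that[OF I])
    fix u assume u: "u \<in> H10 D"
    obtain \<phi> where uH: "u \<in> H1 D" and phi: "\<And>k. \<phi> k \<in> test_functions D"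
      and lim: "(\<lambda>k. H1_inner D (\<phi> k - u) (\<phi> k - u)) \<longlonglongrightarrow> 0"
      using u unfolding H10_iff[OF open_D bounded_D] by blast
    have phiH: "\<phi> k \<in> H1 D" for k using test_function_H1(1)[OF open_D bounded_D phi] .
    note limL = H1_tendsto_D(2)[OF open_D bounded_D lim] and limG = H1_tendsto_D(1)[OF open_D bounded_D lim]
    note sL = symbil_L2_H1[OF open_D bounded_D] and sG = symbil_grad_H1[OF open_D bounded_D]
    have 1: "(\<lambda>k. L2_inner D (\<phi> k) (\<phi> k)) \<longlonglongrightarrow> L2_inner D u u"
      by (rule symbil_tendsto(1)[where B = "L2_inner D", OF sL _ phiH uH limL]) (rule L2_inner_nonneg)
    have 2: "(\<lambda>k. grad_inner D (\<phi> k) (\<phi> k)) \<longlonglongrightarrow> grad_inner D u u"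
      by (rule symbil_tendsto(1)[where B = "grad_inner D", OF sG _ phiH uH limG]) (rule grad_inner_nonneg)
    have 3: "(\<lambda>j. L2_inner D (\<phi> j) (indicator (grid_cell h k))) \<longlonglongrightarrow> L2_inner D u (indicator (grid_cell h k))" for k
      by (rule symbil_tendsto(2)[where B = "L2_inner D", OF symbil_L2_inner _ H1D(1)[OF open_D bounded_D phiH] H1D(1)[OF open_D bounded_D uH] limL ind])
        (rule L2_inner_nonneg)
    show "L2_inner D u u \<le> (\<Sum>k\<in>I. (1 / h ^ CARD('n)) * (L2_inner D u (indicator (grid_cell h k)))\<^sup>2)
     + 2 ^ CARD('n) / 2 * ((real CARD('n) * h)\<^sup>2 * grad_inner D u u)"
      by (rule LIMSEQ_le[OF 1 tendsto_add[OF tendsto_sum[OF tendsto_mult_left[OF tendsto_power[OF 3]]]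
              tendsto_mult_left[OF tendsto_mult_left[OF 2]]]])
        (use test[OF phi] in blast)
  qed
qed

text \<open>For each tolerance a fine grid leaves only finitely many bounded scalar sequences, which
  have a common convergent subsequence. A diagonal sequence then serves all tolerances 1 / (n +
  1).\<close>

lemma H10_precompact:
  assumes X: "\<And>n::nat. X n \<in> H10 D" and K: "\<And>n. grad_inner D (X n) (X n) + L2_inner D (X n) (X n) \<le> K"
  shows "\<exists>r::nat \<Rightarrow> nat. strict_mono r \<and> (\<forall>e>0. \<exists>N. \<forall>m\<ge>N. \<forall>n\<ge>N.
     L2_inner D (X (r m) - X (r n)) (X (r m) - X (r n)) < e)"
proof -
  define P where "P n s \<longleftrightarrow> (\<exists>N. \<forall>i\<ge>N. \<forall>j\<ge>N. L2_inner D (X (s i) - X (s j)) (X (s i) - X (s j)) < 1 / real (Suc n))"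
    for n :: nat and s :: "nat \<Rightarrow> nat"
  note sL = symbil_H10(2)[OF open_D bounded_D] and sG = symbil_H10(3)[OF open_D bounded_D]
  note XH = H10_D[OF open_D bounded_D X]
  note XL = H1D(1)[OF open_D bounded_D XH]
  have K0: "K \<ge> 0" using K[of 0] grad_inner_nonneg[of D "X 0"] L2_inner_nonneg[of D "X 0"] by linarith
  have GX: "grad_inner D (X n) (X n) \<le> K" and LX: "L2_inner D (X n) (X n) \<le> K" for n
    using K[of n] grad_inner_nonneg[of D "X n"] L2_inner_nonneg[of D "X n"] by linarith+
  have G4: "grad_inner D (X i - X j) (X i - X j) \<le> 4 * K" for i j
  proof -
    have "grad_inner D (X i + X j) (X i + X j) \<ge> 0" by (rule grad_inner_nonneg)
    then have "grad_inner D (X i - X j) (X i - X j) \<le> 2 * grad_inner D (X i) (X i) + 2 * grad_inner D (X j) (X j)"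
      using X symbil_sym[OF sG X X, of i j] by (simp add: symbil_simps[OF sG])
    then show ?thesis using GX[of i] GX[of j] by linarith
  qed
  interpret subseqs P
  proof
    fix n :: nat and s :: "nat \<Rightarrow> nat" assume "strict_mono s"
    \<comment> \<open>The gradient term of the grid estimate for a difference is at most c h^2,
      where 4 K bounds the squared gradient norm. The mesh \<open>h\<close> makes it half of the
      tolerance; the two sums T i and T j take a quarter each. The summand 1 keeps \<open>c\<close>
      positive.\<close>
    define c where "c = 2 ^ CARD('n) / 2 * ((real CARD('n))\<^sup>2 * (4 * K)) + 1"
    have c: "c \<ge> 1" using K0 by (simp add: c_def)
    define h where "h = sqrt (1 / (2 * c * real (Suc n)))"
    have h: "h > 0" using c by (simp add: h_def)
    have "h\<^sup>2 = 1 / (2 * c * real (Suc n))" unfolding h_def using c by (intro real_sqrt_pow2) simp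
    then have h2: "c * h\<^sup>2 = 1 / (2 * real (Suc n))" using c by simp
    obtain I where I: "finite I" and est: "\<And>u. u \<in> H10 D \<Longrightarrow> L2_inner D u u \<le>
      (\<Sum>k\<in>I. (1 / h ^ CARD('n)) * (L2_inner D u (indicator (grid_cell h k)))\<^sup>2)
       + 2 ^ CARD('n) / 2 * ((real CARD('n) * h)\<^sup>2 * grad_inner D u u)"
      by (rule H10_grid_estimate[OF h]) blast
    define g where "g k = (indicator (grid_cell h k) :: real^'n \<Rightarrow> real)" for k
    note est = est[folded g_def]
    define a where "a k i = L2_inner D (X (s i)) (g k)" for k i
    have ind: "g k \<in> L2 D" for k
      unfolding g_def by (rule indicator_grid_cell_L2)
    have "bounded (range (a k))" for k
      unfolding bounded_iff
    proof (intro exI ballI)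
      fix y assume "y \<in> range (a k)"
      then obtain i where i: "y = a k i" by auto
      have "\<bar>a k i\<bar> \<le> sqrt (L2_inner D (X (s i)) (X (s i))) * sqrt (L2_inner D (g k) (g k))"
        unfolding a_def by (rule symbil_Cauchy_Schwarz_sqrt[OF symbil_L2_inner L2_inner_nonneg XL ind])
      also have "\<dots> \<le> sqrt K * sqrt (L2_inner D (g k) (g k))"
        by (intro mult_right_mono real_sqrt_le_mono LX) (simp add: L2_inner_nonneg)
      finally show "norm y \<le> sqrt K * sqrt (L2_inner D (g k) (g k))" by (simp add: i)
    qed
    then obtain r where r: "strict_mono r" "\<forall>k\<in>I. convergent (\<lambda>i. a k (r i))"
      using finite_family_convergent_subsequence[OF I, of a] by blast
    then have "\<forall>k\<in>I. \<exists>l. (\<lambda>i. a k (r i)) \<longlonglongrightarrow> l" by (simp add: convergent_def)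
    then obtain l where l: "\<And>k. k \<in> I \<Longrightarrow> (\<lambda>i. a k (r i)) \<longlonglongrightarrow> l k" by metis
    define T where "T i = (\<Sum>k\<in>I. (1 / h ^ CARD('n)) * (2 * (a k (r i) - l k)\<^sup>2))" for i
    have "T \<longlonglongrightarrow> (\<Sum>k\<in>I. (1 / h ^ CARD('n)) * (2 * (l k - l k)\<^sup>2))"
      unfolding T_def using l by (intro tendsto_sum tendsto_mult tendsto_const tendsto_power tendsto_diff)
    then have "T \<longlonglongrightarrow> 0" by simp
    then have "\<forall>\<^sub>F i in sequentially. T i < 1 / (4 * real (Suc n))"
      by (rule order_tendstoD) simp
    then obtain N where N: "\<And>i. i \<ge> N \<Longrightarrow> T i < 1 / (4 * real (Suc n))" by (auto simp: eventually_sequentially)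
    have "L2_inner D (X (s (r i)) - X (s (r j))) (X (s (r i)) - X (s (r j))) < 1 / real (Suc n)" if "i \<ge> N" "j \<ge> N" for i j
    proof -
      let ?d = "X (s (r i)) - X (s (r j))"
      have "L2_inner D ?d ?d \<le> (\<Sum>k\<in>I. (1 / h ^ CARD('n)) * (L2_inner D ?d (g k))\<^sup>2)
         + 2 ^ CARD('n) / 2 * ((real CARD('n) * h)\<^sup>2 * grad_inner D ?d ?d)"
        by (rule est[OF symbil_mem(2)[OF sL X X]])
      also have "(\<Sum>k\<in>I. (1 / h ^ CARD('n)) * (L2_inner D ?d (g k))\<^sup>2) \<le> T i + T j"
        unfolding T_def sum.distrib[symmetric]
      proof (rule sum_mono)
        fix k
        have "L2_inner D ?d (g k) = (a k (r i) - l k) - (a k (r j) - l k)"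
          unfolding a_def using symbil_diff_left[OF symbil_L2_inner XL XL ind] by simp
        moreover have "(x - y)\<^sup>2 \<le> 2 * x\<^sup>2 + 2 * y\<^sup>2" for x y :: real
          using zero_le_power2[of "x + y"] by (simp add: power2_sum power2_diff)
        from this[of "a k (r i) - l k" "a k (r j) - l k"] calculation
        have "(L2_inner D ?d (g k))\<^sup>2 \<le> 2 * (a k (r i) - l k)\<^sup>2 + 2 * (a k (r j) - l k)\<^sup>2" by (simp only:)
        then show "(1 / h ^ CARD('n)) * (L2_inner D ?d (g k))\<^sup>2 \<le>
           (1 / h ^ CARD('n)) * (2 * (a k (r i) - l k)\<^sup>2) + (1 / h ^ CARD('n)) * (2 * (a k (r j) - l k)\<^sup>2)"
          unfolding distrib_left[symmetric] using h by (intro mult_left_mono) auto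
      qed
      also have "2 ^ CARD('n) / 2 * ((real CARD('n) * h)\<^sup>2 * grad_inner D ?d ?d) \<le> 2 ^ CARD('n) / 2 * ((real CARD('n) * h)\<^sup>2 * (4 * K))"
        by (intro mult_left_mono G4) auto
      also have "\<dots> \<le> c * h\<^sup>2" by (simp add: c_def power_mult_distrib algebra_simps)
      finally have "L2_inner D ?d ?d \<le> T i + T j + 1 / (2 * real (Suc n))" using h2 by simp
      also have "\<dots> < 1 / (4 * real (Suc n)) + 1 / (4 * real (Suc n)) + 1 / (2 * real (Suc n))"
        using N[OF that(1)] N[OF that(2)] by linarith
      also have "\<dots> = 1 / real (Suc n)"
      proof -
        have "1 / (4 * x) + 1 / (4 * x) + 1 / (2 * x) = 1 / x" if "x > 0" for x :: real
          using that by (simp add: field_simps)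
        from this[of "real (Suc n)"] show ?thesis by (simp only: of_nat_0_less_iff zero_less_Suc)
      qed
      finally show ?thesis .
    qed
    then show "\<exists>r'. strict_mono r' \<and> P n (s \<circ> r')"
      using r(1) unfolding P_def by (intro exI[of _ r]) auto
  qed
  \<comment> \<open>The property concerns tails and thus passes to subsequences, as the diagonal
    construction requires.\<close>
  have stable: "P n (s \<circ> r)" if "strict_mono r" "P n s" for r s n
    using that unfolding P_def o_def by (meson le_trans seq_suble)
  have "\<exists>N. \<forall>m\<ge>N. \<forall>n\<ge>N. L2_inner D (X (diagseq m) - X (diagseq n)) (X (diagseq m) - X (diagseq n)) < e" if e: "e > 0" for e
  proof -
    obtain k where k: "1 / real (Suc k) < e" using e reals_Archimedean[of e] by (auto simp: inverse_eq_divide)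
    have "P k (diagseq \<circ> ((+) (Suc k)))" by (rule diagseq_holds[OF stable])
    then obtain N where N: "\<And>i j. i \<ge> N \<Longrightarrow> j \<ge> N \<Longrightarrow>
       L2_inner D (X (diagseq (Suc k + i)) - X (diagseq (Suc k + j))) (X (diagseq (Suc k + i)) - X (diagseq (Suc k + j))) < 1 / real (Suc k)"
      unfolding P_def o_def by blast
    show ?thesis
    proof (intro exI[of _ "Suc k + N"] allI impI)
      fix m n assume "Suc k + N \<le> m" "Suc k + N \<le> n"
      then have "m = Suc k + (m - Suc k)" "n = Suc k + (n - Suc k)" "N \<le> m - Suc k" "N \<le> n - Suc k" by auto
      with N[of "m - Suc k" "n - Suc k"] k
      show "L2_inner D (X (diagseq m) - X (diagseq n)) (X (diagseq m) - X (diagseq n)) < e" by simp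
    qed
  qed
  then show ?thesis using subseq_diagseq by blast
qed

lemma compact_pair_H10: "compact_pair (H10 D) (grad_inner D) (L2_inner D)"
proof (rule compact_pair.intro)
  show "symbil (H10 D) (grad_inner D)" "symbil (H10 D) (L2_inner D)"
    by (rule symbil_H10[OF open_D bounded_D])+
  show "0 \<le> grad_inner D v v" "0 \<le> L2_inner D v v" for v
    by (rule grad_inner_nonneg L2_inner_nonneg)+
next
  fix X :: "nat \<Rightarrow> real^'n \<Rightarrow> real"
  assume X: "\<And>n. X n \<in> H10 D"
  { assume "\<And>e. e > 0 \<Longrightarrow> \<exists>N. \<forall>m\<ge>N. \<forall>n\<ge>N. grad_inner D (X m - X n) (X m - X n) + L2_inner D (X m - X n) (X m - X n) < e"
    then show "\<exists>x\<in>H10 D. (\<lambda>n. grad_inner D (X n - x) (X n - x) + L2_inner D (X n - x) (X n - x)) \<longlonglongrightarrow> 0"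
      by (rule H10_complete[OF open_D bounded_D X]) }
  fix K assume "\<And>n. grad_inner D (X n) (X n) + L2_inner D (X n) (X n) \<le> K"
  then show "\<exists>r::nat \<Rightarrow> nat. strict_mono r \<and> (\<forall>e>0. \<exists>N. \<forall>m\<ge>N. \<forall>n\<ge>N.
     L2_inner D (X (r m) - X (r n)) (X (r m) - X (r n)) < e)"
    by (rule H10_precompact[OF X])
qed

end

section \<open>Weighted forms and essentially bounded coefficients\<close>

definition weighted_inner :: "(real^'n) set \<Rightarrow> (real^'n \<Rightarrow> real) \<Rightarrow> (real^'n \<Rightarrow> 'b::euclidean_space) \<Rightarrow> (real^'n \<Rightarrow> 'b) \<Rightarrow> real" where
  "weighted_inner D a f g = L2_inner D (\<lambda>x. a x *\<^sub>R f x) g"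

text \<open>The bound \<open>K\<close> is explicit so that it can serve as a constant in estimates.
  Its sign is recorded because on a null set the almost-everywhere bound would hold for negative
  \<open>K\<close> too.\<close>

definition bounded_coeff :: "(real^'n) set \<Rightarrow> real \<Rightarrow> (real^'n \<Rightarrow> real) \<Rightarrow> bool" where
  "bounded_coeff D K a \<longleftrightarrow> a \<in> borel_measurable (lebesgue_on D) \<and> (AE x in lebesgue_on D. \<bar>a x\<bar> \<le> K) \<and> K \<ge> 0"

lemma A_form_eq: "A_form D a b w v = weighted_inner D a (weak_grad D w) (weak_grad D v) + weighted_inner D b w v"
  by (simp add: A_form_def weighted_inner_def L2_inner_def)

lemma M_form_eq: "M_form D c w v = weighted_inner D c w v"
  by (simp add: M_form_def weighted_inner_def L2_inner_def)

context
  fixes D :: "(real^'n) set" and K a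
  assumes a: "bounded_coeff D K a"
begin

lemma weighted_L2: "f \<in> L2 D \<Longrightarrow> (\<lambda>x. a x *\<^sub>R f x) \<in> L2 D"
  using a by (auto simp: bounded_coeff_def intro: L2_bounded_mult)

lemma symbil_weighted: "symbil (L2 D :: (real^'n \<Rightarrow> 'b::euclidean_space) set) (weighted_inner D a)"
  unfolding symbil_def
proof (intro conjI ballI allI subspace_L2)
  fix f g h :: "real^'n \<Rightarrow> 'b" and c assume f: "f \<in> L2 D"
  have int: "integrable (lebesgue_on D) (\<lambda>x. a x * (p x \<bullet> q x))" if "p \<in> L2 D" "q \<in> L2 D" for p q :: "real^'n \<Rightarrow> 'b"
    using L2_inner_integrable[OF weighted_L2[OF that(1)] that(2)] by simp
  show "weighted_inner D a (c *\<^sub>R f) h = c * weighted_inner D a f h"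
    unfolding weighted_inner_def L2_inner_def integral_mult_right_zero[symmetric]
    by (intro Bochner_Integration.integral_cong) auto
  assume g: "g \<in> L2 D"
  show "weighted_inner D a f g = weighted_inner D a g f"
    by (simp add: weighted_inner_def L2_inner_def inner_commute)
  assume h: "h \<in> L2 D"
  show "weighted_inner D a (f + g) h = weighted_inner D a f h + weighted_inner D a g h"
    using int[OF f h] int[OF g h] by (simp add: weighted_inner_def L2_inner_def inner_add_left distrib_left)
qed

lemma weighted_le:
  assumes f: "f \<in> L2 D" and g: "g \<in> L2 D"
  shows "\<bar>weighted_inner D a f g\<bar> \<le> K * (sqrt (L2_inner D f f) * sqrt (L2_inner D g g))"
proof -
  have K: "K \<ge> 0" using a by (simp add: bounded_coeff_def)
  have "L2_inner D (\<lambda>x. a x *\<^sub>R f x) (\<lambda>x. a x *\<^sub>R f x) \<le> K\<^sup>2 * L2_inner D f f"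
  proof -
    have "L2_inner D (\<lambda>x. a x *\<^sub>R f x) (\<lambda>x. a x *\<^sub>R f x) \<le> (LINT x|lebesgue_on D. K\<^sup>2 * (f x \<bullet> f x))"
      unfolding L2_inner_def
    proof (rule integral_mono_AE)
      show "integrable (lebesgue_on D) (\<lambda>x. (a x *\<^sub>R f x) \<bullet> (a x *\<^sub>R f x))"
        by (intro L2_inner_integrable weighted_L2 f)
      show "integrable (lebesgue_on D) (\<lambda>x. K\<^sup>2 * (f x \<bullet> f x))"
        using L2_inner_integrable[OF f f] by simp
      have "AE x in lebesgue_on D. \<bar>a x\<bar> \<le> K" using a by (simp add: bounded_coeff_def)
      then show "AE x in lebesgue_on D. (a x *\<^sub>R f x) \<bullet> (a x *\<^sub>R f x) \<le> K\<^sup>2 * (f x \<bullet> f x)"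
      proof eventually_elim
        case (elim x)
        then have "(a x)\<^sup>2 \<le> K\<^sup>2" using power_mono[of "\<bar>a x\<bar>" K 2] by simp
        then have "(a x)\<^sup>2 * (f x \<bullet> f x) \<le> K\<^sup>2 * (f x \<bullet> f x)" by (intro mult_right_mono) auto
        then show ?case by (simp add: power2_eq_square)
      qed
    qed
    then show ?thesis by (simp add: L2_inner_def)
  qed
  then have "sqrt (L2_inner D (\<lambda>x. a x *\<^sub>R f x) (\<lambda>x. a x *\<^sub>R f x)) \<le> K * sqrt (L2_inner D f f)"
    using K real_sqrt_le_mono by (fastforce simp: real_sqrt_mult)
  then have "sqrt (L2_inner D (\<lambda>x. a x *\<^sub>R f x) (\<lambda>x. a x *\<^sub>R f x)) * sqrt (L2_inner D g g) \<le> K * sqrt (L2_inner D f f) * sqrt (L2_inner D g g)"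
    by (intro mult_right_mono) (auto simp: L2_inner_nonneg)
  then show ?thesis
    using symbil_Cauchy_Schwarz_sqrt[OF symbil_L2_inner L2_inner_nonneg weighted_L2[OF f] g]
    unfolding weighted_inner_def by (simp add: mult.assoc)
qed

lemma weighted_square_le: "f \<in> L2 D \<Longrightarrow> weighted_inner D a f f \<le> K * L2_inner D f f"
  using weighted_le[of f f] by (simp add: L2_inner_nonneg)

lemma weighted_square_ge:
  assumes f: "f \<in> L2 D" and k: "AE x in lebesgue_on D. k \<le> a x"
  shows "k * L2_inner D f f \<le> weighted_inner D a f f"
proof -
  have "(LINT x|lebesgue_on D. k * (f x \<bullet> f x)) \<le> (LINT x|lebesgue_on D. (a x *\<^sub>R f x) \<bullet> f x)"
  proof (rule integral_mono_AE)
    show "integrable (lebesgue_on D) (\<lambda>x. (a x *\<^sub>R f x) \<bullet> f x)" by (intro L2_inner_integrable weighted_L2 f)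
    show "integrable (lebesgue_on D) (\<lambda>x. k * (f x \<bullet> f x))" using L2_inner_integrable[OF f f] by simp
    show "AE x in lebesgue_on D. k * (f x \<bullet> f x) \<le> (a x *\<^sub>R f x) \<bullet> f x"
      using k by eventually_elim (simp add: mult_right_mono)
  qed
  then show ?thesis by (simp add: weighted_inner_def L2_inner_def)
qed

end

context
  fixes D :: "(real^'n) set"
  assumes open_D: "open D" and bounded_D: "bounded D"
begin

lemma symbil_weighted_grad:
  assumes a: "bounded_coeff D K a"
  shows "symbil (H1 D) (\<lambda>u v. weighted_inner D a (weak_grad D u) (weak_grad D v))"
  unfolding symbil_def
proof (intro conjI ballI allI subspace_H1[OF open_D bounded_D])
  note S = symbil_weighted[OF a, where 'b = "real^'n"]
  note wL = H1D(2)[OF open_D bounded_D]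
  have cong: "weighted_inner D a f h = weighted_inner D a g h"
    if "f \<in> L2 D" "g \<in> L2 D" "h \<in> L2 D" "AE x in lebesgue_on D. f x = g x" for f g h :: "real^'n \<Rightarrow> real^'n"
    unfolding weighted_inner_def
    using that weighted_L2[OF a] by (intro L2_inner_cong_AE) (auto intro: L2D(1) elim: eventually_mono)
  fix u v w c assume u: "u \<in> H1 D" and w: "w \<in> H1 D"
  note mu = wL[OF u] and mw = wL[OF w]
  show "weighted_inner D a (weak_grad D (c *\<^sub>R u)) (weak_grad D w) = c * weighted_inner D a (weak_grad D u) (weak_grad D w)"
    by (rule trans[OF cong[OF wL[OF H1_scale(1)[OF open_D bounded_D u]] symbil_mem(3)[OF S mu] mw H1_scale(2)[OF open_D bounded_D u]]
      symbil_scale_left[OF S mu mw]])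
  assume v: "v \<in> H1 D"
  note mv = wL[OF v]
  show "weighted_inner D a (weak_grad D u) (weak_grad D v) = weighted_inner D a (weak_grad D v) (weak_grad D u)"
    by (rule symbil_sym[OF S mu mv])
  show "weighted_inner D a (weak_grad D (u + v)) (weak_grad D w) =
     weighted_inner D a (weak_grad D u) (weak_grad D w) + weighted_inner D a (weak_grad D v) (weak_grad D w)"
    by (rule trans[OF cong[OF wL[OF H1_add(1)[OF open_D bounded_D u v]] symbil_mem(1)[OF S mu mv] mw H1_add(2)[OF open_D bounded_D u v]]
      symbil_add_left[OF S mu mv mw]])
qed

lemma symbil_A_form:
  assumes "bounded_coeff D K a" "bounded_coeff D K' b"
  shows "symbil (H10 D) (A_form D a b)"
proof -
  have "symbil (H1 D) (weighted_inner D b)"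
    using symbil_subset[OF symbil_weighted[OF assms(2)] subspace_H1[OF open_D bounded_D]] H1D(1)[OF open_D bounded_D] by blast
  from symbil_lincomb[OF symbil_weighted_grad[OF assms(1)] this, of 1 1]
  have "symbil (H1 D) (A_form D a b)"
    by (simp add: A_form_eq[abs_def] del: A_form_eq)
  then show ?thesis
    using symbil_subset[OF _ subspace_H10[OF open_D bounded_D]] H10_D[OF open_D bounded_D] by blast
qed

lemma symbil_M_form:
  assumes "bounded_coeff D K c"
  shows "symbil (H10 D) (M_form D c)"
proof -
  have "H10 D \<subseteq> L2 D" using H10_D[OF open_D bounded_D] H1D(1)[OF open_D bounded_D] by blast
  from symbil_subset[OF symbil_weighted[OF assms] subspace_H10[OF open_D bounded_D] this]
  show ?thesis by (simp add: M_form_eq[abs_def])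
qed

lemma A_form_le:
  assumes a: "bounded_coeff D Ka a" and b: "bounded_coeff D Kb b" and w: "w \<in> H10 D" and v: "v \<in> H10 D"
  shows "\<bar>A_form D a b w v\<bar> \<le> Ka * (sqrt (grad_inner D w w) * sqrt (grad_inner D v v))
     + Kb * (sqrt (L2_inner D w w) * sqrt (L2_inner D v v))"
proof -
  note wv = H1D(1,2)[OF open_D bounded_D H10_D[OF open_D bounded_D w]] H1D(1,2)[OF open_D bounded_D H10_D[OF open_D bounded_D v]]
  show ?thesis
    using weighted_le[OF a wv(2,4)] weighted_le[OF b wv(1,3)] unfolding A_form_eq grad_inner_def by linarith
qed

lemma M_form_le:
  assumes c: "bounded_coeff D K c" and w: "w \<in> H10 D" and v: "v \<in> H10 D"
  shows "\<bar>M_form D c w v\<bar> \<le> K * (sqrt (L2_inner D w w) * sqrt (L2_inner D v v))"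
  using weighted_le[OF c] w v H1D(1)[OF open_D bounded_D H10_D[OF open_D bounded_D]] unfolding M_form_eq by blast

lemma A_form_square:
  assumes a: "bounded_coeff D K a" and b: "bounded_coeff D K b" and v: "v \<in> H10 D"
    and ka: "AE x in lebesgue_on D. k \<le> a x" and kb: "AE x in lebesgue_on D. 0 \<le> b x"
  shows "k * grad_inner D v v \<le> A_form D a b v v" "A_form D a b v v \<le> K * (grad_inner D v v + L2_inner D v v)"
proof -
  note vL = H1D(1,2)[OF open_D bounded_D H10_D[OF open_D bounded_D v]]
  show "k * grad_inner D v v \<le> A_form D a b v v"
    using weighted_square_ge[OF a vL(2) ka] weighted_square_ge[OF b vL(1) kb] unfolding A_form_eq grad_inner_def by linarith
  show "A_form D a b v v \<le> K * (grad_inner D v v + L2_inner D v v)"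
    using weighted_square_le[OF a vL(2)] weighted_square_le[OF b vL(1)] unfolding A_form_eq grad_inner_def distrib_left by linarith
qed

lemma M_form_square:
  assumes c: "bounded_coeff D K c" and v: "v \<in> H10 D" and k: "AE x in lebesgue_on D. k \<le> c x"
  shows "k * L2_inner D v v \<le> M_form D c v v" "M_form D c v v \<le> K * L2_inner D v v"
  using weighted_square_ge[OF c _ k] weighted_square_le[OF c] H1D(1)[OF open_D bounded_D H10_D[OF open_D bounded_D v]]
  unfolding M_form_eq by blast+

lemma L2_inner_zero_iff:
  assumes "f \<in> L2 D"
  shows "L2_inner D f f = 0 \<longleftrightarrow> (AE x in lebesgue_on D. f x = 0)"
  unfolding L2_inner_def using L2_inner_integrable[OF assms assms] by (subst integral_nonneg_eq_0_iff_AE) auto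

end

text \<open>The coefficients depend affinely on one parameter only almost everywhere, since their
  series converge only off a null set; the integrals do not see the difference.\<close>

lemma A_form_affine:
  assumes a: "bounded_coeff D Ka a" "bounded_coeff D Kc a'" and b: "bounded_coeff D Kb b" "bounded_coeff D Kd b'"
    and H: "open D" "bounded D" "w \<in> H10 D" "v \<in> H10 D"
    and p: "p \<in> borel_measurable (lebesgue_on D)" "q \<in> borel_measurable (lebesgue_on D)"
    and eqa: "AE x in lebesgue_on D. p x = a x + t * a' x" and eqb: "AE x in lebesgue_on D. q x = b x + t * b' x"
  shows "A_form D p q w v = A_form D a b w v + t * A_form D a' b' w v"
proof -
  have *: "weighted_inner D p f g = weighted_inner D a f g + t * weighted_inner D a' f g"
    if "bounded_coeff D Ka a" "bounded_coeff D Kc a'" "f \<in> L2 D" "g \<in> L2 D" "p \<in> borel_measurable (lebesgue_on D)"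
      "AE x in lebesgue_on D. p x = a x + t * a' x"
    for Ka Kc a a' p and f g :: "real^'a \<Rightarrow> 'b::euclidean_space"
  proof -
    have "weighted_inner D p f g = (LINT x|lebesgue_on D. (a x *\<^sub>R f x) \<bullet> g x + t * ((a' x *\<^sub>R f x) \<bullet> g x))"
      unfolding weighted_inner_def L2_inner_def
    proof (rule integral_cong_AE)
      show "AE x in lebesgue_on D. (p x *\<^sub>R f x) \<bullet> g x = (a x *\<^sub>R f x) \<bullet> g x + t * ((a' x *\<^sub>R f x) \<bullet> g x)"
        using that(6) by eventually_elim (simp add: algebra_simps)
    qed (use that in \<open>auto simp: L2_def bounded_coeff_def\<close>)
    also have "\<dots> = weighted_inner D a f g + t * weighted_inner D a' f g"
      unfolding weighted_inner_def L2_inner_def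
      using L2_inner_integrable[OF weighted_L2[OF that(1,3)] that(4)] L2_inner_integrable[OF weighted_L2[OF that(2,3)] that(4)]
      by simp
    finally show ?thesis .
  qed
  note wv = H1D(1,2)[OF H(1,2) H10_D[OF H(1,2,3)]] H1D(1,2)[OF H(1,2) H10_D[OF H(1,2,4)]]
  show ?thesis
    unfolding A_form_eq *[OF a wv(2,4) p(1) eqa] *[OF b wv(1,3) p(2) eqb] by (simp add: algebra_simps)
qed

section \<open>Affine coefficients\<close>

text \<open>A nonempty open set is not null, so contradictory almost-everywhere bounds on
  \<open>D\<close> are refutable.\<close>

lemma AE_lebesgue_on_False:
  assumes "open D" "D \<noteq> {}"
  shows "\<not> (AE x in lebesgue_on D. False)"
proof
  assume "AE x in lebesgue_on D. False"
  then have "AE x in lebesgue. x \<notin> D" using assms(1) by (simp add: AE_lebesgue_on_iff)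
  then have "D \<in> null_sets lebesgue" using assms(1) by (subst AE_iff_null_sets) auto
  then show False using assms open_not_negligible negligible_iff_null_sets by blast
qed

lemma Linf_AE_le:
  assumes "f \<in> Linf D"
  shows "AE x in lebesgue_on D. norm (f x) \<le> Linf_norm D f"
proof -
  have fin: "esssup (lebesgue_on D) (\<lambda>x. ereal (norm (f x))) < \<infinity>" using assms by (simp add: Linf_def)
  have "AE x in lebesgue_on D. ereal (norm (f x)) \<le> esssup (lebesgue_on D) (\<lambda>x. ereal (norm (f x)))" by (rule esssup_AE)
  then show ?thesis
    by eventually_elim (use fin in \<open>cases "esssup (lebesgue_on D) (\<lambda>x. ereal (norm (f x)))"; auto simp: Linf_norm_def\<close>)
qed

lemma Linf_norm_le:
  assumes "f \<in> borel_measurable (lebesgue_on D)" "AE x in lebesgue_on D. norm (f x) \<le> C" "C \<ge> 0"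
  shows "f \<in> Linf D" "Linf_norm D f \<le> C"
proof -
  have le: "esssup (lebesgue_on D) (\<lambda>x. ereal (norm (f x))) \<le> ereal C"
    using assms by (intro esssup_I) auto
  then show "f \<in> Linf D" using assms(1) by (auto simp: Linf_def intro: le_less_trans)
  show "Linf_norm D f \<le> C" unfolding Linf_norm_def
    using le assms(3) by (cases "esssup (lebesgue_on D) (\<lambda>x. ereal (norm (f x)))") auto
qed

lemma Linf_norm_nonneg:
  assumes "f \<in> Linf D" "open D" "D \<noteq> {}"
  shows "Linf_norm D f \<ge> 0"
proof (rule ccontr)
  assume neg: "\<not> Linf_norm D f \<ge> 0"
  have "AE x in lebesgue_on D. False"
    using Linf_AE_le[OF assms(1)]
  proof eventually_elim
    case (elim x)
    then show False using neg norm_ge_zero[of "f x"] by linarith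
  qed
  then show False using AE_lebesgue_on_False assms by blast
qed

lemma Linf_bounded_coeff:
  assumes "f \<in> Linf D" "open D" "D \<noteq> {}"
  shows "bounded_coeff D (Linf_norm D f) f"
  using Linf_AE_le[OF assms(1)] Linf_norm_nonneg[OF assms] assms(1)
  by (simp add: bounded_coeff_def Linf_def)

context
  fixes D :: "(real^'n) set" and f0 :: "real^'n \<Rightarrow> real" and f :: "nat \<Rightarrow> real^'n \<Rightarrow> real"
  assumes D: "open D" "D \<noteq> {}"
    and f0: "f0 \<in> Linf D" and f: "\<And>j. f j \<in> Linf D" and summ: "summable (\<lambda>j. Linf_norm D (f j))"
begin

text \<open>Each coefficient obeys its norm bound off its own null set; the countable union of these
  sets is null, and elsewhere the norms majorise the series.\<close>

lemma affine_summable: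
  assumes y: "y \<in> param_box"
  shows "AE x in lebesgue_on D. summable (\<lambda>j. y j * f j x) \<and> \<bar>\<Sum>j. y j * f j x\<bar> \<le> (\<Sum>j. Linf_norm D (f j))"
proof -
  have "AE x in lebesgue_on D. \<forall>j. norm (f j x) \<le> Linf_norm D (f j)"
    using Linf_AE_le[OF f] by (simp add: AE_all_countable)
  then show ?thesis
  proof eventually_elim
    case (elim x)
    have le: "norm (y j * f j x) \<le> Linf_norm D (f j)" for j
    proof -
      have "\<bar>y j\<bar> \<le> 1" using y unfolding param_box_def by (auto simp: abs_le_iff dest!: spec[of _ j])
      then have "\<bar>y j\<bar> * \<bar>f j x\<bar> \<le> 1 * Linf_norm D (f j)"
        using elim by (intro mult_mono) auto
      then show ?thesis by (simp add: abs_mult)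
    qed
    have s: "summable (\<lambda>j. norm (y j * f j x))" by (rule summable_comparison_test'[OF summ]) (use le in simp)
    have "\<bar>\<Sum>j. y j * f j x\<bar> \<le> (\<Sum>j. norm (y j * f j x))" using summable_norm[OF s] by simp
    also have "\<dots> \<le> (\<Sum>j. Linf_norm D (f j))" by (intro suminf_le le s summ)
    finally show ?case using summable_norm_cancel[OF s] by simp
  qed
qed

lemma affine_measurable: "affine_coeff f0 f y \<in> borel_measurable (lebesgue_on D)"
  unfolding affine_coeff_def[abs_def]
  using f0 f by (intro borel_measurable_add borel_measurable_suminf borel_measurable_times) (auto simp: Linf_def)

lemma affine_Linf:
  assumes y: "y \<in> param_box"
  shows "affine_coeff f0 f y \<in> Linf D" "Linf_norm D (affine_coeff f0 f y) \<le> Linf_norm D f0 + (\<Sum>j. Linf_norm D (f j))"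
proof -
  have AE: "AE x in lebesgue_on D. norm (affine_coeff f0 f y x) \<le> Linf_norm D f0 + (\<Sum>j. Linf_norm D (f j))"
    using Linf_AE_le[OF f0] affine_summable[OF y]
    by eventually_elim (auto simp: affine_coeff_def)
  have nn: "Linf_norm D f0 + (\<Sum>j. Linf_norm D (f j)) \<ge> 0"
    using Linf_norm_nonneg[OF f0 D] Linf_norm_nonneg[OF f D] by (intro add_nonneg_nonneg suminf_nonneg summ)
  show "affine_coeff f0 f y \<in> Linf D" "Linf_norm D (affine_coeff f0 f y) \<le> Linf_norm D f0 + (\<Sum>j. Linf_norm D (f j))"
    by (rule Linf_norm_le[OF affine_measurable AE nn])+
qed

lemma affine_bounded_coeff:
  assumes y: "y \<in> param_box" and K: "(SUP y\<in>param_box. Linf_norm D (affine_coeff f0 f y)) \<le> K"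
  shows "bounded_coeff D K (affine_coeff f0 f y)"
proof -
  have "bdd_above ((\<lambda>y. Linf_norm D (affine_coeff f0 f y)) ` param_box)"
    using affine_Linf(2) by (intro bdd_aboveI2)
  then have "Linf_norm D (affine_coeff f0 f y) \<le> K"
    using cSUP_upper[OF y] K by (meson order_trans)
  then show ?thesis
    using Linf_bounded_coeff[OF affine_Linf(1)[OF y] D] by (auto simp: bounded_coeff_def elim: eventually_mono)
qed

text \<open>The two series differ in a single term.\<close>

lemma affine_update:
  assumes y: "y \<in> param_box"
  shows "AE x in lebesgue_on D. affine_coeff f0 f (y(j := t)) x = affine_coeff f0 f y x + (t - y j) * f j x"
  using affine_summable[OF y]
proof eventually_elim
  case (elim x)
  have eq: "(\<lambda>i. (y(j := t)) i * f i x) = (\<lambda>i. y i * f i x + (if i = j then (t - y j) * f j x else 0))"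
    by (auto simp: fun_eq_iff algebra_simps)
  have s: "(\<lambda>i. if i = j then (t - y j) * f j x else 0) sums ((t - y j) * f j x)"
    using sums_If_finite_set[of "{j}" "\<lambda>_. (t - y j) * f j x"] by simp
  have "(\<lambda>i. (y(j := t)) i * f i x) sums ((\<Sum>i. y i * f i x) + (t - y j) * f j x)"
    unfolding eq using elim by (intro sums_add s summable_sums) simp
  then show ?case by (simp add: affine_coeff_def sums_iff)
qed

end

text \<open>The terms are eventually at most 1, where g \<le> g^p because p < 1.\<close>

lemma summable_of_powr:
  fixes g :: "nat \<Rightarrow> real"
  assumes p: "p \<in> {0<..<1}" and g: "\<And>j. g j \<ge> 0" and s: "summable (\<lambda>j. g j powr p)"
  shows "summable g"
proof (rule summable_comparison_test_ev[OF _ s])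
  have "(\<lambda>j. g j powr p) \<longlonglongrightarrow> 0" by (rule summable_LIMSEQ_zero[OF s])
  then have "\<forall>\<^sub>F j in sequentially. g j powr p < 1" by (rule order_tendstoD) simp
  then show "\<forall>\<^sub>F j in sequentially. norm (g j) \<le> g j powr p"
  proof eventually_elim
    case (elim j)
    have "g j \<le> 1"
    proof (rule ccontr)
      assume "\<not> g j \<le> 1"
      then have "1 \<le> g j powr p" using p by (intro ge_one_powr_ge_zero) auto
      then show False using elim by simp
    qed
    show ?case
    proof (cases "g j = 0")
      case False
      then have "g j powr 1 \<le> g j powr p" using g[of j] \<open>g j \<le> 1\<close> p by (intro powr_mono') auto
      then show ?thesis using g[of j] False by simp
    qed simp
  qed
qed

section \<open>The two smallest eigenvalues\<close>

text \<open>A common lower bound \<kappa> for the two positive coefficients and a common upper bound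
  K for all three mirror \<open>amin\<close> and \<open>amax\<close>. With both bounds equal to 1
  the setting includes the Dirichlet Laplacian.\<close>

locale elliptic =
  fixes D :: "(real^'n) set" and p q c :: "real^'n \<Rightarrow> real" and \<kappa> K :: real
  assumes open_D: "open D" and bounded_D: "bounded D" and kappa: "\<kappa> > 0"
    and p: "bounded_coeff D K p" "AE x in lebesgue_on D. \<kappa> \<le> p x"
    and q: "bounded_coeff D K q" "AE x in lebesgue_on D. 0 \<le> q x"
    and c: "bounded_coeff D K c" "AE x in lebesgue_on D. \<kappa> \<le> c x"
begin

abbreviation A where "A \<equiv> A_form D p q"
abbreviation M where "M \<equiv> M_form D c"
abbreviation G where "G \<equiv> grad_inner D"
abbreviation L where "L \<equiv> L2_inner D"

lemmas sA = symbil_A_form[OF open_D bounded_D p(1) q(1)]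
lemmas sM = symbil_M_form[OF open_D bounded_D c(1)]
lemmas mem = symbil_mem[OF sM]
lemmas A_ge = A_form_square(1)[OF open_D bounded_D p(1) q(1) _ p(2) q(2)]
lemmas A_le = A_form_square(2)[OF open_D bounded_D p(1) q(1) _ p(2) q(2)]
lemmas M_ge = M_form_square(1)[OF open_D bounded_D c(1) _ c(2)]
lemmas M_le = M_form_square(2)[OF open_D bounded_D c(1) _ c(2)]

lemma H10_L2: "v \<in> H10 D \<Longrightarrow> v \<in> L2 D"
  using H1D(1)[OF open_D bounded_D] H10_D[OF open_D bounded_D] by blast

lemma A_nonneg: "v \<in> H10 D \<Longrightarrow> A v v \<ge> 0"
  using A_ge[of v] kappa grad_inner_nonneg[of D v] by (meson mult_nonneg_nonneg less_imp_le order_trans)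

lemma M_nonneg: "v \<in> H10 D \<Longrightarrow> M v v \<ge> 0"
  using M_ge[of v] kappa L2_inner_nonneg[of D v] by (meson mult_nonneg_nonneg less_imp_le order_trans)

lemma M_zero_iff:
  assumes "v \<in> H10 D"
  shows "M v v = 0 \<longleftrightarrow> (AE x in lebesgue_on D. v x = 0)"
proof -
  have "M v v = 0 \<longleftrightarrow> L v v = 0"
    using M_ge[OF assms] M_le[OF assms] kappa L2_inner_nonneg[of D v]
    by (metis M_nonneg[OF assms] mult_zero_right mult_le_0_iff order_antisym not_le)
  then show ?thesis using L2_inner_zero_iff[OF open_D bounded_D H10_L2[OF assms]] by simp
qed

lemma minimiser:
  assumes "u0 \<in> H10 D" "v0 \<in> H10 D" "M v0 u0 = 0" "M v0 v0 > 0"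
  shows "\<exists>e \<mu>. e \<in> H10 D \<and> M e u0 = 0 \<and> M e e = 1 \<and>
    (\<forall>v\<in>H10 D. M v u0 = 0 \<longrightarrow> \<mu> * M v v \<le> A v v) \<and> (\<forall>v\<in>H10 D. M v u0 = 0 \<longrightarrow> A e v = \<mu> * M e v)"
proof (rule compact_pair.exists_minimiser[where V = "H10 D" and G = G and L = L and A = A and M = M and \<kappa> = \<kappa> and K = K, OF compact_pair_H10[OF open_D bounded_D] sA sM kappa A_ge A_le M_ge M_le assms])
  fix e \<mu>
  assume "e \<in> H10 D" "M e u0 = 0" "M e e = 1"
    "\<And>v. v \<in> H10 D \<Longrightarrow> M v u0 = 0 \<Longrightarrow> \<mu> * M v v \<le> A v v"
    "\<And>v. v \<in> H10 D \<Longrightarrow> M v u0 = 0 \<Longrightarrow> A e v = \<mu> * M e v"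
  then show ?thesis by (intro exI[of _ e] exI[of _ \<mu>] conjI ballI impI)
qed

context
  fixes l :: "nat \<Rightarrow> real"
  assumes l: "eigenvalues_with_multiplicity D A M l"
begin

text \<open>A number missing from the list would have multiplicity 0, so its eigenspace would
  contain only functions vanishing almost everywhere. This locates the multipliers of minimisers in
  the list.\<close>

lemma eigenvalue_in_list:
  assumes e: "e \<in> eigenspace D A M \<mu>" "M e e \<noteq> 0"
  shows "\<exists>k\<ge>1. l k = \<mu>"
proof (rule ccontr)
  assume "\<not> (\<exists>k\<ge>1. l k = \<mu>)"
  then have "{k\<in>{1..}. l k = \<mu>} = {}" by auto
  then have "has_dim_ae D (eigenspace D A M \<mu>) 0"
    using l unfolding eigenvalues_with_multiplicity_def by (metis card.empty)
  then have "AE x in lebesgue_on D. e x = 0" using e(1) by (auto simp: has_dim_ae_def)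
  then show False using e M_zero_iff[of e] by (auto simp: eigenspace_def)
qed

lemma eigenvector_exists:
  assumes "k \<ge> 1"
  shows "\<exists>e\<in>eigenspace D A M (l k). M e e > 0"
proof -
  define S where "S = {j\<in>{1..}. l j = l k}"
  have S: "finite S" "has_dim_ae D (eigenspace D A M (l k)) (card S)"
    using l unfolding eigenvalues_with_multiplicity_def S_def by blast+
  have "k \<in> S" using assms by (simp add: S_def)
  then have cS: "0 < card S" using S(1) by (auto simp: card_gt_0_iff)
  obtain e where e: "\<And>i. i < card S \<Longrightarrow> e i \<in> eigenspace D A M (l k)"
    "\<And>t. (AE x in lebesgue_on D. (\<Sum>i<card S. t i * e i x) = 0) \<Longrightarrow> (\<forall>i<card S. t i = 0)"
    using S(2) unfolding has_dim_ae_def by blast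
  have sum: "(\<Sum>i<card S. (if i = 0 then 1 else 0) * e i x) = e 0 x" for x
  proof -
    have "(\<Sum>i<card S. (if i = 0 then 1 else 0) * e i x) = (\<Sum>i<card S. if i = 0 then e i x else 0)"
      by (intro sum.cong) auto
    then show ?thesis using cS by (simp add: sum.delta)
  qed
  have "\<not> (AE x in lebesgue_on D. e 0 x = 0)"
  proof
    assume "AE x in lebesgue_on D. e 0 x = 0"
    then have "\<forall>i<card S. (if i = 0 then 1 else 0) = (0::real)"
      using e(2)[of "\<lambda>i. if i = 0 then 1 else 0"] unfolding sum by blast
    then have "(if 0 = (0::nat) then 1 else 0) = (0::real)" using cS by blast
    then show False by simp
  qed
  moreover have "e 0 \<in> H10 D" using e(1)[OF cS] by (simp add: eigenspace_def)
  ultimately have "M (e 0) (e 0) > 0" using M_zero_iff M_nonneg by (metis less_eq_real_def)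
  then show ?thesis using e(1)[OF cS] by blast
qed

text \<open>The unconstrained minimiser is an eigenvector, and its multiplier, being in the
  increasing list, is at least \<open>l 1\<close>.\<close>

lemma first_eigenvalue_min:
  assumes v: "v \<in> H10 D"
  shows "l 1 * M v v \<le> A v v"
proof (cases "M v v = 0")
  case True
  then show ?thesis using A_nonneg[OF v] by simp
next
  case False
  then have "M v v > 0" using M_nonneg[OF v] by simp
  moreover have "M w 0 = 0" if "w \<in> H10 D" for w using symbil_zero(2)[OF sM that] .
  ultimately obtain e \<mu> where e: "e \<in> H10 D" "M e e = 1"
    "\<And>w. w \<in> H10 D \<Longrightarrow> \<mu> * M w w \<le> A w w" "\<And>w. w \<in> H10 D \<Longrightarrow> A e w = \<mu> * M e w"
    using minimiser[OF mem(4) v] v by metis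
  have "e \<in> eigenspace D A M \<mu>" using e by (simp add: eigenspace_def)
  then obtain k where k: "k \<ge> 1" "l k = \<mu>" using eigenvalue_in_list e(2) by fastforce
  then have "l 1 \<le> \<mu>" using l unfolding eigenvalues_with_multiplicity_def mono_on_def by fastforce
  then have "l 1 * M v v \<le> \<mu> * M v v" using M_nonneg[OF v] by (rule mult_right_mono)
  then show ?thesis using e(3)[OF v] by linarith
qed

text \<open>The minimiser orthogonal to \<open>u\<close> is an eigenvector. Because
  \<open>l 1 < l 2\<close> makes the first eigenvalue simple, its multiplier cannot be
  \<open>l 1\<close> and is therefore at least \<open>l 2\<close>.\<close>

lemma second_eigenvalue_min:
  assumes u: "u \<in> eigenspace D A M (l 1)" "M u u = 1" and gap: "l 1 < l 2"
    and v: "v \<in> H10 D" "M v u = 0"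
  shows "l 2 * M v v \<le> A v v"
proof (cases "M v v = 0")
  case True
  then show ?thesis using A_nonneg[OF v(1)] by simp
next
  case False
  then have pos: "M v v > 0" using M_nonneg[OF v(1)] by simp
  have uH: "u \<in> H10 D" and Au: "\<And>w. w \<in> H10 D \<Longrightarrow> A u w = l 1 * M u w"
    using u(1) by (auto simp: eigenspace_def)
  obtain e \<mu> where e: "e \<in> H10 D" "M e u = 0" "M e e = 1"
    "\<And>v. v \<in> H10 D \<Longrightarrow> M v u = 0 \<Longrightarrow> \<mu> * M v v \<le> A v v"
    "\<And>v. v \<in> H10 D \<Longrightarrow> M v u = 0 \<Longrightarrow> A e v = \<mu> * M e v"
    using minimiser[OF uH v(1,2) pos] by blast
  \<comment> \<open>Subtracting the multiple of \<open>u\<close> brings \<open>w\<close> into the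
    constraint space; the subtracted part is invisible, as \<open>e\<close> is orthogonal to
    \<open>u\<close> for both forms.\<close>
  have "A e w = \<mu> * M e w" if w: "w \<in> H10 D" for w
  proof -
    define w' where "w' = w - M w u *\<^sub>R u"
    have w': "w' \<in> H10 D" "M w' u = 0"
      using w uH u(2) by (auto simp: w'_def mem symbil_simps[OF sM])
    have Aeu: "A e u = 0" using Au[OF e(1)] symbil_sym[OF sA e(1) uH] symbil_sym[OF sM e(1) uH] e(2) by simp
    have "A e w' = A e w" "M e w' = M e w"
      unfolding w'_def using e(1,2) Aeu w uH
      by (simp_all add: mem symbil_diff_right[OF sA] symbil_diff_right[OF sM] symbil_scale_right[OF sA] symbil_scale_right[OF sM])
    then show ?thesis using e(5)[OF w'] by simp
  qed
  then have eE: "e \<in> eigenspace D A M \<mu>" using e(1) by (simp add: eigenspace_def)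
  then obtain k where k: "k \<ge> 1" "l k = \<mu>" using eigenvalue_in_list e(3) by fastforce
  have mono: "l i \<le> l j" if "1 \<le> i" "i \<le> j" for i j
    using l that unfolding eigenvalues_with_multiplicity_def mono_on_def by auto
  have "\<mu> \<noteq> l 1"
  proof
    assume mu: "\<mu> = l 1"
    have "{k\<in>{1..}. l k = l 1} = {1}"
    proof (intro equalityI subsetI)
      fix j assume j: "j \<in> {k\<in>{1..}. l k = l 1}"
      show "j \<in> {1}"
      proof (rule ccontr)
        assume "j \<notin> {1}"
        then have "l 2 \<le> l j" using j by (intro mono) auto
        then show False using gap j by simp
      qed
    qed simp
    then have "has_dim_ae D (eigenspace D A M (l 1)) 1"
      using l unfolding eigenvalues_with_multiplicity_def by (metis card_1_singleton_iff One_nat_def)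
    then obtain b where b: "\<And>w. w \<in> eigenspace D A M (l 1) \<Longrightarrow> \<exists>t. AE x in lebesgue_on D. w x = t * b x"
      unfolding has_dim_ae_def by (auto simp: lessThan_Suc) metis
    obtain t where t: "AE x in lebesgue_on D. u x = t * b x" using b[OF u(1)] by blast
    obtain s where s: "AE x in lebesgue_on D. e x = s * b x" using b eE mu by blast
    \<comment> \<open>In a one-dimensional eigenspace both vectors are multiples of
      \<open>b\<close>, so this combination vanishes almost everywhere. Orthonormality gives M w w =
      s^2 + t^2, hence s = 0 and \<open>e\<close> is zero.\<close>
    define w where "w = s *\<^sub>R u - t *\<^sub>R e"
    have wH: "w \<in> H10 D" using uH e(1) by (simp add: w_def mem)
    have "AE x in lebesgue_on D. w x = 0"
      using t s by eventually_elim (simp add: w_def)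
    then have "M w w = 0" using M_zero_iff[OF wH] by simp
    moreover have "M w w = s\<^sup>2 + t\<^sup>2"
      using symbil_lincomb_square[OF sM uH e(1), of s "- t"] u(2) e(2,3) symbil_sym[OF sM uH e(1)] by (simp add: w_def)
    ultimately have "s = 0" by (simp add: sum_power2_eq_zero_iff)
    then have "AE x in lebesgue_on D. e x = 0" using s by simp
    then show False using M_zero_iff[OF e(1)] e(3) by simp
  qed
  then have "k \<ge> 2" using k by (cases "k = 1") auto
  then have "l 2 \<le> \<mu>" using mono[of 2 k] k by simp
  then have "l 2 * M v v \<le> \<mu> * M v v" using M_nonneg[OF v(1)] by (rule mult_right_mono)
  then show ?thesis using e(4)[OF v] by linarith
qed

text \<open>\<open>A\<close> dominates only the gradient form, so the Poincare inequality is what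
  excludes an eigenfunction of zero energy.\<close>

lemma first_eigenvalue_pos: "l 1 > 0"
proof -
  obtain e where e: "e \<in> eigenspace D A M (l 1)" "M e e > 0" using eigenvector_exists[of 1] by auto
  then have eH: "e \<in> H10 D" and Ae: "A e e = l 1 * M e e" by (auto simp: eigenspace_def)
  obtain C where C: "C > 0" "L e e \<le> C * G e e" using H10_Poincare[OF open_D bounded_D] eH by metis
  have "L e e \<noteq> 0" using M_le[OF eH] e(2) by auto
  then have "L e e > 0" using L2_inner_nonneg[of D e] by simp
  then have "0 < C * G e e" using C by linarith
  then have "G e e > 0" using C(1) by (simp add: zero_less_mult_iff)
  then have "A e e > 0" using A_ge[OF eH] kappa mult_pos_pos[of \<kappa> "G e e"] by linarith
  then show ?thesis using e(2) by (simp add: Ae zero_less_mult_iff)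
qed

text \<open>A nondegenerate plane on which the Rayleigh quotient is at most \<open>l 2\<close>, to
  be used as trial space in a comparison of second eigenvalues. It lies in one eigenspace if the two
  eigenvalues coincide; otherwise eigenvectors of different eigenvalues are orthogonal.\<close>

lemma two_eigenvectors:
  obtains f1 f2 where "f1 \<in> H10 D" "f2 \<in> H10 D"
    "\<And>s t. s \<noteq> 0 \<or> t \<noteq> 0 \<Longrightarrow> M (s *\<^sub>R f1 + t *\<^sub>R f2) (s *\<^sub>R f1 + t *\<^sub>R f2) > 0"
    "\<And>s t. A (s *\<^sub>R f1 + t *\<^sub>R f2) (s *\<^sub>R f1 + t *\<^sub>R f2) \<le> l 2 * M (s *\<^sub>R f1 + t *\<^sub>R f2) (s *\<^sub>R f1 + t *\<^sub>R f2)"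
proof (cases "l 1 = l 2")
  case True
  define S where "S = {j\<in>{1..}. l j = l 2}"
  have S: "finite S" "has_dim_ae D (eigenspace D A M (l 2)) (card S)"
    using l unfolding eigenvalues_with_multiplicity_def S_def by blast+
  have "{1, 2} \<subseteq> S" using True by (simp add: S_def)
  then have cS: "2 \<le> card S" using S(1) card_mono[of S "{1, 2::nat}"] by simp
  obtain e where e: "\<And>i. i < card S \<Longrightarrow> e i \<in> eigenspace D A M (l 2)"
    "\<And>t. (AE x in lebesgue_on D. (\<Sum>i<card S. t i * e i x) = 0) \<Longrightarrow> (\<forall>i<card S. t i = 0)"
    using S(2) unfolding has_dim_ae_def by blast
  have eH: "e 0 \<in> H10 D" "e 1 \<in> H10 D" and Ae: "\<And>w. w \<in> H10 D \<Longrightarrow> A (e 0) w = l 2 * M (e 0) w"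
      "\<And>w. w \<in> H10 D \<Longrightarrow> A (e 1) w = l 2 * M (e 1) w"
    using e(1)[of 0] e(1)[of 1] cS by (auto simp: eigenspace_def)
  show thesis
  proof (rule that[OF eH])
    fix s t :: real
    let ?w = "s *\<^sub>R e 0 + t *\<^sub>R e 1"
    have wH: "?w \<in> H10 D" using eH by (simp add: mem)
    show "A ?w ?w \<le> l 2 * M ?w ?w"
      unfolding symbil_lincomb_square[OF sA eH] symbil_lincomb_square[OF sM eH] using Ae eH by (simp add: algebra_simps)
    assume st: "s \<noteq> 0 \<or> t \<noteq> 0"
    define T where "T i = (if i = 0 then s else if i = 1 then t else 0)" for i :: nat
    have "(\<Sum>i<card S. T i * e i x) = ?w x" for x
    proof -
      have "(\<Sum>i<card S. T i * e i x) = (\<Sum>i\<in>{0, 1}. T i * e i x)"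
        using cS by (intro sum.mono_neutral_right) (auto simp: T_def)
      then show ?thesis by (simp add: T_def)
    qed
    then have T: "(AE x in lebesgue_on D. ?w x = 0) \<Longrightarrow> \<forall>i<card S. T i = 0"
      using e(2)[of T] by simp
    have "\<not> (AE x in lebesgue_on D. ?w x = 0)"
    proof
      assume "AE x in lebesgue_on D. ?w x = 0"
      then have "T 0 = 0" "T 1 = 0" using T cS by auto
      then show False using st by (simp add: T_def)
    qed
    then show "M ?w ?w > 0" using M_zero_iff[OF wH] M_nonneg[OF wH] by simp
  qed
next
  case False
  have "l 1 \<le> l 2" using l unfolding eigenvalues_with_multiplicity_def mono_on_def by auto
  obtain f1 f2 where f1: "f1 \<in> eigenspace D A M (l 1)" "M f1 f1 > 0" and f2: "f2 \<in> eigenspace D A M (l 2)" "M f2 f2 > 0"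
    using eigenvector_exists[of 1] eigenvector_exists[of 2] by auto
  have fH: "f1 \<in> H10 D" "f2 \<in> H10 D" and Af: "\<And>w. w \<in> H10 D \<Longrightarrow> A f1 w = l 1 * M f1 w"
      "\<And>w. w \<in> H10 D \<Longrightarrow> A f2 w = l 2 * M f2 w"
    using f1 f2 by (auto simp: eigenspace_def)
  have "l 1 * M f1 f2 = l 2 * M f1 f2"
    using Af(1)[OF fH(2)] Af(2)[OF fH(1)] symbil_sym[OF sA fH] symbil_sym[OF sM fH] by metis
  then have orth: "M f1 f2 = 0" using False by simp
  show thesis
  proof (rule that[OF fH])
    fix s t :: real
    let ?w = "s *\<^sub>R f1 + t *\<^sub>R f2"
    have Mw: "M ?w ?w = s\<^sup>2 * M f1 f1 + t\<^sup>2 * M f2 f2"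
      unfolding symbil_lincomb_square[OF sM fH] by (simp add: orth)
    have "A ?w ?w = s\<^sup>2 * (l 1 * M f1 f1) + t\<^sup>2 * (l 2 * M f2 f2)"
      unfolding symbil_lincomb_square[OF sA fH] using Af fH by (simp add: orth)
    also have "\<dots> \<le> s\<^sup>2 * (l 2 * M f1 f1) + t\<^sup>2 * (l 2 * M f2 f2)"
      using \<open>l 1 \<le> l 2\<close> f1(2) by (intro add_right_mono mult_left_mono mult_right_mono) auto
    finally show "A ?w ?w \<le> l 2 * M ?w ?w" by (simp add: Mw algebra_simps)
    assume "s \<noteq> 0 \<or> t \<noteq> 0"
    then show "M ?w ?w > 0"
      unfolding Mw using f1(2) f2(2) by (auto intro: add_pos_nonneg add_nonneg_pos)
  qed
qed

end

end

section \<open>Comparison with the Dirichlet Laplacian\<close>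

lemma bounded_coeff_const: "\<bar>r\<bar> \<le> K \<Longrightarrow> bounded_coeff D K (\<lambda>_. r)"
  by (auto simp: bounded_coeff_def)

lemma elliptic_Laplace: "open D \<Longrightarrow> bounded D \<Longrightarrow> elliptic D (\<lambda>_. 1) (\<lambda>_. 0) (\<lambda>_. 1) 1 1"
  by (simp add: elliptic_def bounded_coeff_const)

lemma Laplace_forms: "A_form D (\<lambda>_. 1) (\<lambda>_. 0) w v = grad_inner D w v" "M_form D (\<lambda>_. 1) w v = L2_inner D w v"
  by (simp_all add: A_form_def M_form_def grad_inner_def L2_inner_def)

context elliptic
begin

lemma kappa_K: "D \<noteq> {} \<Longrightarrow> K \<ge> \<kappa>"
proof (rule ccontr)
  assume D: "D \<noteq> {}" and n: "\<not> K \<ge> \<kappa>"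
  have "AE x in lebesgue_on D. \<bar>c x\<bar> \<le> K" using c(1) by (simp add: bounded_coeff_def)
  then have "AE x in lebesgue_on D. False"
    using c(2) by eventually_elim (use n in linarith)
  then show False using AE_lebesgue_on_False[OF open_D D] by blast
qed

context
  fixes l \<chi>s :: "nat \<Rightarrow> real"
  assumes l: "eigenvalues_with_multiplicity D A M l" and chi: "dirichlet_eigenvalues D \<chi>s"
begin

interpretation Lap: elliptic D "\<lambda>_. 1" "\<lambda>_. 0" "\<lambda>_. 1" 1 1
  by (rule elliptic_Laplace[OF open_D bounded_D])

lemma chi': "eigenvalues_with_multiplicity D Lap.A Lap.M \<chi>s"
  using chi by (simp add: dirichlet_eigenvalues_def)

lemma chi_pos: "\<chi>s 1 > 0"
  by (rule Lap.first_eigenvalue_pos[OF chi'])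

lemma chi_mono: "\<chi>s 1 \<le> \<chi>s 2"
  using chi' unfolding eigenvalues_with_multiplicity_def mono_on_def by auto

lemma Poincare_chi: "v \<in> H10 D \<Longrightarrow> \<chi>s 1 * L v v \<le> G v v"
  using Lap.first_eigenvalue_min[OF chi', of v] by (simp add: Laplace_forms)

text \<open>A single trial function compares the two Rayleigh quotients. The summand 1 accounts for
  the zero-order term of \<open>A\<close>, which is bounded by K times the L^2 form.\<close>

lemma quotient_compare:
  assumes w: "w \<in> H10 D" "L w w > 0" and lo: "x \<ge> 0" "x * M w w \<le> A w w" and up: "G w w \<le> y * L w w"
  shows "x \<le> K / \<kappa> * (y + 1)"
proof -
  have "x * (\<kappa> * L w w) \<le> x * M w w" using lo(1) M_ge[OF w(1)] by (rule mult_left_mono[rotated])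
  also have "\<dots> \<le> A w w" by (rule lo(2))
  also have "\<dots> \<le> K * (G w w + L w w)" by (rule A_le[OF w(1)])
  also have "\<dots> \<le> K * (y * L w w + L w w)"
    using up c(1) by (intro mult_left_mono) (auto simp: bounded_coeff_def)
  finally have "(x * \<kappa>) * L w w \<le> (K * (y + 1)) * L w w" by (simp add: algebra_simps)
  then have "x * \<kappa> \<le> K * (y + 1)" using w(2) by simp
  then show ?thesis using kappa by (simp add: field_simps)
qed

lemma first_eigenvalue_upper: "l 1 \<le> K / \<kappa> * (\<chi>s 1 + 1)"
proof -
  obtain e where e: "e \<in> eigenspace D Lap.A Lap.M (\<chi>s 1)" "Lap.M e e > 0"
    using Lap.eigenvector_exists[OF chi', of 1] by auto
  then have "e \<in> H10 D" "G e e = \<chi>s 1 * L e e" "L e e > 0"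
    by (auto simp: eigenspace_def Laplace_forms)
  then show ?thesis
    using first_eigenvalue_pos[OF l] first_eigenvalue_min[OF l]
    by (intro quotient_compare[of e]) auto
qed

text \<open>The Courant-Fischer argument: a plane of trial functions for the Laplacian contains a
  nonzero vector orthogonal to the first eigenfunction.\<close>

lemma second_eigenvalue_upper:
  assumes u: "u \<in> eigenspace D A M (l 1)" "M u u = 1" and gap: "l 1 < l 2"
  shows "l 2 \<le> K / \<kappa> * (\<chi>s 2 + 1)"
proof -
  obtain f1 f2 where f: "f1 \<in> H10 D" "f2 \<in> H10 D"
    "\<And>s t. s \<noteq> 0 \<or> t \<noteq> 0 \<Longrightarrow> L (s *\<^sub>R f1 + t *\<^sub>R f2) (s *\<^sub>R f1 + t *\<^sub>R f2) > 0"
    "\<And>s t. G (s *\<^sub>R f1 + t *\<^sub>R f2) (s *\<^sub>R f1 + t *\<^sub>R f2) \<le> \<chi>s 2 * L (s *\<^sub>R f1 + t *\<^sub>R f2) (s *\<^sub>R f1 + t *\<^sub>R f2)"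
    by (rule Lap.two_eigenvectors[OF chi', unfolded Laplace_forms]) blast
  have uH: "u \<in> H10 D" using u by (simp add: eigenspace_def)
  \<comment> \<open>A nontrivial solution of one homogeneous linear equation in two
    unknowns.\<close>
  obtain s t where st: "s \<noteq> 0 \<or> t \<noteq> 0" "s * M f1 u + t * M f2 u = 0"
  proof (cases "M f1 u = 0")
    case True
    then show ?thesis using that[of 1 0] by simp
  next
    case False
    then show ?thesis using that[of "M f2 u" "- M f1 u"] by simp
  qed
  let ?w = "s *\<^sub>R f1 + t *\<^sub>R f2"
  have w: "?w \<in> H10 D" "M ?w u = 0" using f(1,2) uH st(2) by (simp_all add: symbil_simps[OF sM])
  show ?thesis
  proof (rule quotient_compare[OF w(1) f(3)[OF st(1)] _ second_eigenvalue_min[OF l u gap w] f(4)])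
    show "0 \<le> l 2" using first_eigenvalue_pos[OF l] gap by linarith
  qed
qed

end

end

section \<open>Differentiating the eigenvalue equation\<close>

text \<open>A multi-index is represented by a finite set of pairs, the pair \<open>(i, k)\<close> standing for one
  differentiation in the direction \<open>i\<close>. The Leibniz rule becomes a sum over subsets, without
  binomial coefficients.\<close>

definition set_mi :: "(nat \<times> nat) set \<Rightarrow> nat \<Rightarrow> nat" where
  "set_mi S i = card {s \<in> S. fst s = i}"

lemma set_mi_empty: "set_mi {} = (\<lambda>_. 0)"
  by (simp add: set_mi_def fun_eq_iff)

lemma set_mi_insert:
  assumes "finite S" "x \<notin> S"
  shows "set_mi (insert x S) = (set_mi S)(fst x := Suc (set_mi S (fst x)))"
proof
  fix i
  have "{s \<in> insert x S. fst s = i} = (if fst x = i then insert x {s \<in> S. fst s = i} else {s \<in> S. fst s = i})"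
    by auto
  then show "set_mi (insert x S) i = ((set_mi S)(fst x := Suc (set_mi S (fst x)))) i"
    using assms by (auto simp: set_mi_def)
qed

lemma set_mi_multi_index:
  assumes "finite S"
  shows "set_mi S \<in> multi_indices"
proof -
  have "{j. set_mi S j \<noteq> 0} \<subseteq> fst ` S"
  proof
    fix i assume "i \<in> {j. set_mi S j \<noteq> 0}"
    then have "card {s \<in> S. fst s = i} \<noteq> 0" by (simp add: set_mi_def)
    then have "{s \<in> S. fst s = i} \<noteq> {}" by (metis card.empty)
    then show "i \<in> fst ` S" by blast
  qed
  then show ?thesis using assms by (auto simp: multi_indices_def intro: finite_subset)
qed

lemma multi_index_set:
  assumes "\<nu> \<in> multi_indices"
  defines "S \<equiv> Sigma {j. \<nu> j \<noteq> 0} (\<lambda>j. {..<\<nu> j})"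
  shows "finite S" "set_mi S = \<nu>" "card S = mi_order \<nu>" "(\<Prod>s\<in>S. \<beta> (fst s)) = mi_power \<beta> \<nu>"
proof -
  have fin: "finite {j. \<nu> j \<noteq> 0}" using assms(1) by (simp add: multi_indices_def)
  then show "finite S" by (simp add: S_def)
  show "set_mi S = \<nu>"
  proof
    fix i
    have "{s \<in> S. fst s = i} = Pair i ` {..<\<nu> i}" by (auto simp: S_def)
    then show "set_mi S i = \<nu> i" by (simp add: set_mi_def card_image inj_on_def)
  qed
  show "card S = mi_order \<nu>" using fin by (simp add: S_def mi_order_def)
  show "(\<Prod>s\<in>S. \<beta> (fst s)) = mi_power \<beta> \<nu>"
  proof -
    have "(\<Prod>j\<in>{j. \<nu> j \<noteq> 0}. \<Prod>k\<in>{..<\<nu> j}. \<beta> j) = (\<Prod>(j, k)\<in>S. \<beta> j)"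
      unfolding S_def using fin by (intro prod.Sigma) auto
    then show ?thesis by (simp add: mi_power_def case_prod_unfold)
  qed
qed

definition partial :: "nat \<Rightarrow> (nat \<Rightarrow> real) \<Rightarrow> ((nat \<Rightarrow> real) \<Rightarrow> real) \<Rightarrow> real \<Rightarrow> bool" where
  "partial j y f d \<longleftrightarrow> ((\<lambda>t. f (y(j := t))) has_real_derivative d) (at (y j) within {-1/2..1/2})"

lemma has_real_derivative_eq_on:
  fixes f g :: "real \<Rightarrow> real"
  assumes "a \<in> S" "\<And>t. t \<in> S \<Longrightarrow> g t = f t" "(f has_real_derivative d) (at a within S)"
  shows "(g has_real_derivative d) (at a within S)"
  by (rule has_field_derivative_transform_within[OF assms(3) zero_less_one assms(1)]) (simp add: assms(2))

text \<open>The parameter interval has no isolated point, so derivatives within it are unique even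
  at the end points. Identities valid on the whole box can therefore be differentiated.\<close>

lemma partial_unique:
  assumes y: "y \<in> param_box" and f: "partial j y f d" and g: "partial j y g e"
    and eq: "\<And>z. z \<in> param_box \<Longrightarrow> f z = g z"
  shows "d = e"
proof -
  have yj: "y j \<in> {-1/2..1/2}" using y by (simp add: param_box_def)
  have box: "y(j := t) \<in> param_box" if "t \<in> {-1/2..1/2}" for t
    using y that by (auto simp: param_box_def)
  have "((\<lambda>t. f (y(j := t))) has_real_derivative e) (at (y j) within {-1/2..1/2})"
    using g unfolding partial_def
    by (rule has_real_derivative_eq_on[OF yj, rotated]) (simp add: eq box)
  moreover have "at (y j) within {-1/2..1/2} \<noteq> bot"
    using yj by (subst trivial_limit_within) (simp add: islimpt_Icc[of "-1/2" "1/2"])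
  ultimately show ?thesis
    using f unfolding partial_def has_field_derivative_iff by (intro tendsto_unique) auto
qed

lemma partial_sum:
  "(\<And>i. i \<in> I \<Longrightarrow> partial j y (f i) (d i)) \<Longrightarrow> partial j y (\<lambda>z. \<Sum>i\<in>I. f i z) (\<Sum>i\<in>I. d i)"
  unfolding partial_def by (rule DERIV_sum)

lemma partial_add: "partial j y f d \<Longrightarrow> partial j y g e \<Longrightarrow> partial j y (\<lambda>z. f z + g z) (d + e)"
  unfolding partial_def by (rule DERIV_add)

lemma partial_const: "partial j y (\<lambda>z. k) 0"
  unfolding partial_def by simp

lemma partial_mult: "partial j y f d \<Longrightarrow> partial j y g e \<Longrightarrow> partial j y (\<lambda>z. f z * g z) (d * g y + f y * e)"
  unfolding partial_def using DERIV_mult[of "\<lambda>t. f (y(j := t))" d "y j" "{-1/2..1/2}" "\<lambda>t. g (y(j := t))" e]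
  by (simp add: mult.commute add.commute)

text \<open>Separates the differentiation of the eigenvalue problem from the function spaces. The
  analytic input is that all forms are bounded by the seminorm of \<open>G\<close> and that
  difference quotients of \<open>u\<close> converge in it; \<open>B j\<close> is the derivative of
  \<open>A\<close> in the direction j.\<close>

locale parametric_family =
  fixes V :: "'v::real_vector set" and G M :: "'v \<Rightarrow> 'v \<Rightarrow> real"
    and A :: "(nat \<Rightarrow> real) \<Rightarrow> 'v \<Rightarrow> 'v \<Rightarrow> real" and B :: "nat \<Rightarrow> 'v \<Rightarrow> 'v \<Rightarrow> real"
    and lam :: "(nat \<Rightarrow> nat) \<Rightarrow> (nat \<Rightarrow> real) \<Rightarrow> real" and u :: "(nat \<Rightarrow> nat) \<Rightarrow> (nat \<Rightarrow> real) \<Rightarrow> 'v"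
  assumes G: "symbil V G" and M: "symbil V M" and A: "\<And>y. y \<in> param_box \<Longrightarrow> symbil V (A y)" and B: "\<And>j. symbil V (B j)"
    and G_nonneg: "\<And>v. v \<in> V \<Longrightarrow> G v v \<ge> 0"
    and M_bounded: "\<exists>C. \<forall>v\<in>V. \<forall>w\<in>V. \<bar>M v w\<bar> \<le> C * (sqrt (G v v) * sqrt (G w w))"
    and A_bounded: "\<And>y. y \<in> param_box \<Longrightarrow> \<exists>C. \<forall>v\<in>V. \<forall>w\<in>V. \<bar>A y v w\<bar> \<le> C * (sqrt (G v v) * sqrt (G w w))"
    and B_bounded: "\<And>j. \<exists>C. \<forall>v\<in>V. \<forall>w\<in>V. \<bar>B j v w\<bar> \<le> C * (sqrt (G v v) * sqrt (G w w))"
    and A_update: "\<And>y j t v w. y \<in> param_box \<Longrightarrow> t \<in> {-1/2..1/2} \<Longrightarrow> v \<in> V \<Longrightarrow> w \<in> V \<Longrightarrow>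
        A (y(j := t)) v w = A y v w + (t - y j) * B j v w"
    and u_V: "\<And>\<nu> y. \<nu> \<in> multi_indices \<Longrightarrow> y \<in> param_box \<Longrightarrow> u \<nu> y \<in> V"
    and lam_deriv: "\<And>\<nu> j y. \<nu> \<in> multi_indices \<Longrightarrow> y \<in> param_box \<Longrightarrow> partial j y (lam \<nu>) (lam (\<nu>(j := Suc (\<nu> j))) y)"
    and u_deriv: "\<And>\<nu> j y. \<nu> \<in> multi_indices \<Longrightarrow> y \<in> param_box \<Longrightarrow>
        ((\<lambda>t. let d = (1 / (t - y j)) *\<^sub>R (u \<nu> (y(j := t)) - u \<nu> y) - u (\<nu>(j := Suc (\<nu> j))) y in sqrt (G d d)) \<longlongrightarrow> 0)
          (at (y j) within {-1/2..1/2})"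
    and eig: "\<And>y v. y \<in> param_box \<Longrightarrow> v \<in> V \<Longrightarrow> A y (u (\<lambda>_. 0) y) v = lam (\<lambda>_. 0) y * M (u (\<lambda>_. 0) y) v"
    and normalised: "\<And>y. y \<in> param_box \<Longrightarrow> M (u (\<lambda>_. 0) y) (u (\<lambda>_. 0) y) = 1"
begin

definition bounded_form :: "('v \<Rightarrow> 'v \<Rightarrow> real) \<Rightarrow> bool" where
  "bounded_form F \<longleftrightarrow> symbil V F \<and> (\<exists>C. \<forall>v\<in>V. \<forall>w\<in>V. \<bar>F v w\<bar> \<le> C * (sqrt (G v v) * sqrt (G w w)))"

definition vpartial :: "nat \<Rightarrow> (nat \<Rightarrow> real) \<Rightarrow> ((nat \<Rightarrow> real) \<Rightarrow> 'v) \<Rightarrow> 'v \<Rightarrow> bool" where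
  "vpartial j y f d \<longleftrightarrow> d \<in> V \<and> (\<forall>z\<in>param_box. f z \<in> V) \<and>
     ((\<lambda>t. let e = (1 / (t - y j)) *\<^sub>R (f (y(j := t)) - f y) - d in sqrt (G e e)) \<longlongrightarrow> 0)
          (at (y j) within {-1/2..1/2})"

lemma box_update: "y \<in> param_box \<Longrightarrow> t \<in> {-1/2..1/2} \<Longrightarrow> y(j := t) \<in> param_box"
  by (auto simp: param_box_def)

lemma box_nth: "y \<in> param_box \<Longrightarrow> y j \<in> {-1/2..1/2}"
  by (simp add: param_box_def)

lemma partial_form_left:
  assumes y: "y \<in> param_box" and F: "bounded_form F" and f: "vpartial j y f d" and v: "v \<in> V"
  shows "partial j y (\<lambda>z. F (f z) v) (F d v)"
proof -
  have sF: "symbil V F" using F by (simp add: bounded_form_def)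
  obtain C where C: "\<And>v w. v \<in> V \<Longrightarrow> w \<in> V \<Longrightarrow> \<bar>F v w\<bar> \<le> C * (sqrt (G v v) * sqrt (G w w))"
    using F unfolding bounded_form_def by blast
  have d: "d \<in> V" and fV: "\<And>z. z \<in> param_box \<Longrightarrow> f z \<in> V" using f by (auto simp: vpartial_def)
  define e where "e t = (1 / (t - y j)) *\<^sub>R (f (y(j := t)) - f y) - d" for t
  have lim: "((\<lambda>t. sqrt (G (e t) (e t))) \<longlongrightarrow> 0) (at (y j) within {-1/2..1/2})"
    using f by (simp add: vpartial_def e_def Let_def)
  have "((\<lambda>t. (F (f (y(j := t))) v - F (f y) v) / (t - y j) - F d v) \<longlongrightarrow> 0) (at (y j) within {-1/2..1/2})"
  proof (rule Lim_null_comparison)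
    show "\<forall>\<^sub>F t in at (y j) within {-1/2..1/2}. norm ((F (f (y(j := t))) v - F (f y) v) / (t - y j) - F d v)
        \<le> (C * sqrt (G v v)) * sqrt (G (e t) (e t))"
      unfolding eventually_at_filter
    proof (intro always_eventually allI impI)
      fix t :: real assume "t \<noteq> y j" and t: "t \<in> {-1/2..1/2}"
      have V: "f (y(j := t)) \<in> V" "f y \<in> V" using fV box_update[OF y t] y by auto
      have eV: "e t \<in> V" unfolding e_def using V d by (simp add: symbil_mem[OF sF])
      have "(F (f (y(j := t))) v - F (f y) v) / (t - y j) - F d v = F (e t) v"
        unfolding e_def using V d v by (simp add: symbil_simps[OF sF])
      then show "norm ((F (f (y(j := t))) v - F (f y) v) / (t - y j) - F d v)
        \<le> (C * sqrt (G v v)) * sqrt (G (e t) (e t))"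
        using C[OF eV v] by (simp add: mult_ac)
    qed
    show "((\<lambda>t. (C * sqrt (G v v)) * sqrt (G (e t) (e t))) \<longlongrightarrow> 0) (at (y j) within {-1/2..1/2})"
      by (rule tendsto_mult_right_zero[OF lim])
  qed
  then have "((\<lambda>t. (F (f (y(j := t))) v - F (f y) v) / (t - y j)) \<longlongrightarrow> F d v) (at (y j) within {-1/2..1/2})"
    by (rule LIM_zero_cancel)
  then show ?thesis unfolding partial_def has_field_derivative_iff by simp
qed

text \<open>The increment is t - y j times the difference quotient, whose seminorm stays bounded
  near the point.\<close>

lemma vpartial_continuous:
  assumes y: "y \<in> param_box" and f: "vpartial j y f d"
  shows "((\<lambda>t. sqrt (G (f (y(j := t)) - f y) (f (y(j := t)) - f y))) \<longlongrightarrow> 0) (at (y j) within {-1/2..1/2})"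
proof -
  have d: "d \<in> V" and fV: "\<And>z. z \<in> param_box \<Longrightarrow> f z \<in> V" using f by (auto simp: vpartial_def)
  define e where "e t = (1 / (t - y j)) *\<^sub>R (f (y(j := t)) - f y) - d" for t
  have lim: "((\<lambda>t. sqrt (G (e t) (e t))) \<longlongrightarrow> 0) (at (y j) within {-1/2..1/2})"
    using f by (simp add: vpartial_def e_def Let_def)
  show ?thesis
  proof (rule Lim_null_comparison)
    show "\<forall>\<^sub>F t in at (y j) within {-1/2..1/2}. norm (sqrt (G (f (y(j := t)) - f y) (f (y(j := t)) - f y)))
        \<le> \<bar>t - y j\<bar> * (sqrt (G (e t) (e t)) + sqrt (G d d))"
      unfolding eventually_at_filter
    proof (intro always_eventually allI impI)
      fix t :: real assume t': "t \<noteq> y j" and t: "t \<in> {-1/2..1/2}"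
      have V: "f (y(j := t)) \<in> V" "f y \<in> V" using fV box_update[OF y t] y by auto
      have eV: "e t \<in> V" unfolding e_def using V d by (simp add: symbil_mem[OF G])
      have eq: "f (y(j := t)) - f y = (t - y j) *\<^sub>R (e t + d)"
        using t' by (simp add: e_def)
      have "G ((t - y j) *\<^sub>R (e t + d)) ((t - y j) *\<^sub>R (e t + d)) = (t - y j)\<^sup>2 * G (e t + d) (e t + d)"
        using symbil_mem(1)[OF G eV d] symbil_mem(3)[OF G symbil_mem(1)[OF G eV d]]
        by (simp only: symbil_scale_left[OF G] symbil_scale_right[OF G] power2_eq_square mult.assoc)
      then have "sqrt (G (f (y(j := t)) - f y) (f (y(j := t)) - f y)) = \<bar>t - y j\<bar> * sqrt (G (e t + d) (e t + d))"
        unfolding eq by (simp add: real_sqrt_mult)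
      also have "\<dots> \<le> \<bar>t - y j\<bar> * (sqrt (G (e t) (e t)) + sqrt (G d d))"
        by (intro mult_left_mono symbil_triangle[OF G G_nonneg eV d]) auto
      finally show "norm (sqrt (G (f (y(j := t)) - f y) (f (y(j := t)) - f y))) \<le> \<bar>t - y j\<bar> * (sqrt (G (e t) (e t)) + sqrt (G d d))"
        using G_nonneg[OF symbil_mem(2)[OF G V]] by simp
    qed
    have "((\<lambda>t. \<bar>t - y j\<bar>) \<longlongrightarrow> \<bar>y j - y j\<bar>) (at (y j) within {-1/2..1/2})" by (intro tendsto_intros)
    from tendsto_mult[OF this tendsto_add[OF lim tendsto_const]]
    show "((\<lambda>t. \<bar>t - y j\<bar> * (sqrt (G (e t) (e t)) + sqrt (G d d))) \<longlongrightarrow> 0) (at (y j) within {-1/2..1/2})" by simp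
  qed
qed

text \<open>The product rule, obtained by expanding the form about the pair \<open>f y\<close>,
  \<open>g y\<close>: two terms with one argument frozen, a product of increments, and a
  constant.\<close>

lemma partial_form:
  assumes y: "y \<in> param_box" and F: "bounded_form F" and f: "vpartial j y f d" and g: "vpartial j y g e"
  shows "partial j y (\<lambda>z. F (f z) (g z)) (F d (g y) + F (f y) e)"
proof -
  have sF: "symbil V F" using F by (simp add: bounded_form_def)
  obtain C where C: "\<And>v w. v \<in> V \<Longrightarrow> w \<in> V \<Longrightarrow> \<bar>F v w\<bar> \<le> C * (sqrt (G v v) * sqrt (G w w))"
    using F unfolding bounded_form_def by blast
  have d: "d \<in> V" "e \<in> V" and fV: "\<And>z. z \<in> param_box \<Longrightarrow> f z \<in> V" "\<And>z. z \<in> param_box \<Longrightarrow> g z \<in> V"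
    using f g by (auto simp: vpartial_def)
  have 1: "partial j y (\<lambda>z. F (f z) (g y)) (F d (g y))"
    by (rule partial_form_left[OF y F f fV(2)[OF y]])
  have "partial j y (\<lambda>z. F (g z) (f y)) (F e (f y))"
    by (rule partial_form_left[OF y F g fV(1)[OF y]])
  then have 2: "partial j y (\<lambda>z. F (g z) (f y)) (F (f y) e)"
    using symbil_sym[OF sF d(2) fV(1)[OF y]] by simp
  text \<open>The remainder is a product of two increments.\<close>
  have 3: "partial j y (\<lambda>z. F (f z - f y) (g z - g y)) 0"
    unfolding partial_def has_field_derivative_iff
  proof (rule Lim_null_comparison)
    let ?N = "\<lambda>v. sqrt (G v v)"
    define r where "r t = (1 / (t - y j)) *\<^sub>R (f (y(j := t)) - f y) - d" for t
    have lim: "((\<lambda>t. ?N (r t)) \<longlongrightarrow> 0) (at (y j) within {-1/2..1/2})"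
      using f by (simp add: vpartial_def r_def Let_def)
    show "\<forall>\<^sub>F t in at (y j) within {-1/2..1/2}.
        norm ((F (f (y(j := t)) - f y) (g (y(j := t)) - g y) - F (f (y(j := y j)) - f y) (g (y(j := y j)) - g y)) / (t - y j))
        \<le> \<bar>C\<bar> * ((?N (r t) + ?N d) * ?N (g (y(j := t)) - g y))"
      unfolding eventually_at_filter
    proof (intro always_eventually allI impI)
      fix t :: real assume t': "t \<noteq> y j" and t: "t \<in> {-1/2..1/2}"
      have V: "f (y(j := t)) \<in> V" "f y \<in> V" "g (y(j := t)) \<in> V" "g y \<in> V" using fV box_update[OF y t] y by auto
      have rV: "r t \<in> V" unfolding r_def using V d by (simp add: symbil_mem[OF G])
      have gV: "g (y(j := t)) - g y \<in> V" using V symbil_mem[OF G] by simp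
      have rdV: "r t + d \<in> V" using rV d symbil_mem[OF G] by simp
      have eq: "f (y(j := t)) - f y = (t - y j) *\<^sub>R (r t + d)" using t' by (simp add: r_def)
      have "F (f (y(j := t)) - f y) (g (y(j := t)) - g y) / (t - y j) = F (r t + d) (g (y(j := t)) - g y)"
        unfolding eq symbil_scale_left[OF sF rdV gV] using t' by simp
      moreover have "\<bar>F (r t + d) (g (y(j := t)) - g y)\<bar> \<le> \<bar>C\<bar> * ((?N (r t) + ?N d) * ?N (g (y(j := t)) - g y))"
      proof -
        have "\<bar>F (r t + d) (g (y(j := t)) - g y)\<bar> \<le> C * (?N (r t + d) * ?N (g (y(j := t)) - g y))"
          by (rule C[OF rdV gV])
        also have "\<dots> \<le> \<bar>C\<bar> * (?N (r t + d) * ?N (g (y(j := t)) - g y))"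
          using G_nonneg rdV gV by (intro mult_right_mono) auto
        also have "\<dots> \<le> \<bar>C\<bar> * ((?N (r t) + ?N d) * ?N (g (y(j := t)) - g y))"
          using G_nonneg gV by (intro mult_left_mono mult_right_mono symbil_triangle[OF G G_nonneg rV d(1)]) auto
        finally show ?thesis .
      qed
      moreover have "F (f (y(j := y j)) - f y) (g (y(j := y j)) - g y) = 0"
        using symbil_zero(1)[OF sF symbil_mem(4)[OF sF]] by simp
      ultimately show "norm ((F (f (y(j := t)) - f y) (g (y(j := t)) - g y) - F (f (y(j := y j)) - f y) (g (y(j := y j)) - g y)) / (t - y j))
        \<le> \<bar>C\<bar> * ((?N (r t) + ?N d) * ?N (g (y(j := t)) - g y))"
        by (simp only: real_norm_def diff_zero)
    qed
    show "((\<lambda>t. \<bar>C\<bar> * ((?N (r t) + ?N d) * ?N (g (y(j := t)) - g y))) \<longlongrightarrow> 0) (at (y j) within {-1/2..1/2})"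
      using tendsto_mult[OF tendsto_const[of "\<bar>C\<bar>"] tendsto_mult[OF tendsto_add[OF lim tendsto_const[of "?N d"]] vpartial_continuous[OF y g]]]
      by simp
  qed
  have "partial j y (\<lambda>z. F (f z) (g y) + F (g z) (f y) + F (f z - f y) (g z - g y) + - F (f y) (g y)) (F d (g y) + F (f y) e + 0 + 0)"
    by (intro partial_add partial_const 1 2 3)
  then have "((\<lambda>t. F (f (y(j := t))) (g y) + F (g (y(j := t))) (f y) + F (f (y(j := t)) - f y) (g (y(j := t)) - g y) + - F (f y) (g y))
     has_real_derivative (F d (g y) + F (f y) e)) (at (y j) within {-1/2..1/2})" by (simp add: partial_def)
  then show ?thesis
    unfolding partial_def
  proof (rule has_real_derivative_eq_on[OF box_nth[OF y], rotated])
    fix t :: real assume t: "t \<in> {-1/2..1/2}"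
    have V: "f (y(j := t)) \<in> V" "f y \<in> V" "g (y(j := t)) \<in> V" "g y \<in> V" using fV box_update[OF y t] y by auto
    show "F (f (y(j := t))) (g (y(j := t))) =
      F (f (y(j := t))) (g y) + F (g (y(j := t))) (f y) + F (f (y(j := t)) - f y) (g (y(j := t)) - g y) + - F (f y) (g y)"
      using V symbil_sym[OF sF V(3,2)] by (simp add: symbil_simps[OF sF])
  qed
qed

definition uS where "uS S y = u (set_mi S) y"
definition lS where "lS S y = lam (set_mi S) y"

lemma uS_V: "finite S \<Longrightarrow> y \<in> param_box \<Longrightarrow> uS S y \<in> V"
  unfolding uS_def by (intro u_V set_mi_multi_index)

lemma uS_deriv: "finite S \<Longrightarrow> x \<notin> S \<Longrightarrow> y \<in> param_box \<Longrightarrow> vpartial (fst x) y (uS S) (uS (insert x S) y)"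
  using u_deriv[OF set_mi_multi_index, of S y "fst x"] uS_V[of "insert x S" y] uS_V[of S]
  unfolding vpartial_def uS_def[abs_def] by (simp add: set_mi_insert)

lemma lS_deriv: "finite S \<Longrightarrow> x \<notin> S \<Longrightarrow> y \<in> param_box \<Longrightarrow> partial (fst x) y (lS S) (lS (insert x S) y)"
  using lam_deriv[OF set_mi_multi_index, of S y "fst x"] unfolding lS_def[abs_def] by (simp add: set_mi_insert)

lemma forms: "bounded_form M" "bounded_form (B j)" "y \<in> param_box \<Longrightarrow> bounded_form (A y)"
  unfolding bounded_form_def using M M_bounded B B_bounded A A_bounded by blast+

text \<open>Differentiating the identity for \<open>S\<close> in the direction of \<open>x\<close>
  gives the one for \<open>insert x S\<close>: the subsets of the larger set split according to
  whether they contain \<open>x\<close>, matching the two terms of the product rule. The right-hand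
  side is constant in y.\<close>

lemma normalisation_identity:
  assumes "finite S" "y \<in> param_box"
  shows "(\<Sum>T\<in>Pow S. M (uS T y) (uS (S - T) y)) = (if S = {} then 1 else 0)"
  using assms
proof (induction S arbitrary: y rule: finite_induct)
  case empty
  then show ?case using normalised by (simp add: uS_def set_mi_empty)
next
  case (insert x S)
  have "partial (fst x) y (\<lambda>z. \<Sum>T\<in>Pow S. M (uS T z) (uS (S - T) z))
      (\<Sum>T\<in>Pow S. M (uS (insert x T) y) (uS (S - T) y) + M (uS T y) (uS (insert x (S - T)) y))"
  proof (rule partial_sum)
    fix T assume T: "T \<in> Pow S"
    then have "finite T" "x \<notin> T" "finite (S - T)" "x \<notin> S - T" using insert finite_subset by auto
    then show "partial (fst x) y (\<lambda>z. M (uS T z) (uS (S - T) z))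
      (M (uS (insert x T) y) (uS (S - T) y) + M (uS T y) (uS (insert x (S - T)) y))"
      by (intro partial_form[OF insert.prems forms(1)] uS_deriv insert.prems)
  qed
  from partial_unique[OF insert.prems this partial_const insert.IH]
  have "(\<Sum>T\<in>Pow S. M (uS (insert x T) y) (uS (S - T) y) + M (uS T y) (uS (insert x (S - T)) y)) = 0" .
  moreover have "(\<Sum>T\<in>Pow (insert x S). M (uS T y) (uS (insert x S - T) y)) =
      (\<Sum>T\<in>Pow S. M (uS T y) (uS (insert x (S - T)) y)) + (\<Sum>T\<in>Pow S. M (uS (insert x T) y) (uS (S - T) y))"
  proof -
    have *: "insert x S - T = insert x (S - T)" "insert x S - insert x T = S - T" if "T \<in> Pow S" for T
      using that insert by auto
    show ?thesis unfolding sum_Pow_insert[OF insert(1,2)]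
      by (intro arg_cong2[of _ _ _ _ "(+)"] sum.cong refl) (simp_all only: *)
  qed
  ultimately show ?case by (simp add: sum.distrib)
qed

text \<open>Since \<open>A\<close> is affine in y, at most one differentiation can fall on the form;
  each pair in \<open>S\<close> may be that one, which gives the sum of the \<open>B\<close>
  terms.\<close>

lemma eigenvalue_identity:
  assumes "finite S" "y \<in> param_box" "v \<in> V"
  shows "A y (uS S y) v + (\<Sum>s\<in>S. B (fst s) (uS (S - {s}) y) v) = (\<Sum>T\<in>Pow S. lS (S - T) y * M (uS T y) v)"
  using assms(1,2)
proof (induction S arbitrary: y rule: finite_induct)
  case empty
  then show ?case using eig assms(3) by (simp add: uS_def lS_def set_mi_empty)
next
  case (insert x S)
  note y = insert.prems and v = assms(3)
  let ?j = "fst x"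
  have fS: "finite S" "x \<notin> S" using insert by auto
  have A: "partial ?j y (\<lambda>z. A z (uS S z) v) (A y (uS (insert x S) y) v + B ?j (uS S y) v)"
  proof -
    have "((\<lambda>t. A y (uS S (y(?j := t))) v + (t - y ?j) * B ?j (uS S (y(?j := t))) v) has_real_derivative
        A y (uS (insert x S) y) v + (1 * B ?j (uS S y) v + (y ?j - y ?j) * B ?j (uS (insert x S) y) v)) (at (y ?j) within {-1/2..1/2})"
    proof (intro DERIV_add)
      show "((\<lambda>t. A y (uS S (y(?j := t))) v) has_real_derivative A y (uS (insert x S) y) v) (at (y ?j) within {-1/2..1/2})"
        using partial_form_left[OF y forms(3)[OF y] uS_deriv[OF fS y] v] by (simp add: partial_def)
      have "((\<lambda>t. B ?j (uS S (y(?j := t))) v) has_real_derivative B ?j (uS (insert x S) y) v) (at (y ?j) within {-1/2..1/2})"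
        using partial_form_left[OF y forms(2) uS_deriv[OF fS y] v] by (simp add: partial_def)
      moreover have "((\<lambda>t. t - y ?j) has_real_derivative 1) (at (y ?j) within {-1/2..1/2})"
        by (auto intro!: derivative_eq_intros)
      ultimately show "((\<lambda>t. (t - y ?j) * B ?j (uS S (y(?j := t))) v) has_real_derivative
          1 * B ?j (uS S y) v + (y ?j - y ?j) * B ?j (uS (insert x S) y) v) (at (y ?j) within {-1/2..1/2})"
        using DERIV_mult[of "\<lambda>t. t - y ?j" 1 "y ?j" "{-1/2..1/2}"] by (fastforce simp: mult.commute)
    qed
    then have D: "((\<lambda>t. A y (uS S (y(?j := t))) v + (t - y ?j) * B ?j (uS S (y(?j := t))) v) has_real_derivative
        A y (uS (insert x S) y) v + B ?j (uS S y) v) (at (y ?j) within {-1/2..1/2})" by simp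
    show ?thesis
      unfolding partial_def
      by (rule has_real_derivative_eq_on[OF box_nth[OF y] _ D])
        (use A_update[OF y _ uS_V[OF fS(1) box_update[OF y]] v] in simp)
  qed
  have S: "partial ?j y (\<lambda>z. \<Sum>s\<in>S. B (fst s) (uS (S - {s}) z) v) (\<Sum>s\<in>S. B (fst s) (uS (insert x (S - {s})) y) v)"
    using fS by (intro partial_sum partial_form_left[OF y forms(2) uS_deriv[OF _ _ y] v]) auto
  have R: "partial ?j y (\<lambda>z. \<Sum>T\<in>Pow S. lS (S - T) z * M (uS T z) v)
     (\<Sum>T\<in>Pow S. lS (insert x (S - T)) y * M (uS T y) v + lS (S - T) y * M (uS (insert x T) y) v)"
  proof (rule partial_sum)
    fix T assume T: "T \<in> Pow S"
    then have "finite T" "x \<notin> T" "finite (S - T)" "x \<notin> S - T" using fS finite_subset by auto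
    then show "partial ?j y (\<lambda>z. lS (S - T) z * M (uS T z) v)
       (lS (insert x (S - T)) y * M (uS T y) v + lS (S - T) y * M (uS (insert x T) y) v)"
      by (intro partial_mult[OF lS_deriv partial_form_left[OF y forms(1) _ v]] uS_deriv y)
  qed
  have main: "A y (uS (insert x S) y) v + B ?j (uS S y) v + (\<Sum>s\<in>S. B (fst s) (uS (insert x (S - {s})) y) v)
    = (\<Sum>T\<in>Pow S. lS (insert x (S - T)) y * M (uS T y) v + lS (S - T) y * M (uS (insert x T) y) v)"
    by (rule partial_unique[OF y partial_add[OF A S] R insert.IH])
  have "(\<Sum>s\<in>insert x S. B (fst s) (uS (insert x S - {s}) y) v) = B ?j (uS S y) v + (\<Sum>s\<in>S. B (fst s) (uS (insert x (S - {s})) y) v)"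
  proof -
    have "insert x S - {s} = insert x (S - {s})" if "s \<in> S" for s using that fS by auto
    then show ?thesis using fS by (simp cong: sum.cong)
  qed
  moreover have "(\<Sum>T\<in>Pow (insert x S). lS (insert x S - T) y * M (uS T y) v) =
      (\<Sum>T\<in>Pow S. lS (insert x (S - T)) y * M (uS T y) v) + (\<Sum>T\<in>Pow S. lS (S - T) y * M (uS (insert x T) y) v)"
  proof -
    have *: "insert x S - T = insert x (S - T)" "insert x S - insert x T = S - T" if "T \<in> Pow S" for T
      using that insert by auto
    show ?thesis unfolding sum_Pow_insert[OF fS]
      by (intro arg_cong2[of _ _ _ _ "(+)"] sum.cong refl) (simp_all only: *)
  qed
  ultimately show ?case using main by (simp add: sum.distrib)
qed

end

section \<open>The derivative bounds\<close>

lemma C_eps_nonneg: "\<epsilon> \<in> {0<..<1} \<Longrightarrow> C_eps \<epsilon> \<ge> 0"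
  using sum_binomial_powr_le[of \<epsilon> 0] by simp

context
  fixes amin amax x1 x2 \<delta> :: real
  assumes pos: "amin > 0" "amax > 0" "x1 > 0" "x2 > 0" "\<delta> > 0"
begin

lemma eig_bounds_pos: "eig_upper amin amax x1 > 0" "eig_upper amin amax x2 > 0" "eig_lower amin amax x1 > 0" "eigfun_upper amin amax x1 > 0"
  using pos by (simp_all add: eig_upper_def eig_lower_def eigfun_upper_def)

lemma eigfun_upper_square: "(eigfun_upper amin amax x1)\<^sup>2 = amax * (x1 + 1) / amin\<^sup>2"
  using pos by (simp add: eigfun_upper_def power_divide)

lemma eig_ratio: "amax / x1 * (eigfun_upper amin amax x1)\<^sup>2 = eig_upper amin amax x1 / eig_lower amin amax x1"
  unfolding eigfun_upper_square using pos
  by (simp add: eig_upper_def eig_lower_def field_simps power2_eq_square)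

lemma eig_ratio_scaled: "amin\<^sup>2 * eig_upper amin amax x1 / (amax\<^sup>2 * eig_lower amin amax x1) = 1 + 1 / x1"
  using pos by (simp add: eig_upper_def eig_lower_def field_simps power2_eq_square)

lemma C_gap_pos: "C_gap amin amax x2 \<delta> > 0"
  using pos eig_bounds_pos by (simp add: C_gap_def)

text \<open>This form shows the three ingredients separately: the bound for the perturbing forms,
  the constant \<open>K\<close> of the recursion, and the coercivity constant.\<close>

lemma C_beta_eq: "C_beta amin amax x1 x2 \<delta> \<epsilon> =
    (1 + 1 / x1) * (3/2 * (amax / x1 * (eigfun_upper amin amax x1)\<^sup>2) * C_eps \<epsilon> + 1) / C_gap amin amax x2 \<delta>"
  unfolding C_beta_def eig_ratio_scaled eig_ratio by simp

lemma C_beta_pos: "\<epsilon> \<in> {0<..<1} \<Longrightarrow> C_beta amin amax x1 x2 \<delta> \<epsilon> > 0"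
  unfolding C_beta_eq using C_eps_nonneg[of \<epsilon>] C_gap_pos pos
  by (intro divide_pos_pos mult_pos_pos add_nonneg_pos mult_nonneg_nonneg) auto

text \<open>The recursion bounds the eigenvalue derivatives by multiples of \<open>C_gap\<close>
  times the squared eigenfunction bound. As \<delta> is at most the bound for the second eigenvalue,
  \<open>C_gap\<close> is at most \<open>amin\<close>, and the product stays below the bound for the
  first eigenvalue.\<close>

lemma C_gap_eigfun_le:
  assumes "\<delta> \<le> eig_upper amin amax x2"
  shows "C_gap amin amax x2 \<delta> * (eigfun_upper amin amax x1)\<^sup>2 \<le> eig_upper amin amax x1"
proof -
  have "C_gap amin amax x2 \<delta> \<le> amin"
    unfolding C_gap_def using assms pos eig_bounds_pos by (simp add: divide_le_eq mult_left_mono)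
  then have "C_gap amin amax x2 \<delta> * (eigfun_upper amin amax x1)\<^sup>2 \<le> amin * (eigfun_upper amin amax x1)\<^sup>2"
    by (intro mult_right_mono) auto
  also have "\<dots> = eig_upper amin amax x1"
    unfolding eigfun_upper_square using pos by (simp add: eig_upper_def field_simps power2_eq_square)
  finally show ?thesis .
qed

end

lemma L2_sqrt_le_grad:
  assumes D: "open D" "bounded D" and chi: "dirichlet_eigenvalues D \<chi>s" and pos: "\<chi>s 1 > 0"
    and v: "v \<in> H10 D" and w: "w \<in> H10 D"
    and P: "\<And>v. v \<in> H10 D \<Longrightarrow> \<chi>s 1 * L2_inner D v v \<le> grad_inner D v v"
  shows "sqrt (L2_inner D v v) * sqrt (L2_inner D w w) \<le> 1 / \<chi>s 1 * (sqrt (grad_inner D v v) * sqrt (grad_inner D w w))"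
proof -
  have "sqrt (L2_inner D v v) \<le> sqrt (grad_inner D v v) / sqrt (\<chi>s 1)" if "v \<in> H10 D" for v
    using P[OF that] pos by (simp flip: real_sqrt_divide add: field_simps)
  then have "sqrt (L2_inner D v v) * sqrt (L2_inner D w w) \<le> (sqrt (grad_inner D v v) / sqrt (\<chi>s 1)) * (sqrt (grad_inner D w w) / sqrt (\<chi>s 1))"
    using v w pos by (intro mult_mono) (auto simp: L2_inner_nonneg grad_inner_nonneg)
  also have "\<dots> = 1 / \<chi>s 1 * (sqrt (grad_inner D v v) * sqrt (grad_inner D w w))"
    using pos by simp
  finally show ?thesis .
qed

theorem lemma3p4:
  fixes D :: "(real^'n) set"
    and a0 b0 c :: "real^'n \<Rightarrow> real"
    and a b :: "nat \<Rightarrow> real^'n \<Rightarrow> real"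
    and amin amax \<delta> \<epsilon> :: real
    and \<chi>s :: "nat \<Rightarrow> real"
    and lam :: "nat \<Rightarrow> (nat \<Rightarrow> real) \<Rightarrow> real"
    and u1 :: "(nat \<Rightarrow> real) \<Rightarrow> real^'n \<Rightarrow> real"
    and dlam1 :: "(nat \<Rightarrow> nat) \<Rightarrow> (nat \<Rightarrow> real) \<Rightarrow> real"
    and du1 :: "(nat \<Rightarrow> nat) \<Rightarrow> (nat \<Rightarrow> real) \<Rightarrow> real^'n \<Rightarrow> real"
    and \<beta> :: "nat \<Rightarrow> real"
    and \<nu> :: "nat \<Rightarrow> nat"
  assumes dim: "CARD('n) \<in> {1, 2, 3}"
    and D: "convex_lipschitz_domain D"
    and A1: "assumption_A1 D a0 a b0 b c amin"
    and amax: "amax = coeff_max D a0 a b0 b c"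
    and chi: "dirichlet_eigenvalues D \<chi>s"
    and lam: "\<And>y. y \<in> param_box \<Longrightarrow>
        eigenvalues_with_multiplicity D
          (A_form D (affine_coeff a0 a y) (affine_coeff b0 b y)) (M_form D c) (\<lambda>k. lam k y)"
    and u1: "\<And>y. y \<in> param_box \<Longrightarrow>
        normalised_eigenfunction D
          (A_form D (affine_coeff a0 a y) (affine_coeff b0 b y)) (M_form D c) (lam 1 y) (u1 y)"
    and dlam1: "mixed_partials (lam 1) dlam1"
    and du1: "mixed_partials_V D u1 du1"
    and gap: "\<delta> > 0" "\<And>y. y \<in> param_box \<Longrightarrow> lam 2 y - lam 1 y \<ge> \<delta>"
    and eps: "\<epsilon> \<in> {0<..<1}"
    and nu: "\<nu> \<in> multi_indices"
    and beta: "\<And>j. \<beta> j = C_beta amin amax (\<chi>s 1) (\<chi>s 2) \<delta> \<epsilon>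
                            * max (Linf_norm D (a j)) (Linf_norm D (b j))"
  shows "C_beta amin amax (\<chi>s 1) (\<chi>s 2) \<delta> \<epsilon> > 0 \<and>
    (\<forall>y\<in>param_box.
       \<bar>dlam1 \<nu> y\<bar>
         \<le> eig_upper amin amax (\<chi>s 1) * fact (mi_order \<nu>) powr (1 + \<epsilon>) * mi_power \<beta> \<nu> \<and>
       V_norm D (du1 \<nu> y)
         \<le> eigfun_upper amin amax (\<chi>s 1) * fact (mi_order \<nu>) powr (1 + \<epsilon>) * mi_power \<beta> \<nu>)"
proof -
  have oD: "open D" and bD: "bounded D" and nD: "D \<noteq> {}"
    using D by (auto simp: convex_lipschitz_domain_def)
  have Linf: "a0 \<in> Linf D" "\<And>j. a j \<in> Linf D" "b0 \<in> Linf D" "\<And>j. b j \<in> Linf D" "c \<in> Linf D"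
    and amin: "amin > 0" and low: "\<And>y. y \<in> param_box \<Longrightarrow> AE x in lebesgue_on D.
         affine_coeff a0 a y x \<ge> amin \<and> affine_coeff b0 b y x \<ge> 0 \<and> c x \<ge> amin"
    using A1 unfolding assumption_A1_def by blast+
  obtain p where p: "p \<in> {0<..<1}" "summable (\<lambda>j. Linf_norm D (a j) powr p)" "summable (\<lambda>j. Linf_norm D (b j) powr p)"
    using A1 unfolding assumption_A1_def by blast
  have sa: "summable (\<lambda>j. Linf_norm D (a j))"
    by (rule summable_of_powr[OF p(1) Linf_norm_nonneg[OF Linf(2) oD nD] p(2)])
  have sb: "summable (\<lambda>j. Linf_norm D (b j))"
    by (rule summable_of_powr[OF p(1) Linf_norm_nonneg[OF Linf(4) oD nD] p(3)])
  have le_amax: "(SUP y\<in>param_box. Linf_norm D (affine_coeff a0 a y)) \<le> amax"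
    "(SUP y\<in>param_box. Linf_norm D (affine_coeff b0 b y)) \<le> amax" "Linf_norm D c \<le> amax"
    unfolding amax coeff_max_def by (intro Max_ge; simp)+
  have bc_c: "bounded_coeff D amax c"
    using Linf_bounded_coeff[OF Linf(5) oD nD] le_amax(3) by (auto simp: bounded_coeff_def elim: eventually_mono)
  have ell: "elliptic D (affine_coeff a0 a y) (affine_coeff b0 b y) c amin amax" if y: "y \<in> param_box" for y
  proof
    show "bounded_coeff D amax (affine_coeff a0 a y)"
      by (rule affine_bounded_coeff[OF oD nD Linf(1,2) sa y le_amax(1)])
    show "bounded_coeff D amax (affine_coeff b0 b y)"
      by (rule affine_bounded_coeff[OF oD nD Linf(3,4) sb y le_amax(2)])
    show "AE x in lebesgue_on D. amin \<le> affine_coeff a0 a y x" "AE x in lebesgue_on D. 0 \<le> affine_coeff b0 b y x"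
      "AE x in lebesgue_on D. amin \<le> c x"
      using low[OF y] by (auto elim: eventually_mono)
  qed (use oD bD amin bc_c in auto)
  \<comment> \<open>One parameter value is enough for the facts that do not depend on y: positivity
    of \<open>amax\<close> and of the Dirichlet eigenvalues, and the Poincare inequality with the
    first of them.\<close>
  have y0: "(\<lambda>_. 0) \<in> param_box" by (simp add: param_box_def)
  interpret E0: elliptic D "affine_coeff a0 a (\<lambda>_. 0)" "affine_coeff b0 b (\<lambda>_. 0)" c amin amax by (rule ell[OF y0])
  have amax_pos: "amax > 0" using E0.kappa_K[OF nD] amin by linarith
  have chi1: "\<chi>s 1 > 0" by (rule E0.chi_pos[OF lam[OF y0] chi])
  have chi2: "\<chi>s 2 > 0" using E0.chi_mono[OF lam[OF y0] chi] chi1 by linarith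
  note Poincare = E0.Poincare_chi[OF lam[OF y0] chi]
  note const_pos = amin amax_pos chi1 chi2 gap(1)
  let ?Cb = "C_beta amin amax (\<chi>s 1) (\<chi>s 2) \<delta> \<epsilon>"
  let ?G = "grad_inner D" and ?N = "\<lambda>v. sqrt (grad_inner D v v)"
  let ?A = "\<lambda>y. A_form D (affine_coeff a0 a y) (affine_coeff b0 b y)"
  have Cb: "?Cb > 0" by (rule C_beta_pos[OF const_pos eps])
  have LG: "sqrt (L2_inner D v v) * sqrt (L2_inner D w w) \<le> 1 / \<chi>s 1 * (?N v * ?N w)" if "v \<in> H10 D" "w \<in> H10 D" for v w
    by (rule L2_sqrt_le_grad[OF oD bD chi chi1 that Poincare])
  have A_bd: "\<bar>A_form D f g v w\<bar> \<le> K * (1 + 1 / \<chi>s 1) * (?N v * ?N w)"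
    if "bounded_coeff D K f" "bounded_coeff D K g" "v \<in> H10 D" "w \<in> H10 D" for f g v w K
  proof -
    have "K \<ge> 0" using that(1) by (simp add: bounded_coeff_def)
    from mult_left_mono[OF LG[OF that(3,4)] this] A_form_le[OF oD bD that]
    show ?thesis by (simp add: algebra_simps)
  qed
  have M_bd: "\<bar>M_form D c v w\<bar> \<le> amax / \<chi>s 1 * (?N v * ?N w)" if "v \<in> H10 D" "w \<in> H10 D" for v w
    using order_trans[OF M_form_le[OF oD bD bc_c that] mult_left_mono[OF LG[OF that]]] amax_pos by simp
  define mx where "mx j = max (Linf_norm D (a j)) (Linf_norm D (b j))" for j
  have bc_mx: "bounded_coeff D (mx j) (a j)" "bounded_coeff D (mx j) (b j)" for j
    using Linf_bounded_coeff[OF Linf(2) oD nD, of j] Linf_bounded_coeff[OF Linf(4) oD nD, of j]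
    by (auto simp: bounded_coeff_def mx_def elim: eventually_mono)
  have mx0: "mx j \<ge> 0" for j using bc_mx(1)[of j] by (simp add: bounded_coeff_def)
  have eigen: "u1 y \<in> eigenspace D (?A y) (M_form D c) (lam 1 y)" "M_form D c (u1 y) (u1 y) = 1" if "y \<in> param_box" for y
    using u1[OF that] by (simp_all add: normalised_eigenfunction_def real_sqrt_eq_1_iff)
  have d0: "dlam1 (\<lambda>_. 0) y = lam 1 y" "du1 (\<lambda>_. 0) y = u1 y" if "y \<in> param_box" for y
    using dlam1 du1 that by (auto simp: mixed_partials_def mixed_partials_V_def)
  interpret F: parametric_family "H10 D" ?G "M_form D c" ?A "\<lambda>j. A_form D (a j) (b j)" dlam1 du1
  proof
    fix y assume y: "y \<in> param_box"
    interpret E: elliptic D "affine_coeff a0 a y" "affine_coeff b0 b y" c amin amax by (rule ell[OF y])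
    show "symbil (H10 D) (?A y)" by (rule E.sA)
    show "\<exists>C. \<forall>v\<in>H10 D. \<forall>w\<in>H10 D. \<bar>?A y v w\<bar> \<le> C * (?N v * ?N w)"
      using A_bd[OF E.p(1) E.q(1)] by blast
    show "?A (y(j := t)) v w = ?A y v w + (t - y j) * A_form D (a j) (b j) v w"
      if "t \<in> {-1/2..1/2}" "v \<in> H10 D" "w \<in> H10 D" for j t v w
      by (rule A_form_affine[OF E.p(1) bc_mx(1) E.q(1) bc_mx(2) oD bD that(2,3)
          affine_measurable[OF oD nD Linf(1,2) sa] affine_measurable[OF oD nD Linf(3,4) sb]
          affine_update[OF oD nD Linf(1,2) sa y] affine_update[OF oD nD Linf(3,4) sb y]])
    show "?A y (du1 (\<lambda>_. 0) y) v = dlam1 (\<lambda>_. 0) y * M_form D c (du1 (\<lambda>_. 0) y) v" if "v \<in> H10 D" for v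
      using eigen(1)[OF y] that by (simp add: d0[OF y] eigenspace_def)
    show "M_form D c (du1 (\<lambda>_. 0) y) (du1 (\<lambda>_. 0) y) = 1" using eigen(2)[OF y] by (simp add: d0[OF y])
    fix \<mu> :: "nat \<Rightarrow> nat" assume mu: "\<mu> \<in> multi_indices"
    show "du1 \<mu> y \<in> H10 D" using du1 mu y by (simp add: mixed_partials_V_def)
    fix j
    show "partial j y (dlam1 \<mu>) (dlam1 (\<mu>(j := Suc (\<mu> j))) y)"
      using dlam1 mu y by (simp add: mixed_partials_def partial_def)
    have eq: "(1 / (t - y j)) *\<^sub>R (du1 \<mu> (y(j := t)) - du1 \<mu> y) - du1 (\<mu>(j := Suc (\<mu> j))) y
       = (\<lambda>x. (du1 \<mu> (y(j := t)) x - du1 \<mu> y x) / (t - y j) - du1 (\<mu>(j := Suc (\<mu> j))) y x)" for t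
      by (simp add: fun_eq_iff)
    show "((\<lambda>t. let d = (1 / (t - y j)) *\<^sub>R (du1 \<mu> (y(j := t)) - du1 \<mu> y) - du1 (\<mu>(j := Suc (\<mu> j))) y in ?N d) \<longlongrightarrow> 0)
          (at (y j) within {-1/2..1/2})"
      unfolding Let_def eq using du1 mu y by (simp add: mixed_partials_V_def V_norm_eq)
  next
    show "symbil (H10 D) ?G" by (rule symbil_H10(3)[OF oD bD])
    show "symbil (H10 D) (M_form D c)" by (rule E0.sM)
    show "symbil (H10 D) (A_form D (a j) (b j))" for j by (rule symbil_A_form[OF oD bD bc_mx])
    show "?G v v \<ge> 0" for v by (rule grad_inner_nonneg)
    show "\<exists>C. \<forall>v\<in>H10 D. \<forall>w\<in>H10 D. \<bar>M_form D c v w\<bar> \<le> C * (?N v * ?N w)" using M_bd by blast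
    show "\<exists>C. \<forall>v\<in>H10 D. \<forall>w\<in>H10 D. \<bar>A_form D (a j) (b j) v w\<bar> \<le> C * (?N v * ?N w)" for j
      using A_bd[OF bc_mx] by blast
  qed
  define U where "U = eigfun_upper amin amax (\<chi>s 1)"
  define \<gamma> where "\<gamma> = C_gap amin amax (\<chi>s 2) \<delta>"
  define K where "K = 3/2 * (amax / \<chi>s 1 * U\<^sup>2) * C_eps \<epsilon> + 1"
  have gam: "\<gamma> > 0" unfolding \<gamma>_def by (rule C_gap_pos[OF const_pos])
  have U0: "U > 0" unfolding U_def by (rule eig_bounds_pos[OF const_pos])
  have K1: "K \<ge> 1" using C_eps_nonneg[OF eps] amax_pos chi1 by (simp add: K_def)
  \<comment> \<open>The purpose of the choice of \<open>C_beta\<close>: \<beta> j \<gamma> / K is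
    exactly the bound for the form with coefficients \<open>a j\<close> and \<open>b j\<close>,
    where the zero-order part costs 1/\<chi>_1 by the Poincare inequality.\<close>
  have beta_K: "\<beta> j * \<gamma> / K = mx j * (1 + 1 / \<chi>s 1)" for j
    using gam K1 unfolding beta C_beta_eq[OF const_pos] U_def[symmetric] \<gamma>_def[symmetric] K_def[symmetric] mx_def[symmetric]
    by simp
  have beta0: "\<beta> j \<ge> 0" for j using Cb mx0[of j] unfolding beta mx_def by simp
  have "\<bar>dlam1 \<nu> y\<bar> \<le> eig_upper amin amax (\<chi>s 1) * (fact (mi_order \<nu>) powr (1 + \<epsilon>) * mi_power \<beta> \<nu>) \<and>
       V_norm D (du1 \<nu> y) \<le> U * (fact (mi_order \<nu>) powr (1 + \<epsilon>) * mi_power \<beta> \<nu>)" if y: "y \<in> param_box" for y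
  proof -
    interpret E: elliptic D "affine_coeff a0 a y" "affine_coeff b0 b y" c amin amax by (rule ell[OF y])
    note ly = lam[OF y]
    have l_pos: "lam 1 y > 0" by (rule E.first_eigenvalue_pos[OF ly])
    have gap_y: "lam 1 y < lam 2 y" using gap(1) gap(2)[OF y] by linarith
    have l1: "lam 1 y \<le> eig_upper amin amax (\<chi>s 1)"
      using E.first_eigenvalue_upper[OF ly chi] by (simp add: eig_upper_def)
    have l2: "lam 2 y \<le> eig_upper amin amax (\<chi>s 2)"
      using E.second_eigenvalue_upper[OF ly chi eigen[OF y] gap_y] by (simp add: eig_upper_def)
    have uH: "u1 y \<in> H10 D" and Au: "?A y (u1 y) (u1 y) = lam 1 y"
      using eigen[OF y] by (auto simp: eigenspace_def)
    have u_le: "?N (u1 y) \<le> U"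
    proof (rule real_le_lsqrt)
      have "amin * ?G (u1 y) (u1 y) \<le> amax / amin * (\<chi>s 1 + 1)"
        using E.A_ge[OF uH] Au l1 by (simp add: eig_upper_def)
      then show "?G (u1 y) (u1 y) \<le> U\<^sup>2"
        unfolding U_def eigfun_upper_square[OF const_pos] using amin by (simp add: field_simps power2_eq_square)
    qed (use U0 grad_inner_nonneg in auto)
    have coercive: "\<gamma> * ?G v v \<le> ?A y v v - lam 1 y * M_form D c v v" if v: "v \<in> H10 D" "M_form D c v (u1 y) = 0" for v
    proof -
      have A0: "?A y v v \<ge> amin * ?G v v" by (rule E.A_ge[OF v(1)])
      have l2_pos: "lam 2 y > 0" using l_pos gap_y by linarith
      \<comment> \<open>On the orthogonal complement of the eigenfunction \<lambda>_2 M \<le> A, and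
        \<lambda>_2 (A - \<lambda>_1 M) - (\<lambda>_2 - \<lambda>_1) A = \<lambda>_1 (A -
        \<lambda>_2 M). Hence A - \<lambda>_1 M is at least the fraction (\<lambda>_2 - \<lambda>_1)
        / \<lambda>_2 of A, which gives the constant \<open>C_gap\<close>.\<close>
      have "\<delta> * (amin * ?G v v) \<le> (lam 2 y - lam 1 y) * ?A y v v"
        using gap gap(2)[OF y] A0 amin grad_inner_nonneg[of D v] by (intro mult_mono) auto
      also have "\<dots> \<le> lam 2 y * (?A y v v - lam 1 y * M_form D c v v)"
        using mult_left_mono[OF E.second_eigenvalue_min[OF ly eigen[OF y] gap_y v] less_imp_le[OF l_pos]]
        by (simp add: algebra_simps)
      finally have 1: "\<delta> * (amin * ?G v v) \<le> lam 2 y * (?A y v v - lam 1 y * M_form D c v v)" .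
      \<comment> \<open>The sign of A - \<lambda>_1 M is needed before \<lambda>_2(y) can be
        replaced by its bound uniform in y.\<close>
      have "0 \<le> \<delta> * (amin * ?G v v)" using gap(1) amin grad_inner_nonneg[of D v] by simp
      then have "0 \<le> ?A y v v - lam 1 y * M_form D c v v"
        using 1 l2_pos by (metis order_trans zero_le_mult_iff not_less)
      from order_trans[OF 1 mult_right_mono[OF l2 this]]
      have "amin * \<delta> * ?G v v \<le> eig_upper amin amax (\<chi>s 2) * (?A y v v - lam 1 y * M_form D c v v)" by (simp add: mult_ac)
      then show ?thesis
        using eig_bounds_pos(2)[OF const_pos] by (simp add: \<gamma>_def C_gap_def divide_le_eq mult_ac)
    qed
    have gU: "\<gamma> * U\<^sup>2 \<le> eig_upper amin amax (\<chi>s 1)"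
      unfolding \<gamma>_def U_def using gap(2)[OF y] l_pos l2 by (intro C_gap_eigfun_le[OF const_pos]) linarith
    have rec: "\<bar>F.lS S y\<bar> \<le> \<gamma> * U\<^sup>2 / K * (fact (card S) powr (1+\<epsilon>) * (\<Prod>s\<in>S. \<beta> (fst s))) \<and>
         ?N (F.uS S y) \<le> U / K * (fact (card S) powr (1+\<epsilon>) * (\<Prod>s\<in>S. \<beta> (fst s)))" if "finite S" "S \<noteq> {}" for S
    proof (rule recursion_bound[where V = "H10 D" and G = ?G and A = "?A y" and M = "M_form D c"
          and u = "\<lambda>S. F.uS S y" and l = "\<lambda>S. F.lS S y" and B = "\<lambda>s. A_form D (a (fst s)) (b (fst s))"
          and m = "amax / \<chi>s 1" and \<beta> = "\<lambda>s. \<beta> (fst s)"])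
      show "\<bar>A_form D (a (fst s)) (b (fst s)) v w\<bar> \<le> \<beta> (fst s) * \<gamma> / K * (?N v * ?N w)"
        if "v \<in> H10 D" "w \<in> H10 D" for s v w
        unfolding beta_K by (rule A_bd[OF bc_mx that])
      show "\<gamma> * ?G v v \<le> ?A y v v - F.lS {} y * M_form D c v v" if "v \<in> H10 D" "M_form D c v (F.uS {} y) = 0" for v
        using coercive[of v] that by (simp add: F.lS_def F.uS_def set_mi_empty d0[OF y])
      show "?N (F.uS {} y) \<le> U" using u_le by (simp add: F.uS_def set_mi_empty d0[OF y])
      show "(\<Sum>T\<in>Pow S. M_form D c (F.uS T y) (F.uS (S - T) y)) = (if S = {} then 1 else 0)" if "finite S" for S
        by (rule F.normalisation_identity[OF that y])
      show "\<bar>M_form D c v w\<bar> \<le> amax / \<chi>s 1 * (?N v * ?N w)" if "v \<in> H10 D" "w \<in> H10 D" for v w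
        by (rule M_bd[OF that])
      show "K = 3/2 * (amax / \<chi>s 1 * U\<^sup>2) * C_eps \<epsilon> + 1" by (rule K_def)
    qed (use that y amax_pos chi1 eps U0 gam beta0 in
        \<open>auto intro: E.sA E.sM symbil_H10(3)[OF oD bD] grad_inner_nonneg F.uS_V F.eigenvalue_identity\<close>)
    obtain S where S: "finite S" "set_mi S = \<nu>" "card S = mi_order \<nu>" "(\<Prod>s\<in>S. \<beta> (fst s)) = mi_power \<beta> \<nu>"
      using multi_index_set[OF nu] by metis
    define W where "W = fact (mi_order \<nu>) powr (1 + \<epsilon>) * mi_power \<beta> \<nu>"
    have W0: "W \<ge> 0" unfolding W_def S(4)[symmetric] using beta0 by (simp add: prod_nonneg)
    \<comment> \<open>The recursion speaks about derivatives of positive order and gives them the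
      gain 1 / K, which is discarded here; order zero is covered by the bounds for the eigenpair
      itself.\<close>
    show ?thesis
    proof (cases "S = {}")
      case True
      then have "\<nu> = (\<lambda>_. 0)" "W = 1" using S by (auto simp: set_mi_empty W_def)
      then show ?thesis using l_pos l1 u_le by (simp add: d0[OF y] V_norm_eq W_def)
    next
      case False
      have "\<bar>dlam1 \<nu> y\<bar> \<le> \<gamma> * U\<^sup>2 / K * W" "V_norm D (du1 \<nu> y) \<le> U / K * W"
        using rec[OF S(1) False] by (simp_all add: F.lS_def F.uS_def S(2,3,4) W_def V_norm_eq)
      moreover have "\<gamma> * U\<^sup>2 / K * W \<le> eig_upper amin amax (\<chi>s 1) * W"
      proof (intro mult_right_mono W0)
        have "\<gamma> * U\<^sup>2 / K \<le> \<gamma> * U\<^sup>2 / 1" using K1 gam by (intro divide_left_mono) auto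
        then show "\<gamma> * U\<^sup>2 / K \<le> eig_upper amin amax (\<chi>s 1)" using gU by simp
      qed
      moreover have "U / K * W \<le> U * W"
      proof (intro mult_right_mono W0)
        have "U / K \<le> U / 1" using K1 U0 by (intro divide_left_mono) auto
        then show "U / K \<le> U" by simp
      qed
      ultimately show ?thesis by (simp add: W_def)
    qed
  qed
  then show ?thesis using Cb by (simp add: U_def mult.assoc)
qed

end
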